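(* Let $N\ge 3$ be an integer and let $0<\theta<\varsigma<\pi/2$. Suppose that each of the operators $\mathcal{A}^{\Pi_N^{\varsigma}}$ and $\mathcal{A}^{\Pi_N^{\theta}}$ has at least $k$ eigenvalues (counted with multiplicity) below its own essential spectrum threshold. Then $$\lambda_j(\mathcal{A}^{\Pi_N^{\theta}})\le \lambda_j(\mathcal{A}^{\Pi_N^{\varsigma}})\qquad\text{for all } 1\le j\le k.$$
   Context: For a domain $\Omega\subset\mathbb{R}^d$, let $H_0^1(\Omega)$ be the Sobolev space of $H^1(\Omega)$ functions with zero trace on $\partial\Omega$. The Dirichlet Laplacian $\mathcal{A}^{\Omega}$ is the self-adjoint operator in $L_2(\Omega)$ generated by the closed positive form $\mathfrak{a}_\Omega[u,v]=(\nabla u,\nabla v)_{L_2(\Omega)}$ with domain $H_0^1(\Omega)$. Regular polyhedral layers. Use cylindrical coordinates $(r,\varphi,z)$ in $\mathbb{R}^3$ with $r\ge0$. Put $\psi_N=2\pi/N$. For $\theta\in(0,\pi/2)$ let $\Upsilon_N^\theta$ be the regular polyhedral angle (solid convex cone) with apex at the origin and $N$ faces, whose axis of rotational symmetry is the $z$-axis and each of whose faces makes the angle $\theta$ with this axis; explicitly, $$\Upsilon_N^\theta=\{(r,\varphi,z): z\sin\theta-r\cos\theta\cos(\varphi-j\psi_N)>0,\ 0\le j\le N-1\}.$$ The regular polyhedral layer of unit width is $\Pi_N^\theta=\{x\in\Upsilon_N^\theta:\operatorname{dist}(x,\partial\Upsilon_N^\theta)\in(0,1)\}$. The essential spectrum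 of $\mathcal{A}^{\Pi_N^\theta}$ is a ray $[\Lambda_\dagger^\theta,+\infty)$. The threshold $\Lambda_\dagger^\theta$ (which depends on $\theta$ and $N$) equals the first eigenvalue of the Dirichlet Laplacian in the planar V-shaped waveguide of unit width (the set of points inside a planar angle of magnitude $\beta$ at distance less than one from the boundary of that angle), where $\beta$ is the common inner dihedral angle of $\Upsilon_N^\theta$ along its edges. $\lambda_j(\mathcal{A}^{\Pi_N^\theta})$ denotes the $j$-th eigenvalue of $\mathcal{A}^{\Pi_N^\theta}$ below $\Lambda_\dagger^\theta$, the eigenvalues being listed in nondecreasing order and counted with multiplicity. *)

theory Defs
  imports "HOL-Analysis.Analysis"
begin

section \<open>The Hilbert space of square-integrable functions\<close>

text \<open>Elements of \<open>L2_space M\<close> are functions, not classes of functions; equality in the Hilbert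
  space is equality \<open>M\<close>-almost everywhere.\<close>

definition L2_space :: "'a measure \<Rightarrow> ('a \<Rightarrow> complex) set" where
  "L2_space M = {f \<in> borel_measurable M. integrable M (\<lambda>x. (cmod (f x))\<^sup>2)}"

definition L2_inner :: "'a measure \<Rightarrow> ('a \<Rightarrow> complex) \<Rightarrow> ('a \<Rightarrow> complex) \<Rightarrow> complex" where
  "L2_inner M f g = (\<integral>x. f x * cnj (g x) \<partial>M)"

definition L2_norm :: "'a measure \<Rightarrow> ('a \<Rightarrow> complex) \<Rightarrow> real" where
  "L2_norm M f = sqrt (\<integral>x. (cmod (f x))\<^sup>2 \<partial>M)"

definition L2_independent :: "'a measure \<Rightarrow> nat \<Rightarrow> (nat \<Rightarrow> 'a \<Rightarrow> complex) \<Rightarrow> bool" where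
  "L2_independent M n u \<longleftrightarrow>
     (\<forall>c :: nat \<Rightarrow> complex. (AE x in M. (\<Sum>i<n. c i * u i x) = 0) \<longrightarrow> (\<forall>i<n. c i = 0))"


section \<open>Spectra of unbounded operators\<close>

text \<open>An unbounded operator \<open>T\<close> in \<open>L2_space M\<close> is given by its graph: \<open>(u, f) \<in> T\<close> means that
  \<open>u\<close> is in the domain of \<open>T\<close> and \<open>T u = f\<close>.\<close>

text \<open>\<open>T - \<mu>\<close> maps the domain of \<open>T\<close> onto the whole space and has a bounded inverse (the estimate
  includes injectivity).\<close>

definition resolvent_set ::
    "'a measure \<Rightarrow> (('a \<Rightarrow> complex) \<times> ('a \<Rightarrow> complex)) set \<Rightarrow> complex set" where
  "resolvent_set M T =
     {\<mu>. (\<forall>f\<in>L2_space M. \<exists>u. (u, \<lambda>x. \<mu> * u x + f x) \<in> T) \<and>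
         (\<exists>C. \<forall>(u, g)\<in>T. L2_norm M u \<le> C * L2_norm M (\<lambda>x. g x - \<mu> * u x))}"

definition spectrum ::
    "'a measure \<Rightarrow> (('a \<Rightarrow> complex) \<times> ('a \<Rightarrow> complex)) set \<Rightarrow> complex set" where
  "spectrum M T = - resolvent_set M T"

text \<open>The dimension of the kernel of \<open>T - \<mu>\<close>; it is \<open>0\<close> if \<open>\<mu>\<close> is not an eigenvalue.\<close>

definition eigen_mult ::
    "'a measure \<Rightarrow> (('a \<Rightarrow> complex) \<times> ('a \<Rightarrow> complex)) set \<Rightarrow> complex \<Rightarrow> enat" where
  "eigen_mult M T \<mu> =
     Sup {enat n | n. \<exists>u. (\<forall>i<n. (u i, \<lambda>x. \<mu> * u i x) \<in> T) \<and> L2_independent M n u}"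

definition discrete_spectrum ::
    "'a measure \<Rightarrow> (('a \<Rightarrow> complex) \<times> ('a \<Rightarrow> complex)) set \<Rightarrow> complex set" where
  "discrete_spectrum M T =
     {\<mu>. \<mu> isolated_in spectrum M T \<and> 0 < eigen_mult M T \<mu> \<and> eigen_mult M T \<mu> < \<infinity>}"

definition essential_spectrum ::
    "'a measure \<Rightarrow> (('a \<Rightarrow> complex) \<times> ('a \<Rightarrow> complex)) set \<Rightarrow> complex set" where
  "essential_spectrum M T = spectrum M T - discrete_spectrum M T"

text \<open>The operators of interest are self-adjoint, so that their spectra and eigenvalues are real.
  The bottom of an empty essential spectrum is \<open>\<infinity>\<close>.\<close>

definition essential_threshold ::
    "'a measure \<Rightarrow> (('a \<Rightarrow> complex) \<times> ('a \<Rightarrow> complex)) set \<Rightarrow> ereal" where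
  "essential_threshold M T = Inf {ereal t | t. complex_of_real t \<in> essential_spectrum M T}"

text \<open>The number of eigenvalues in a set of reals, counted with multiplicity.\<close>

definition eigen_count ::
    "'a measure \<Rightarrow> (('a \<Rightarrow> complex) \<times> ('a \<Rightarrow> complex)) set \<Rightarrow> real set \<Rightarrow> enat" where
  "eigen_count M T I =
     (SUP F\<in>{F. finite F \<and> F \<subseteq> I}. \<Sum>t\<in>F. eigen_mult M T (complex_of_real t))"

definition has_eigenvalues_below_threshold ::
    "'a measure \<Rightarrow> (('a \<Rightarrow> complex) \<times> ('a \<Rightarrow> complex)) set \<Rightarrow> nat \<Rightarrow> bool" where
  "has_eigenvalues_below_threshold M T k \<longleftrightarrow>
     enat k \<le> eigen_count M T {t. ereal t < essential_threshold M T}"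

text \<open>The \<open>j\<close>-th entry (\<open>j \<ge> 1\<close>) of the nondecreasing list, with multiplicities, of the eigenvalues
  below the threshold is the least \<open>t\<close> such that at least \<open>j\<close> entries are \<open>\<le> t\<close>. It is
  meaningful only under \<open>has_eigenvalues_below_threshold M T j\<close>.\<close>

definition nth_eigenvalue ::
    "'a measure \<Rightarrow> (('a \<Rightarrow> complex) \<times> ('a \<Rightarrow> complex)) set \<Rightarrow> nat \<Rightarrow> real" where
  "nth_eigenvalue M T j =
     Inf {t. ereal t < essential_threshold M T \<and> enat j \<le> eigen_count M T {..t}}"


section \<open>Sobolev spaces and the Dirichlet Laplacian\<close>

definition partial_deriv ::
    "'a::euclidean_space \<Rightarrow> ('a \<Rightarrow> complex) \<Rightarrow> 'a \<Rightarrow> complex" where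
  "partial_deriv b f x = frechet_derivative f (at x) b"

primrec k_times_cont_diff :: "nat \<Rightarrow> ('a::euclidean_space \<Rightarrow> complex) \<Rightarrow> bool" where
  "k_times_cont_diff 0 f \<longleftrightarrow> continuous_on UNIV f"
| "k_times_cont_diff (Suc k) f \<longleftrightarrow>
     (\<forall>x. f differentiable (at x)) \<and> (\<forall>b\<in>Basis. k_times_cont_diff k (partial_deriv b f))"

definition test_functions :: "'a::euclidean_space set \<Rightarrow> ('a \<Rightarrow> complex) set" where
  "test_functions \<Omega> =
     {\<phi>. (\<forall>k. k_times_cont_diff k \<phi>) \<and>
         compact (closure {x. \<phi> x \<noteq> 0}) \<and> closure {x. \<phi> x \<noteq> 0} \<subseteq> \<Omega>}"

definition is_weak_deriv ::
    "'a::euclidean_space set \<Rightarrow> 'a \<Rightarrow> ('a \<Rightarrow> complex) \<Rightarrow> ('a \<Rightarrow> complex) \<Rightarrow> bool" where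
  "is_weak_deriv \<Omega> b u g \<longleftrightarrow>
     (\<forall>\<phi>\<in>test_functions \<Omega>.
        (\<integral>x. u x * partial_deriv b \<phi> x \<partial>lebesgue_on \<Omega>) = - (\<integral>x. g x * \<phi> x \<partial>lebesgue_on \<Omega>))"

definition H1 :: "'a::euclidean_space set \<Rightarrow> ('a \<Rightarrow> complex) set" where
  "H1 \<Omega> = {u \<in> L2_space (lebesgue_on \<Omega>).
             \<forall>b\<in>Basis. \<exists>g\<in>L2_space (lebesgue_on \<Omega>). is_weak_deriv \<Omega> b u g}"

text \<open>Determined almost everywhere in \<open>\<Omega>\<close> for open \<open>\<Omega>\<close> and \<open>u \<in> H1 \<Omega>\<close>.\<close>

definition weak_deriv ::
    "'a::euclidean_space set \<Rightarrow> 'a \<Rightarrow> ('a \<Rightarrow> complex) \<Rightarrow> ('a \<Rightarrow> complex)" where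
  "weak_deriv \<Omega> b u = (SOME g. g \<in> L2_space (lebesgue_on \<Omega>) \<and> is_weak_deriv \<Omega> b u g)"

definition H1_norm :: "'a::euclidean_space set \<Rightarrow> ('a \<Rightarrow> complex) \<Rightarrow> real" where
  "H1_norm \<Omega> u = sqrt ((L2_norm (lebesgue_on \<Omega>) u)\<^sup>2 +
                        (\<Sum>b\<in>Basis. (L2_norm (lebesgue_on \<Omega>) (weak_deriv \<Omega> b u))\<^sup>2))"

text \<open>The functions in \<open>H1 \<Omega>\<close> with zero trace on the boundary, defined for every open \<open>\<Omega>\<close> as the
  closure of the test functions; for a Lipschitz domain this is the kernel of the trace operator.\<close>

definition H1_0 :: "'a::euclidean_space set \<Rightarrow> ('a \<Rightarrow> complex) set" where
  "H1_0 \<Omega> = {u \<in> H1 \<Omega>. \<exists>\<phi>. (\<forall>n::nat. \<phi> n \<in> test_functions \<Omega>) \<and>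
                 (\<lambda>n. H1_norm \<Omega> (\<lambda>x. u x - \<phi> n x)) \<longlonglongrightarrow> 0}"

definition dirichlet_form ::
    "'a::euclidean_space set \<Rightarrow> ('a \<Rightarrow> complex) \<Rightarrow> ('a \<Rightarrow> complex) \<Rightarrow> complex" where
  "dirichlet_form \<Omega> u v =
     (\<Sum>b\<in>Basis. L2_inner (lebesgue_on \<Omega>) (weak_deriv \<Omega> b u) (weak_deriv \<Omega> b v))"

text \<open>The operator generated by the closed form \<open>dirichlet_form \<Omega>\<close> with domain \<open>H1_0 \<Omega>\<close>, in the
  sense of the first representation theorem for forms.\<close>

definition dirichlet_laplacian ::
    "'a::euclidean_space set \<Rightarrow> (('a \<Rightarrow> complex) \<times> ('a \<Rightarrow> complex)) set" where
  "dirichlet_laplacian \<Omega> =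
     {(u, f). u \<in> H1_0 \<Omega> \<and> f \<in> L2_space (lebesgue_on \<Omega>) \<and>
              (\<forall>v\<in>H1_0 \<Omega>. dirichlet_form \<Omega> u v = L2_inner (lebesgue_on \<Omega>) f v)}"


section \<open>Regular polyhedral layers\<close>

definition cylindrical :: "real \<Rightarrow> real \<Rightarrow> real \<Rightarrow> real^3" where
  "cylindrical r \<phi> z = vector [r * cos \<phi>, r * sin \<phi>, z]"

definition polyhedral_angle :: "nat \<Rightarrow> real \<Rightarrow> (real^3) set" where
  "polyhedral_angle N \<theta> =
     {cylindrical r \<phi> z | r \<phi> z. r \<ge> 0 \<and>
        (\<forall>j<N. z * sin \<theta> - r * cos \<theta> * cos (\<phi> - real j * (2 * pi / real N)) > 0)}"

definition polyhedral_layer :: "nat \<Rightarrow> real \<Rightarrow> (real^3) set" where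
  "polyhedral_layer N \<theta> =
     {x \<in> polyhedral_angle N \<theta>. infdist x (frontier (polyhedral_angle N \<theta>)) \<in> {0<..<1}}"

definition layer_has_eigenvalues :: "nat \<Rightarrow> real \<Rightarrow> nat \<Rightarrow> bool" where
  "layer_has_eigenvalues N \<theta> k \<longleftrightarrow>
     has_eigenvalues_below_threshold (lebesgue_on (polyhedral_layer N \<theta>))
       (dirichlet_laplacian (polyhedral_layer N \<theta>)) k"

definition layer_eigenvalue :: "nat \<Rightarrow> real \<Rightarrow> nat \<Rightarrow> real" where
  "layer_eigenvalue N \<theta> j =
     nth_eigenvalue (lebesgue_on (polyhedral_layer N \<theta>))
       (dirichlet_laplacian (polyhedral_layer N \<theta>)) j"

end

theory Submission
  imports Defs
begin

text \<open>Let \<open>g(x, y)\<close> be the maximum over \<open>j\<close> of \<open>x cos(j\<psi>) + y sin(j\<psi>)\<close>, where \<open>\<psi> = 2\<pi>/N\<close>. The distance of a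
  point of the polyhedral angle from its boundary is \<open>w = z sin \<theta> - g(x, y) cos \<theta>\<close>. In the
  coordinates \<open>X = (x, y) / cos \<theta>\<close> and \<open>w\<close> the layers of all angles \<open>\<theta>\<close> become the same set, the plane
  times \<open>(0, 1)\<close>; the Jacobian is constant, and the integrand of the Dirichlet form becomes
  \<open>|v_w|\<^sup>2 - 2 Re (v_w cnj (\<nabla>g \<cdot> \<nabla>_X v)) + |\<nabla>_X v|\<^sup>2 / cos\<^sup>2 \<theta>\<close>. Only the last coefficient depends on
  \<open>\<theta>\<close>, and it increases with \<open>\<theta>\<close>. A function on the layer of the larger angle \<open>\<sigma>\<close>, transplanted to
  the layer of \<open>\<theta>\<close> through these coordinates, therefore has a Rayleigh quotient that is not larger,
  and the variational principle turns this into the inequality of the eigenvalues.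

  The function \<open>g\<close> has corners, so the transplantation does not map test functions to test functions.
  The proof replaces \<open>g\<close> by the soft maximum \<open>\<epsilon> ln (\<Sum>j. exp (\<cdot> / \<epsilon>))\<close>. Its gradient is a convex
  combination of unit vectors, and a gradient of length at most one is all that the comparison of
  the two integrands requires (\<open>form_comparison_real\<close>, \<open>gradient_layer_map\<close>). The resulting map of the
  space is a diffeomorphism with the same constant Jacobian (\<open>integral_layer_map\<close>), and for small
  \<open>\<epsilon>\<close> it pulls a given test function on the layer of \<open>\<sigma>\<close> back to a test function on the layer of \<open>\<theta>\<close>
  (\<open>layer_map_test\<close>). Test functions suffice: the span of the first \<open>j\<close> eigenfunctions for \<open>\<sigma>\<close> is
  approximated by a span of test functions at the cost of an arbitrarily small increase of the
  Rayleigh quotients (\<open>approximate_eigenspace\<close>).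

  The part of the variational principle that is needed is \<open>form_bound_imp_eigen_count\<close>: if the form is
  at most \<open>t\<close> times the squared norm on a space of dimension \<open>j\<close>, and \<open>t\<close> lies below the essential
  spectrum, then there are at least \<open>j\<close> eigenvalues up to \<open>t\<close>. Otherwise let \<open>E\<close> be the span of a maximal
  orthonormal family of eigenfunctions with eigenvalues up to \<open>t\<close>. The space of dimension \<open>j\<close> contains
  a nonzero vector orthogonal to \<open>E\<close>, so the infimum \<open>m\<close> of the Rayleigh quotient on the orthogonal
  complement of \<open>E\<close> is at most \<open>t\<close>. Hence \<open>m\<close> is a point of the resolvent set or an isolated point of
  the spectrum. The first is excluded by a Cauchy-Schwarz argument (\<open>regular_not_bottom\<close>). In the
  second case the absence of spectrum to the right of \<open>m\<close> gives a gap estimate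
  (\<open>spectral_gap_estimate\<close>), which shows that the functions \<open>\<epsilon> (A - m + \<epsilon>)\<inverse> v\<close>, for \<open>v\<close> with nearly
  minimal Rayleigh quotient, converge to a nonzero eigenfunction orthogonal to \<open>E\<close>
  (\<open>isolated_bottom_eigenvector\<close>), against the maximality of \<open>E\<close>.\<close>


section \<open>Hermitian forms\<close>

text \<open>A positive semidefinite Hermitian form on a complex vector space of functions. Since its elements are
functions and not classes of functions, the form may vanish on nonzero elements. The inner product of
\<open>L2_space M\<close>, the Dirichlet form and, on suitable subspaces, its shift by a spectral parameter are all
of this kind and share the Cauchy-Schwarz inequality.\<close>

locale hermitian_form =
  fixes Q :: "('a \<Rightarrow> complex) set" and a :: "('a \<Rightarrow> complex) \<Rightarrow> ('a \<Rightarrow> complex) \<Rightarrow> complex"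
  assumes zero_in [simp]: "(\<lambda>x. 0) \<in> Q"
    and add_in [simp]: "u \<in> Q \<Longrightarrow> v \<in> Q \<Longrightarrow> (\<lambda>x. u x + v x) \<in> Q"
    and scale_in [simp]: "u \<in> Q \<Longrightarrow> (\<lambda>x. c * u x) \<in> Q"
    and add_left: "u \<in> Q \<Longrightarrow> v \<in> Q \<Longrightarrow> w \<in> Q \<Longrightarrow> a (\<lambda>x. u x + v x) w = a u w + a v w"
    and scale_left: "u \<in> Q \<Longrightarrow> w \<in> Q \<Longrightarrow> a (\<lambda>x. c * u x) w = c * a u w"
    and hermitian: "u \<in> Q \<Longrightarrow> v \<in> Q \<Longrightarrow> a v u = cnj (a u v)"
    and nonneg: "u \<in> Q \<Longrightarrow> 0 \<le> Re (a u u)"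
begin

lemma minus_in [simp]: "u \<in> Q \<Longrightarrow> (\<lambda>x. - u x) \<in> Q"
  using scale_in[of u "-1"] by simp

lemma diff_in [simp]: "u \<in> Q \<Longrightarrow> v \<in> Q \<Longrightarrow> (\<lambda>x. u x - v x) \<in> Q"
  using add_in[OF _ minus_in, of u v] by simp

lemma minus_left: "u \<in> Q \<Longrightarrow> w \<in> Q \<Longrightarrow> a (\<lambda>x. - u x) w = - a u w"
  using scale_left[of u w "-1"] by simp

lemma diff_left: "u \<in> Q \<Longrightarrow> v \<in> Q \<Longrightarrow> w \<in> Q \<Longrightarrow> a (\<lambda>x. u x - v x) w = a u w - a v w"
  using add_left[OF _ minus_in, of u v w] by (simp add: minus_left)

lemma zero_left: "w \<in> Q \<Longrightarrow> a (\<lambda>x. 0) w = 0"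
  using scale_left[of "\<lambda>x. 0" w 0] by simp

lemma add_right: "u \<in> Q \<Longrightarrow> v \<in> Q \<Longrightarrow> w \<in> Q \<Longrightarrow> a w (\<lambda>x. u x + v x) = a w u + a w v"
  by (subst hermitian) (auto simp: add_left hermitian[of w])

lemma scale_right: "u \<in> Q \<Longrightarrow> w \<in> Q \<Longrightarrow> a w (\<lambda>x. c * u x) = cnj c * a w u"
  by (subst hermitian) (auto simp: scale_left hermitian[of w])

lemma minus_right: "u \<in> Q \<Longrightarrow> w \<in> Q \<Longrightarrow> a w (\<lambda>x. - u x) = - a w u"
  by (subst hermitian) (auto simp: minus_left hermitian[of w])

lemma diff_right: "u \<in> Q \<Longrightarrow> v \<in> Q \<Longrightarrow> w \<in> Q \<Longrightarrow> a w (\<lambda>x. u x - v x) = a w u - a w v"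
  by (subst hermitian) (auto simp: diff_left hermitian[of w])

lemma zero_right: "w \<in> Q \<Longrightarrow> a w (\<lambda>x. 0) = 0"
  by (subst hermitian) (auto simp: zero_left)

lemmas sesquilinear = add_left scale_left minus_left diff_left zero_left
  add_right scale_right minus_right diff_right zero_right

lemma sum_in [simp]: "(\<And>i. i \<in> I \<Longrightarrow> u i \<in> Q) \<Longrightarrow> (\<lambda>x. \<Sum>i\<in>I. c i * u i x) \<in> Q"
  by (induction I rule: infinite_finite_induct) auto

lemma sum_left:
  "(\<And>i. i \<in> I \<Longrightarrow> u i \<in> Q) \<Longrightarrow> w \<in> Q \<Longrightarrow> a (\<lambda>x. \<Sum>i\<in>I. c i * u i x) w = (\<Sum>i\<in>I. c i * a (u i) w)"
  by (induction I rule: infinite_finite_induct) (auto simp: sesquilinear)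

lemma sum_right:
  "(\<And>i. i \<in> I \<Longrightarrow> u i \<in> Q) \<Longrightarrow> w \<in> Q \<Longrightarrow> a w (\<lambda>x. \<Sum>i\<in>I. c i * u i x) = (\<Sum>i\<in>I. cnj (c i) * a w (u i))"
  by (induction I rule: infinite_finite_induct) (auto simp: sesquilinear)

lemma diag_real: "u \<in> Q \<Longrightarrow> a u u = complex_of_real (Re (a u u))"
  using hermitian[of u u] by (simp add: complex_eq_iff)

lemma Re_comm: "u \<in> Q \<Longrightarrow> v \<in> Q \<Longrightarrow> Re (a u v) = Re (a v u)"
  using hermitian[of u v] by simp

lemma diag_add:
  "u \<in> Q \<Longrightarrow> v \<in> Q \<Longrightarrow>
     Re (a (\<lambda>x. u x + v x) (\<lambda>x. u x + v x)) = Re (a u u) + 2 * Re (a u v) + Re (a v v)"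
  using Re_comm[of u v] by (simp add: sesquilinear)

lemma diag_diff:
  "u \<in> Q \<Longrightarrow> v \<in> Q \<Longrightarrow>
     Re (a (\<lambda>x. u x - v x) (\<lambda>x. u x - v x)) = Re (a u u) - 2 * Re (a u v) + Re (a v v)"
  using Re_comm[of u v] by (simp add: sesquilinear)

lemma diag_scale: "u \<in> Q \<Longrightarrow> Re (a (\<lambda>x. c * u x) (\<lambda>x. c * u x)) = (cmod c)\<^sup>2 * Re (a u u)"
proof -
  assume u: "u \<in> Q"
  have "a (\<lambda>x. c * u x) (\<lambda>x. c * u x) = (c * cnj c) * a u u"
    using u by (simp add: sesquilinear)
  also have "\<dots> = complex_of_real ((cmod c)\<^sup>2) * a u u"
    by (simp add: complex_norm_square del: of_real_power)
  finally show ?thesis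
    by simp
qed

text \<open>The quadratic polynomial \<open>s \<mapsto> a (u - s X v) (u - s X v)\<close> with \<open>X = a u v\<close> is nonnegative. If \<open>a v v = 0\<close>
it is affine in \<open>s\<close>, which forces \<open>X = 0\<close>.\<close>

lemma cauchy_schwarz:
  assumes u: "u \<in> Q" and v: "v \<in> Q"
  shows "(cmod (a u v))\<^sup>2 \<le> Re (a u u) * Re (a v v)"
proof -
  define A C X where "A = Re (a u u)" and "C = Re (a v v)" and "X = a u v"
  have X: "a v u = cnj X"
    using hermitian[OF u v] by (simp add: X_def)
  have quad: "0 \<le> A - 2 * s * (cmod X)\<^sup>2 + s\<^sup>2 * (cmod X)\<^sup>2 * C" for s :: real
  proof -
    define c where "c = complex_of_real s * X"
    have "0 \<le> Re (a (\<lambda>x. u x - c * v x) (\<lambda>x. u x - c * v x))"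
      using u v by (intro nonneg) auto
    also have "\<dots> = A - 2 * Re (a u (\<lambda>x. c * v x)) + (cmod c)\<^sup>2 * C"
      using u v by (subst diag_diff) (auto simp: diag_scale A_def C_def)
    also have "a u (\<lambda>x. c * v x) = complex_of_real s * (X * cnj X)"
      using u v by (simp add: scale_right c_def X_def)
    also have "Re \<dots> = s * (cmod X)\<^sup>2"
      by (simp add: complex_norm_square[symmetric] del: of_real_power)
    finally show ?thesis
      by (simp add: c_def norm_mult power_mult_distrib)
  qed
  have A: "0 \<le> A" and C: "0 \<le> C"
    using nonneg u v by (auto simp: A_def C_def)
  have "(cmod X)\<^sup>2 \<le> A * C"
  proof (cases "C = 0")
    case True
    have "(cmod X)\<^sup>2 = 0"
    proof (rule ccontr)
      assume n: "(cmod X)\<^sup>2 \<noteq> 0"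
      then show False
        using quad[of "(A + 1) / (2 * (cmod X)\<^sup>2)"] True A by (simp add: field_simps)
    qed
    then show ?thesis
      using A C by simp
  next
    case False
    then show ?thesis
      using quad[of "1 / C"] C by (simp add: field_simps power2_eq_square)
  qed
  then show ?thesis
    by (simp add: A_def C_def X_def)
qed

lemma cauchy_schwarz_Re:
  assumes "u \<in> Q" and "v \<in> Q"
  shows "\<bar>Re (a u v)\<bar> \<le> sqrt (Re (a u u)) * sqrt (Re (a v v))"
proof -
  have "\<bar>Re (a u v)\<bar> \<le> cmod (a u v)"
    by (rule abs_Re_le_cmod)
  also have "\<dots> \<le> sqrt (Re (a u u) * Re (a v v))"
    using cauchy_schwarz[OF assms] by (rule real_le_rsqrt)
  finally show ?thesis
    by (simp add: real_sqrt_mult)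
qed

lemma triangle:
  assumes u: "u \<in> Q" and v: "v \<in> Q"
  shows "sqrt (Re (a (\<lambda>x. u x + v x) (\<lambda>x. u x + v x))) \<le> sqrt (Re (a u u)) + sqrt (Re (a v v))"
proof (rule real_le_lsqrt)
  have "Re (a (\<lambda>x. u x + v x) (\<lambda>x. u x + v x)) \<le>
      Re (a u u) + 2 * (sqrt (Re (a u u)) * sqrt (Re (a v v))) + Re (a v v)"
    using diag_add[OF u v] cauchy_schwarz_Re[OF u v] by simp
  also have "\<dots> = (sqrt (Re (a u u)) + sqrt (Re (a v v)))\<^sup>2"
    using nonneg u v by (simp add: power2_sum)
  finally show "Re (a (\<lambda>x. u x + v x) (\<lambda>x. u x + v x)) \<le> (sqrt (Re (a u u)) + sqrt (Re (a v v)))\<^sup>2" .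
qed (use nonneg u v in auto)

lemma triangle_sum:
  assumes u: "\<And>i. i \<in> I \<Longrightarrow> u i \<in> Q"
  shows "sqrt (Re (a (\<lambda>x. \<Sum>i\<in>I. c i * u i x) (\<lambda>x. \<Sum>i\<in>I. c i * u i x)))
    \<le> (\<Sum>i\<in>I. cmod (c i) * sqrt (Re (a (u i) (u i))))"
  using u
proof (induction I rule: infinite_finite_induct)
  case (insert i I)
  have "sqrt (Re (a (\<lambda>x. \<Sum>i\<in>insert i I. c i * u i x) (\<lambda>x. \<Sum>i\<in>insert i I. c i * u i x)))
      \<le> sqrt (Re (a (\<lambda>x. c i * u i x) (\<lambda>x. c i * u i x))) +
        sqrt (Re (a (\<lambda>x. \<Sum>i\<in>I. c i * u i x) (\<lambda>x. \<Sum>i\<in>I. c i * u i x)))"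
    using insert triangle[of "\<lambda>x. c i * u i x" "\<lambda>x. \<Sum>i\<in>I. c i * u i x"] by simp
  also have "sqrt (Re (a (\<lambda>x. c i * u i x) (\<lambda>x. c i * u i x))) = cmod (c i) * sqrt (Re (a (u i) (u i)))"
    using insert by (simp add: diag_scale real_sqrt_mult)
  finally show ?case
    using insert by simp
qed (auto simp: zero_left)

end


section \<open>The Hilbert space of square-integrable functions\<close>

lemma L2_spaceD: "f \<in> L2_space M \<Longrightarrow> f \<in> borel_measurable M"
  "f \<in> L2_space M \<Longrightarrow> integrable M (\<lambda>x. (cmod (f x))\<^sup>2)"
  by (auto simp: L2_space_def)

lemma L2_integrable_mult:
  assumes "f \<in> L2_space M" and "g \<in> L2_space M"
  shows "integrable M (\<lambda>x. f x * g x)"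
proof (rule Bochner_Integration.integrable_bound)
  show "integrable M (\<lambda>x. (cmod (f x))\<^sup>2 + (cmod (g x))\<^sup>2)"
    using assms by (simp add: L2_spaceD)
  show "(\<lambda>x. f x * g x) \<in> borel_measurable M"
    using assms by (intro borel_measurable_times L2_spaceD(1))
  show "AE x in M. norm (f x * g x) \<le> norm ((cmod (f x))\<^sup>2 + (cmod (g x))\<^sup>2)"
  proof (rule AE_I2)
    fix x
    have "2 * (cmod (f x) * cmod (g x)) \<le> (cmod (f x))\<^sup>2 + (cmod (g x))\<^sup>2"
      using sum_squares_bound[of "cmod (f x)" "cmod (g x)"] by simp
    moreover have "0 \<le> cmod (f x) * cmod (g x)"
      by simp
    ultimately have "cmod (f x) * cmod (g x) \<le> (cmod (f x))\<^sup>2 + (cmod (g x))\<^sup>2"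
      by linarith
    then show "norm (f x * g x) \<le> norm ((cmod (f x))\<^sup>2 + (cmod (g x))\<^sup>2)"
      by (simp add: norm_mult)
  qed
qed

lemma borel_measurable_cnj [measurable (raw)]:
  "f \<in> borel_measurable M \<Longrightarrow> (\<lambda>x. cnj (f x)) \<in> borel_measurable M"
  by (rule measurable_compose[OF _ borel_measurable_continuous_onI]) (auto intro: continuous_intros)

lemma L2_space_cnj: "f \<in> L2_space M \<Longrightarrow> (\<lambda>x. cnj (f x)) \<in> L2_space M"
  by (auto simp: L2_space_def)

lemma L2_integrable_cnj:
  "f \<in> L2_space M \<Longrightarrow> g \<in> L2_space M \<Longrightarrow> integrable M (\<lambda>x. f x * cnj (g x))"
  by (intro L2_integrable_mult L2_space_cnj)

lemma L2_space_add:
  assumes "f \<in> L2_space M" and "g \<in> L2_space M"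
  shows "(\<lambda>x. f x + g x) \<in> L2_space M"
proof -
  have "integrable M (\<lambda>x. (cmod (f x + g x))\<^sup>2)"
  proof (rule Bochner_Integration.integrable_bound)
    show "integrable M (\<lambda>x. 2 * (cmod (f x))\<^sup>2 + 2 * (cmod (g x))\<^sup>2)"
      using assms by (simp add: L2_spaceD)
    show "(\<lambda>x. (cmod (f x + g x))\<^sup>2) \<in> borel_measurable M"
      using assms[THEN L2_spaceD(1)] by measurable
    show "AE x in M. norm ((cmod (f x + g x))\<^sup>2) \<le> norm (2 * (cmod (f x))\<^sup>2 + 2 * (cmod (g x))\<^sup>2)"
    proof (rule AE_I2)
      fix x
      have "(cmod (f x + g x))\<^sup>2 \<le> (cmod (f x) + cmod (g x))\<^sup>2"
        by (intro power_mono norm_triangle_ineq) auto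
      also have "\<dots> \<le> 2 * (cmod (f x))\<^sup>2 + 2 * (cmod (g x))\<^sup>2"
        using sum_squares_bound[of "cmod (f x)" "cmod (g x)"] by (simp add: power2_sum)
      finally show "norm ((cmod (f x + g x))\<^sup>2) \<le> norm (2 * (cmod (f x))\<^sup>2 + 2 * (cmod (g x))\<^sup>2)"
        by simp
    qed
  qed
  then show ?thesis
    using assms by (auto simp: L2_space_def)
qed

lemma L2_inner_self: "Re (L2_inner M f f) = (\<integral>x. (cmod (f x))\<^sup>2 \<partial>M)"
  by (simp add: L2_inner_def complex_norm_square[symmetric] del: of_real_power)

lemma L2_norm_eq: "L2_norm M f = sqrt (Re (L2_inner M f f))"
  by (simp add: L2_norm_def L2_inner_self)

lemma L2_norm_nonneg [simp]: "0 \<le> L2_norm M f"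
  by (simp add: L2_norm_def)

lemma L2_norm_sq: "(L2_norm M f)\<^sup>2 = Re (L2_inner M f f)"
  by (simp add: L2_norm_eq L2_inner_self)

lemma L2_inner_cong_AE:
  assumes "f \<in> borel_measurable M" "f' \<in> borel_measurable M" "g \<in> borel_measurable M" "g' \<in> borel_measurable M"
    and "AE x in M. f x = f' x" and "AE x in M. g x = g' x"
  shows "L2_inner M f g = L2_inner M f' g'"
  unfolding L2_inner_def using assms by (intro integral_cong_AE) auto

global_interpretation L2: hermitian_form "L2_space M" "L2_inner M" for M :: "'a measure"
proof
  show "(\<lambda>x. 0) \<in> L2_space M"
    by (simp add: L2_space_def)
  show "(\<lambda>x. u x + v x) \<in> L2_space M" if "u \<in> L2_space M" "v \<in> L2_space M" for u v
    using that by (rule L2_space_add)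
  show "(\<lambda>x. c * u x) \<in> L2_space M" if "u \<in> L2_space M" for u c
    using that by (auto simp: L2_space_def norm_mult power_mult_distrib)
  show "L2_inner M (\<lambda>x. u x + v x) w = L2_inner M u w + L2_inner M v w"
    if "u \<in> L2_space M" "v \<in> L2_space M" "w \<in> L2_space M" for u v w
    using that by (simp add: L2_inner_def distrib_right L2_integrable_cnj)
  show "L2_inner M (\<lambda>x. c * u x) w = c * L2_inner M u w"
    if "u \<in> L2_space M" "w \<in> L2_space M" for u w c
    by (simp add: L2_inner_def mult.assoc)
  show "L2_inner M v u = cnj (L2_inner M u v)" for u v
    unfolding L2_inner_def by (subst Bochner_Integration.integral_cnj[symmetric]) (simp add: mult.commute)
  show "0 \<le> Re (L2_inner M u u)" for u
    by (simp add: L2_inner_self)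
qed

lemma L2_norm_eq_0_iff:
  assumes "f \<in> L2_space M"
  shows "L2_norm M f = 0 \<longleftrightarrow> (AE x in M. f x = 0)"
  using integral_nonneg_eq_0_iff_AE[OF L2_spaceD(2)[OF assms]] by (simp add: L2_norm_def)

lemma L2_norm_triangle:
  "u \<in> L2_space M \<Longrightarrow> v \<in> L2_space M \<Longrightarrow> L2_norm M (\<lambda>x. u x + v x) \<le> L2_norm M u + L2_norm M v"
  unfolding L2_norm_eq by (rule L2.triangle)

lemma L2_norm_scale: "u \<in> L2_space M \<Longrightarrow> L2_norm M (\<lambda>x. c * u x) = cmod c * L2_norm M u"
  by (simp add: L2_norm_eq L2.diag_scale real_sqrt_mult)

lemma L2_norm_minus: "L2_norm M (\<lambda>x. - u x) = L2_norm M u"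
  by (simp add: L2_norm_def)

lemma L2_norm_minus_commute: "L2_norm M (\<lambda>x. u x - v x) = L2_norm M (\<lambda>x. v x - u x)"
  by (simp add: L2_norm_def norm_minus_commute)

lemma L2_norm_triangle_diff:
  "u \<in> L2_space M \<Longrightarrow> v \<in> L2_space M \<Longrightarrow> L2_norm M u \<le> L2_norm M v + L2_norm M (\<lambda>x. u x - v x)"
  using L2_norm_triangle[of v M "\<lambda>x. u x - v x"] by simp

lemma L2_cauchy_schwarz:
  "u \<in> L2_space M \<Longrightarrow> v \<in> L2_space M \<Longrightarrow> cmod (L2_inner M u v) \<le> L2_norm M u * L2_norm M v"
  using L2.cauchy_schwarz[of u M v]
  by (metis L2_norm_nonneg L2_norm_sq mult_nonneg_nonneg norm_ge_zero power2_le_imp_le power_mult_distrib)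

lemma L2_cauchy_schwarz_Re:
  "u \<in> L2_space M \<Longrightarrow> v \<in> L2_space M \<Longrightarrow> \<bar>Re (L2_inner M u v)\<bar> \<le> L2_norm M u * L2_norm M v"
  unfolding L2_norm_eq by (rule L2.cauchy_schwarz_Re)

text \<open>Bounds an increment by a summable constant and a weighted square, so that convergence of weighted
squares implies absolute convergence of the increments.\<close>

lemma le_inverse_add_mult_square:
  fixes d q :: real
  assumes "0 < q"
  shows "d \<le> 1 / q + q * d\<^sup>2"
proof -
  have "0 \<le> (q * d - 1)\<^sup>2" and "0 \<le> (q * d)\<^sup>2"
    by simp_all
  then have "d * q \<le> 1 + (q * d)\<^sup>2"
    by (simp add: power2_diff power2_eq_square algebra_simps)
  then show ?thesis
    using assms by (simp add: field_simps power2_eq_square)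
qed

text \<open>The sum of \<open>2\<^sup>n |f (n + 1) - f n|\<^sup>2\<close> has a finite integral and is therefore finite almost everywhere, which
makes \<open>f\<close> converge there. Fatou's lemma carries the bound on the distances over to the limit.\<close>

lemma L2_limit_exists_fast:
  assumes f: "\<And>n. f n \<in> L2_space M"
    and fast: "\<And>n m. n \<le> m \<Longrightarrow> L2_norm M (\<lambda>x. f m x - f n x) \<le> (1/2) ^ n"
  shows "\<exists>g\<in>L2_space M. \<forall>n. L2_norm M (\<lambda>x. f n x - g x) \<le> (1/2) ^ n"
proof -
  have [measurable]: "f n \<in> borel_measurable M" for n
    using f by (rule L2_spaceD)
  define d where "d n x = cmod (f (Suc n) x - f n x)" for n x
  have [measurable]: "d n \<in> borel_measurable M" for n
    unfolding d_def by measurable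
  have sq: "(\<integral>\<^sup>+x. ennreal ((cmod (f m x - f n x))\<^sup>2) \<partial>M) \<le> ennreal ((1/4) ^ n)" if "n \<le> m" for n m
  proof -
    have i: "(\<lambda>x. f m x - f n x) \<in> L2_space M"
      using f by simp
    have "(\<integral>\<^sup>+x. ennreal ((cmod (f m x - f n x))\<^sup>2) \<partial>M) = ennreal ((L2_norm M (\<lambda>x. f m x - f n x))\<^sup>2)"
      using L2_spaceD(2)[OF i] by (simp add: nn_integral_eq_integral L2_norm_sq L2_inner_self)
    also have "\<dots> \<le> ennreal (((1/2)^n)\<^sup>2)"
      by (intro ennreal_leI power_mono fast that) simp
    also have "((1/2)^n)\<^sup>2 = ((1/4)::real) ^ n"
      by (simp add: power2_eq_square flip: power_mult_distrib)
    finally show ?thesis .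
  qed
  have "(\<integral>\<^sup>+x. (\<Sum>n. ennreal (2^n * (d n x)\<^sup>2)) \<partial>M) = (\<Sum>n. \<integral>\<^sup>+x. ennreal (2^n * (d n x)\<^sup>2) \<partial>M)"
    by (rule nn_integral_suminf) measurable
  also have "\<dots> \<le> (\<Sum>n. ennreal ((1/2)^n))"
  proof (rule suminf_le)
    fix n
    have "(\<integral>\<^sup>+x. ennreal (2^n * (d n x)\<^sup>2) \<partial>M) = ennreal (2^n) * (\<integral>\<^sup>+x. ennreal ((d n x)\<^sup>2) \<partial>M)"
      by (simp add: ennreal_mult nn_integral_cmult)
    also have "\<dots> \<le> ennreal (2^n) * ennreal ((1/4)^n)"
      using sq[of n "Suc n"] by (intro mult_left_mono) (auto simp: d_def)
    also have "\<dots> = ennreal ((1/2)^n)"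
      by (simp add: ennreal_mult[symmetric] power_mult_distrib[symmetric])
    finally show "(\<integral>\<^sup>+x. ennreal (2^n * (d n x)\<^sup>2) \<partial>M) \<le> ennreal ((1/2)^n)" .
  qed auto
  also have "\<dots> = ennreal (\<Sum>n. (1/2)^n)"
    by (rule suminf_ennreal2) (auto intro: summable_geometric)
  also have "\<dots> < \<infinity>"
    by simp
  finally have "(\<integral>\<^sup>+x. (\<Sum>n. ennreal (2^n * (d n x)\<^sup>2)) \<partial>M) \<noteq> \<infinity>"
    by simp
  then have "AE x in M. (\<Sum>n. ennreal (2^n * (d n x)\<^sup>2)) \<noteq> \<infinity>"
    by (intro nn_integral_noteq_infinite) measurable
  then have conv: "AE x in M. convergent (\<lambda>n. f n x)"
  proof eventually_elim
    fix x
    assume fin: "(\<Sum>n. ennreal (2^n * (d n x)\<^sup>2)) \<noteq> \<infinity>"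
    have s: "summable (\<lambda>n. 2^n * (d n x)\<^sup>2)"
      by (rule summable_suminf_not_top) (use fin in \<open>auto simp: top_ennreal_def[symmetric] infinity_ennreal_def\<close>)
    have "summable (\<lambda>n. (1/2)^n + 2^n * (d n x)\<^sup>2)"
      by (intro summable_add s summable_geometric) simp
    moreover have "norm (f (Suc n) x - f n x) \<le> (1/2)^n + 2^n * (d n x)\<^sup>2" for n
    proof -
      have "d n x \<le> 1 / 2^n + 2^n * (d n x)\<^sup>2"
        by (rule le_inverse_add_mult_square) simp
      then show ?thesis by (simp add: d_def power_one_over)
    qed
    ultimately have "summable (\<lambda>n. f (Suc n) x - f n x)"
      by (rule summable_comparison_test'[where N = 0])
    then have "(\<lambda>m. (\<Sum>n<m. f (Suc n) x - f n x) + f 0 x) \<longlonglongrightarrow> (\<Sum>n. f (Suc n) x - f n x) + f 0 x"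
      by (intro tendsto_add summable_LIMSEQ tendsto_const)
    then show "convergent (\<lambda>n. f n x)"
      by (auto simp: sum_lessThan_telescope[of "\<lambda>n. f n x"] convergent_def)
  qed
  define g where "g x = lim (\<lambda>n. f n x)" for x
  have [measurable]: "g \<in> borel_measurable M"
    unfolding g_def by measurable
  have bound: "(\<integral>\<^sup>+x. ennreal ((cmod (f n x - g x))\<^sup>2) \<partial>M) \<le> ennreal ((1/4) ^ n)" for n
  proof -
    have "(\<integral>\<^sup>+x. ennreal ((cmod (f n x - g x))\<^sup>2) \<partial>M)
        = (\<integral>\<^sup>+x. liminf (\<lambda>m. ennreal ((cmod (f m x - f n x))\<^sup>2)) \<partial>M)"
    proof (rule nn_integral_cong_AE, use conv in eventually_elim)
      fix x assume "convergent (\<lambda>n. f n x)"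
      then have "(\<lambda>m. f m x) \<longlonglongrightarrow> g x"
        by (simp add: g_def convergent_LIMSEQ_iff)
      then have "(\<lambda>m. ennreal ((cmod (f m x - f n x))\<^sup>2)) \<longlonglongrightarrow> ennreal ((cmod (g x - f n x))\<^sup>2)"
        by (intro tendsto_intros)
      then have "liminf (\<lambda>m. ennreal ((cmod (f m x - f n x))\<^sup>2)) = ennreal ((cmod (g x - f n x))\<^sup>2)"
        by (intro lim_imp_Liminf) auto
      then show "ennreal ((cmod (f n x - g x))\<^sup>2) = liminf (\<lambda>m. ennreal ((cmod (f m x - f n x))\<^sup>2))"
        by (simp add: norm_minus_commute)
    qed
    also have "\<dots> \<le> liminf (\<lambda>m. \<integral>\<^sup>+x. ennreal ((cmod (f m x - f n x))\<^sup>2) \<partial>M)"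
      by (rule nn_integral_liminf) measurable
    also have "\<dots> \<le> liminf (\<lambda>m. ennreal ((1/4) ^ n))"
      using sq[of n] by (intro Liminf_mono) (auto simp: eventually_sequentially)
    also have "\<dots> = ennreal ((1/4) ^ n)"
      by (simp add: Liminf_const)
    finally show ?thesis .
  qed
  have diff_L2: "(\<lambda>x. f n x - g x) \<in> L2_space M" for n
  proof -
    have "(\<integral>\<^sup>+x. ennreal ((cmod (f n x - g x))\<^sup>2) \<partial>M) < \<infinity>"
      by (rule le_less_trans[OF bound]) simp
    then have "integrable M (\<lambda>x. (cmod (f n x - g x))\<^sup>2)"
      by (intro integrableI_nonneg) auto
    then show ?thesis
      by (simp add: L2_space_def)
  qed
  have "g \<in> L2_space M"
    using L2.diff_in[OF f[of 0] diff_L2[of 0]] by simp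
  moreover have "L2_norm M (\<lambda>x. f n x - g x) \<le> (1/2)^n" for n
  proof -
    have "ennreal ((L2_norm M (\<lambda>x. f n x - g x))\<^sup>2) = (\<integral>\<^sup>+x. ennreal ((cmod (f n x - g x))\<^sup>2) \<partial>M)"
      using L2_spaceD(2)[OF diff_L2] by (simp add: nn_integral_eq_integral L2_norm_sq L2_inner_self)
    also have "\<dots> \<le> ennreal ((1/4) ^ n)" by (rule bound)
    finally have "(L2_norm M (\<lambda>x. f n x - g x))\<^sup>2 \<le> (1/4)^n"
      by (simp add: ennreal_le_iff)
    also have "(1/4)^n = ((1/2 :: real)^n)\<^sup>2"
      by (simp add: power2_eq_square flip: power_mult_distrib)
    finally show ?thesis
      by (rule power2_le_imp_le) simp
  qed
  ultimately show ?thesis by blast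
qed

lemma L2_complete:
  assumes f: "\<And>n. f n \<in> L2_space M"
    and cauchy: "\<And>e. e > 0 \<Longrightarrow> \<exists>N. \<forall>n\<ge>N. \<forall>m\<ge>n. L2_norm M (\<lambda>x. f m x - f n x) \<le> e"
  shows "\<exists>g\<in>L2_space M. (\<lambda>n. L2_norm M (\<lambda>x. f n x - g x)) \<longlonglongrightarrow> 0"
proof -
  have "\<exists>N. \<forall>n\<ge>N. \<forall>m\<ge>n. L2_norm M (\<lambda>x. f m x - f n x) \<le> (1/2) ^ k" for k
    using cauchy[of "(1/2)^k"] by simp
  then obtain N where N: "\<And>k n m. n \<ge> N k \<Longrightarrow> m \<ge> n \<Longrightarrow> L2_norm M (\<lambda>x. f m x - f n x) \<le> (1/2) ^ k"
    by metis
  define r where "r k = (\<Sum>i\<le>k. N i)" for k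
  have rN: "N k \<le> r k" for k
    unfolding r_def by (rule member_le_sum) auto
  have r_mono: "r n \<le> r m" if "n \<le> m" for n m
    unfolding r_def using that by (intro sum_mono2) auto
  have "\<exists>g\<in>L2_space M. \<forall>n. L2_norm M (\<lambda>x. f (r n) x - g x) \<le> (1/2) ^ n"
    by (rule L2_limit_exists_fast) (use f N rN r_mono in auto)
  then obtain g where g: "g \<in> L2_space M" and fg: "\<And>n. L2_norm M (\<lambda>x. f (r n) x - g x) \<le> (1/2) ^ n"
    by auto
  have est: "L2_norm M (\<lambda>x. f n x - g x) \<le> 2 * (1/2) ^ k" if "n \<ge> r k" for n k
  proof -
    have "L2_norm M (\<lambda>x. f n x - g x) \<le> L2_norm M (\<lambda>x. f n x - f (r k) x) + L2_norm M (\<lambda>x. f (r k) x - g x)"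
      using L2_norm_triangle[of "\<lambda>x. f n x - f (r k) x" M "\<lambda>x. f (r k) x - g x"] f g by simp
    then show ?thesis
      using N[OF rN that] fg[of k] by simp
  qed
  have "(\<lambda>n. L2_norm M (\<lambda>x. f n x - g x)) \<longlonglongrightarrow> 0"
  proof (rule LIMSEQ_I)
    fix e :: real assume "0 < e"
    then obtain k where k: "(1/2::real) ^ k < e / 2"
      using real_arch_pow_inv[of "e/2" "1/2"] by auto
    show "\<exists>no. \<forall>n\<ge>no. norm (L2_norm M (\<lambda>x. f n x - g x) - 0) < e"
      using est[of k] k by (intro exI[of _ "r k"]) fastforce
  qed
  with g show ?thesis by blast
qed


section \<open>Eigenvalues counted with multiplicity\<close>

text \<open>Elimination of one unknown per equation. It supplies every dimension count below: a span of more
vectors than there are orthogonality conditions contains a nontrivial combination that satisfies them.\<close>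

lemma homogeneous_system_nontrivial:
  fixes A :: "'k \<Rightarrow> 'i \<Rightarrow> complex"
  assumes "finite K" and "finite I" and "card K < card I"
  shows "\<exists>c. (\<exists>i\<in>I. c i \<noteq> 0) \<and> (\<forall>k\<in>K. (\<Sum>i\<in>I. c i * A k i) = 0)"
  using assms
proof (induction K arbitrary: I A rule: finite_induct)
  case empty
  then obtain i where "i \<in> I"
    by (auto simp: card_gt_0_iff)
  then show ?case
    by (intro exI[of _ "\<lambda>_. 1"]) auto
next
  case (insert m K)
  show ?case
  proof (cases "\<forall>i\<in>I. A m i = 0")
    case True
    have "card K < card I"
      using insert by simp
    with insert.IH[OF insert.prems(1), of A] True show ?thesis
      by auto
  next
    case False
    then obtain p where p: "p \<in> I" "A m p \<noteq> 0"
      by auto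
    \<comment> \<open>the \<open>m\<close>-th equation solved for the unknown \<open>p\<close> and substituted into the others\<close>
    define A' where "A' k i = A k i - A k p * A m i / A m p" for k i
    have "card K < card (I - {p})"
      using insert p by simp
    then obtain c where c: "\<exists>i\<in>I - {p}. c i \<noteq> 0" "\<And>k. k \<in> K \<Longrightarrow> (\<Sum>i\<in>I - {p}. c i * A' k i) = 0"
      using insert.IH[of "I - {p}" A'] insert.prems(1) by auto
    define c' where "c' = c(p := - (\<Sum>i\<in>I - {p}. c i * A m i) / A m p)"
    have split: "(\<Sum>i\<in>I. c' i * A k i) = (\<Sum>i\<in>I - {p}. c i * A' k i)" for k
    proof -
      have "(\<Sum>i\<in>I. c' i * A k i) = c' p * A k p + (\<Sum>i\<in>I - {p}. c' i * A k i)"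
        using insert.prems(1) p by (simp add: sum.remove)
      also have "(\<Sum>i\<in>I - {p}. c' i * A k i) = (\<Sum>i\<in>I - {p}. c i * A k i)"
        by (intro sum.cong) (auto simp: c'_def)
      also have "c' p * A k p = - (\<Sum>i\<in>I - {p}. c i * (A k p * A m i / A m p))"
        by (simp add: c'_def sum_distrib_left sum_divide_distrib sum_negf mult_ac)
      finally show ?thesis
        by (simp add: A'_def right_diff_distrib sum_subtractf)
    qed
    moreover have "(\<Sum>i\<in>I - {p}. c i * A' m i) = 0"
      using p by (simp add: A'_def)
    moreover have "\<exists>i\<in>I. c' i \<noteq> 0"
      using c(1) by (auto simp: c'_def)
    ultimately show ?thesis
      using c(2) by (intro exI[of _ c']) auto
  qed
qed

lemma enat_sum: "finite F \<Longrightarrow> enat (\<Sum>t\<in>F. f t) = (\<Sum>t\<in>F. enat (f t))"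
  by (induction F rule: finite_induct) (auto simp: zero_enat_def simp flip: plus_enat_simps(1))

lemma eigen_mult_geI:
  assumes "\<And>i. i < n \<Longrightarrow> (u i, \<lambda>x. \<mu> * u i x) \<in> T" and "L2_independent M n u"
  shows "enat n \<le> eigen_mult M T \<mu>"
  unfolding eigen_mult_def using assms by (intro Sup_upper) auto

text \<open>An infinite supremum of extended naturals need not be attained, but each finite positive lower bound of it is
reached by some element. This is how numbers of eigenvalues are turned into eigenfunctions.\<close>

lemma enat_le_Sup_imp_ex:
  assumes "enat n \<le> Sup X" and "n > 0"
  shows "\<exists>x\<in>X. enat n \<le> x"
proof (rule ccontr)
  assume "\<not> (\<exists>x\<in>X. enat n \<le> x)"
  then have lt: "x < enat (Suc (n - 1))" if "x \<in> X" for x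
    using that \<open>n > 0\<close> by (auto simp: not_le)
  then have "x \<le> enat (n - 1)" if "x \<in> X" for x
    using lt[OF that] by (cases x) auto
  then have "Sup X \<le> enat (n - 1)"
    by (intro Sup_least)
  then have "enat n \<le> enat (n - 1)"
    using assms(1) by (rule order_trans[rotated])
  with \<open>n > 0\<close> show False
    by simp
qed

lemma eigen_mult_geD:
  assumes "enat n \<le> eigen_mult M T \<mu>"
  shows "\<exists>u. (\<forall>i<n. (u i, \<lambda>x. \<mu> * u i x) \<in> T) \<and> L2_independent M n u"
proof (cases "n = 0")
  case True
  then show ?thesis
    by (simp add: L2_independent_def)
next
  case False
  then obtain m u where m: "n \<le> m" "\<forall>i<m. (u i, \<lambda>x. \<mu> * u i x) \<in> T" "L2_independent M m u"
    using enat_le_Sup_imp_ex[OF assms[unfolded eigen_mult_def]] by auto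
  have "L2_independent M n u"
    unfolding L2_independent_def
  proof safe
    fix c :: "nat \<Rightarrow> complex" and i
    assume ae: "AE x in M. (\<Sum>i<n. c i * u i x) = 0" and "i < n"
    define c' where "c' i = (if i < n then c i else 0)" for i
    have "(\<Sum>i<m. c' i * u i x) = (\<Sum>i<n. c i * u i x)" for x
      using m(1) by (intro sum.mono_neutral_cong_right) (auto simp: c'_def)
    then have "\<forall>i<m. c' i = 0"
      using m(3) ae unfolding L2_independent_def by auto
    then show "c i = 0"
      using \<open>i < n\<close> m(1) by (auto simp: c'_def dest!: spec[of _ i])
  qed
  with m show ?thesis
    by (intro exI[of _ u]) auto
qed

lemma eigen_count_geD:
  assumes "enat n \<le> eigen_count M T I"
  shows "\<exists>F. finite F \<and> F \<subseteq> I \<and> enat n \<le> (\<Sum>t\<in>F. eigen_mult M T (complex_of_real t))"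
proof (cases "n = 0")
  case True
  then show ?thesis
    by (intro exI[of _ "{}"]) (auto simp: zero_enat_def)
next
  case False
  then show ?thesis
    using enat_le_Sup_imp_ex[OF assms[unfolded eigen_count_def]] by auto
qed

lemma eigen_count_geI:
  assumes "finite F" and "F \<subseteq> I"
  shows "(\<Sum>t\<in>F. eigen_mult M T (complex_of_real t)) \<le> eigen_count M T I"
  unfolding eigen_count_def using assms by (intro SUP_upper) auto

text \<open>The operator \<open>T\<close> generated by the form \<open>a\<close> with domain \<open>Q\<close>. Where solutions of an equation \<open>(T - s) u = f\<close>
are used below, they come from the surjectivity that is part of the definition of the resolvent set.\<close>

locale form_operator = hermitian_form Q a
  for Q :: "('a \<Rightarrow> complex) set" and a +
  fixes M :: "'a measure"
  assumes Q_L2 [simp]: "u \<in> Q \<Longrightarrow> u \<in> L2_space M"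
begin

abbreviation ip :: "('a \<Rightarrow> complex) \<Rightarrow> ('a \<Rightarrow> complex) \<Rightarrow> complex" where
  "ip \<equiv> L2_inner M"

definition T :: "(('a \<Rightarrow> complex) \<times> ('a \<Rightarrow> complex)) set" where
  "T = {(u, f). u \<in> Q \<and> f \<in> L2_space M \<and> (\<forall>v\<in>Q. a u v = ip f v)}"

lemmas ip_simps = L2.sesquilinear

lemma eigen_iff:
  "(u, \<lambda>x. \<mu> * u x) \<in> T \<longleftrightarrow> u \<in> Q \<and> (\<forall>v\<in>Q. a u v = \<mu> * ip u v)"
  by (auto simp: T_def ip_simps)

lemma eigen_orthogonal:
  assumes "(u, \<lambda>x. complex_of_real s * u x) \<in> T" and "(v, \<lambda>x. complex_of_real r * v x) \<in> T" and "s \<noteq> r"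
  shows "ip u v = 0"
proof -
  have u: "u \<in> Q" "a u v = s * ip u v" and v: "v \<in> Q" "a v u = r * ip v u"
    using assms by (auto simp: eigen_iff)
  have "s * ip u v = cnj (r * ip v u)"
    using hermitian[of v u] u v by simp
  also have "\<dots> = r * ip u v"
    using L2.hermitian[of v M u] u v by simp
  finally show ?thesis
    using assms(3) by simp
qed

lemma eigen_sum:
  assumes "\<And>i. i \<in> I \<Longrightarrow> (u i, \<lambda>x. \<mu> * u i x) \<in> T"
  shows "((\<lambda>x. \<Sum>i\<in>I. c i * u i x), \<lambda>x. \<mu> * (\<Sum>i\<in>I. c i * u i x)) \<in> T"
  using assms unfolding eigen_iff
  by (auto simp: sum_left L2.sum_left sum_distrib_left mult_ac)

lemma eigen_scale:
  assumes "(u, \<lambda>x. \<mu> * u x) \<in> T"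
  shows "((\<lambda>x. c * u x), \<lambda>x. \<mu> * (c * u x)) \<in> T"
  using assms unfolding eigen_iff by (auto simp: sesquilinear ip_simps)

text \<open>One family for all eigenvalues in \<open>I\<close>: by \<open>orthonormal_eigen_of_count\<close> and \<open>count_of_orthonormal_eigen\<close> it
exists if and only if \<open>I\<close> contains at least \<open>n\<close> eigenvalues, counted with multiplicity.\<close>

definition orthonormal_eigen :: "real set \<Rightarrow> nat \<Rightarrow> (nat \<Rightarrow> 'a \<Rightarrow> complex) \<Rightarrow> (nat \<Rightarrow> real) \<Rightarrow> bool" where
  "orthonormal_eigen I n e ev \<longleftrightarrow>
     (\<forall>i<n. ev i \<in> I \<and> (e i, \<lambda>x. complex_of_real (ev i) * e i x) \<in> T) \<and>
     (\<forall>i<n. \<forall>k<n. ip (e i) (e k) = (if i = k then 1 else 0))"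

lemma orthonormal_eigen_extend:
  assumes e: "orthonormal_eigen I n e ev"
    and w: "(w, \<lambda>x. complex_of_real s * w x) \<in> T" and s: "s \<in> I"
    and orth: "\<And>i. i < n \<Longrightarrow> ip w (e i) = 0" and nz: "Re (ip w w) > 0"
  shows "\<exists>e ev. orthonormal_eigen I (Suc n) e ev"
proof -
  define r where "r = 1 / sqrt (Re (ip w w))"
  define w' where "w' = (\<lambda>x. complex_of_real r * w x)"
  have wQ: "w \<in> Q" and eQ: "e i \<in> Q" if "i < n" for i
    using w e that by (auto simp: eigen_iff orthonormal_eigen_def)
  have wQ: "w \<in> Q"
    using w by (simp add: eigen_iff)
  have w'T: "(w', \<lambda>x. complex_of_real s * w' x) \<in> T"
    unfolding w'_def by (rule eigen_scale[OF w])
  have w'e: "ip w' (e i) = 0" if "i < n" for i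
    using orth[OF that] eQ[OF that] wQ by (simp add: w'_def ip_simps)
  then have ew': "ip (e i) w' = 0" if "i < n" for i
    using L2.hermitian[of w' M "e i"] that eQ wQ by (simp add: w'_def)
  have "Re (ip w' w') = 1"
    unfolding w'_def using nz wQ by (subst L2.diag_scale) (simp_all add: r_def norm_divide power_divide)
  then have w'w': "ip w' w' = 1"
    using L2.diag_real[of w' M] wQ by (simp add: w'_def)
  have "orthonormal_eigen I (Suc n) (e(n := w')) (ev(n := s))"
    using e w'T w'e ew' w'w' s unfolding orthonormal_eigen_def
    by (auto simp: less_Suc_eq)
  then show ?thesis by blast
qed

text \<open>Gram-Schmidt with one vector at a time. As long as the family is shorter than the total multiplicity,
some eigenspace has a dimension larger than the number of its members in the family, hence contains a
nonzero vector orthogonal to those members. The other members belong to different eigenvalues and are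
orthogonal to it anyway.\<close>

lemma orthonormal_eigen_of_mult:
  assumes "finite F" and "enat n \<le> (\<Sum>t\<in>F. eigen_mult M T (complex_of_real t))"
  shows "\<exists>e ev. orthonormal_eigen F n e ev"
  using assms(2)
proof (induction n)
  case 0
  show ?case by (simp add: orthonormal_eigen_def)
next
  case (Suc n)
  then have "enat n \<le> (\<Sum>t\<in>F. eigen_mult M T (complex_of_real t))"
    by (metis Suc_ile_eq less_imp_le)
  then obtain e ev where e: "orthonormal_eigen F n e ev"
    using Suc.IH by blast
  define J where "J t = {i. i < n \<and> ev i = t}" for t
  have [simp]: "finite (J t)" for t
    by (simp add: J_def)
  have "(\<Sum>t\<in>F. card (J t)) = card (\<Union>t\<in>F. J t)"
    using assms(1) by (subst card_UN_disjoint) (auto simp: J_def)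
  also have "(\<Union>t\<in>F. J t) = {..<n}"
    using e by (auto simp: J_def orthonormal_eigen_def)
  finally have n: "(\<Sum>t\<in>F. card (J t)) = n"
    by simp
  have "\<exists>t\<in>F. enat (card (J t)) < eigen_mult M T (complex_of_real t)"
  proof (rule ccontr)
    assume "\<not> ?thesis"
    then have "(\<Sum>t\<in>F. eigen_mult M T (complex_of_real t)) \<le> (\<Sum>t\<in>F. enat (card (J t)))"
      by (intro sum_mono) (auto simp: not_less)
    also have "\<dots> = enat (\<Sum>t\<in>F. card (J t))"
      by (simp add: enat_sum assms(1))
    finally have "enat (Suc n) \<le> enat n"
      using Suc.prems n by (metis order_trans)
    then show False by simp
  qed
  then obtain t where t: "t \<in> F" "enat (Suc (card (J t))) \<le> eigen_mult M T (complex_of_real t)"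
    by (auto simp: Suc_ile_eq)
  then obtain u where u: "\<And>i. i < Suc (card (J t)) \<Longrightarrow> (u i, \<lambda>x. complex_of_real t * u i x) \<in> T"
    and indep: "L2_independent M (Suc (card (J t))) u"
    using eigen_mult_geD by blast
  have "card (J t) < card {..<Suc (card (J t))}"
    by simp
  from homogeneous_system_nontrivial[OF _ _ this, of "\<lambda>k i. ip (u i) (e k)"]
  obtain c where c: "\<exists>i<Suc (card (J t)). c i \<noteq> 0"
    and c0: "\<And>k. k \<in> J t \<Longrightarrow> (\<Sum>i<Suc (card (J t)). c i * ip (u i) (e k)) = 0"
    by auto
  define w where "w = (\<lambda>x. \<Sum>i<Suc (card (J t)). c i * u i x)"
  have wT: "(w, \<lambda>x. complex_of_real t * w x) \<in> T"
    unfolding w_def by (rule eigen_sum) (use u in auto)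
  have uQ: "u i \<in> Q" if "i < Suc (card (J t))" for i
    using u[OF that] by (auto simp: eigen_iff)
  have orth: "ip w (e k) = 0" if "k < n" for k
  proof (cases "ev k = t")
    case True
    then have "k \<in> J t" using that by (simp add: J_def)
    have "e k \<in> Q"
      using e that by (auto simp: orthonormal_eigen_def eigen_iff)
    then show ?thesis
      unfolding w_def using c0[OF \<open>k \<in> J t\<close>] by (subst L2.sum_left) (auto intro!: Q_L2 uQ)
  next
    case False
    then show ?thesis
      using e that wT by (intro eigen_orthogonal[of w t "e k" "ev k"]) (auto simp: orthonormal_eigen_def)
  qed
  have wL: "w \<in> L2_space M"
    using wT by (auto simp: eigen_iff)
  have "Re (ip w w) \<noteq> 0"
  proof
    assume "Re (ip w w) = 0"
    then have "AE x in M. w x = 0"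
      using L2_norm_eq_0_iff[OF wL] by (simp add: L2_norm_eq)
    then show False
      using indep c unfolding L2_independent_def w_def by blast
  qed
  then have "Re (ip w w) > 0"
    using L2.nonneg[OF wL] by linarith
  from orthonormal_eigen_extend[OF e wT t(1) orth this] show ?case by blast
qed

lemma orthonormal_eigen_of_count:
  assumes "enat n \<le> eigen_count M T I"
  shows "\<exists>e ev. orthonormal_eigen I n e ev"
proof -
  obtain F where "finite F" "F \<subseteq> I" "enat n \<le> (\<Sum>t\<in>F. eigen_mult M T (complex_of_real t))"
    using eigen_count_geD[OF assms] by blast
  then show ?thesis
    using orthonormal_eigen_of_mult[of F n] unfolding orthonormal_eigen_def by blast
qed

lemma orthonormal_eigen_independent:
  assumes e: "orthonormal_eigen I n e ev" and r: "inj_on r {..<m}" "\<And>i. i < m \<Longrightarrow> r i < n"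
  shows "L2_independent M m (\<lambda>i. e (r i))"
  unfolding L2_independent_def
proof safe
  fix c :: "nat \<Rightarrow> complex" and k
  assume ae: "AE x in M. (\<Sum>i<m. c i * e (r i) x) = 0" and k: "k < m"
  have eL: "e (r i) \<in> L2_space M" if "i < m" for i
    using e r(2)[OF that] by (auto simp: orthonormal_eigen_def eigen_iff)
  have "0 = ip (\<lambda>x. 0) (e (r k))"
    using k eL by (simp add: ip_simps)
  also have "\<dots> = ip (\<lambda>x. \<Sum>i<m. c i * e (r i) x) (e (r k))"
  proof (rule L2_inner_cong_AE)
    show "(\<lambda>x. \<Sum>i<m. c i * e (r i) x) \<in> borel_measurable M"
      by (intro L2_spaceD L2.sum_in) (use eL in auto)
  qed (use ae k eL in \<open>auto intro!: L2_spaceD\<close>)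
  also have "\<dots> = (\<Sum>i<m. c i * ip (e (r i)) (e (r k)))"
    using k eL by (subst L2.sum_left) auto
  also have "\<dots> = (\<Sum>i<m. if i = k then c i else 0)"
    using e r k by (intro sum.cong) (auto simp: orthonormal_eigen_def inj_on_def)
  also have "\<dots> = c k"
    using k by simp
  finally show "c k = 0" by simp
qed

text \<open>The members of the family with a common eigenvalue are independent, so their number is at most the
multiplicity of this eigenvalue.\<close>

lemma count_of_orthonormal_eigen:
  assumes e: "orthonormal_eigen I n e ev"
  shows "enat n \<le> eigen_count M T I"
proof -
  define F where "F = ev ` {..<n}"
  define J where "J t = {i. i < n \<and> ev i = t}" for t
  have [simp]: "finite (J t)" for t
    by (simp add: J_def)
  have F: "finite F" "F \<subseteq> I"
    using e by (auto simp: F_def orthonormal_eigen_def)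
  have "(\<Sum>t\<in>F. card (J t)) = card (\<Union>t\<in>F. J t)"
    using F by (subst card_UN_disjoint) (auto simp: J_def)
  also have "(\<Union>t\<in>F. J t) = {..<n}"
    by (auto simp: J_def F_def)
  finally have "enat n = enat (\<Sum>t\<in>F. card (J t))"
    by simp
  also have "\<dots> = (\<Sum>t\<in>F. enat (card (J t)))"
    by (simp add: enat_sum F(1))
  also have "\<dots> \<le> (\<Sum>t\<in>F. eigen_mult M T (complex_of_real t))"
  proof (rule sum_mono)
    fix t assume "t \<in> F"
    obtain r where r: "bij_betw r {..<card (J t)} (J t)"
      using ex_bij_betw_nat_finite[of "J t"] by (auto simp: atLeast0LessThan)
    have rJ: "r i \<in> J t" if "i < card (J t)" for i
      using r that by (auto simp: bij_betw_def)
    show "enat (card (J t)) \<le> eigen_mult M T (complex_of_real t)"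
    proof (rule eigen_mult_geI)
      fix i assume "i < card (J t)"
      from rJ[OF this] show "(e (r i), \<lambda>x. complex_of_real t * e (r i) x) \<in> T"
        using e by (auto simp: J_def orthonormal_eigen_def)
    next
      show "L2_independent M (card (J t)) (\<lambda>i. e (r i))"
        by (rule orthonormal_eigen_independent[OF e]) (use r rJ in \<open>auto simp: J_def bij_betw_def\<close>)
    qed
  qed
  also have "\<dots> \<le> eigen_count M T I"
    using F by (rule eigen_count_geI)
  finally show ?thesis .
qed

end


section \<open>The variational principle below the essential spectrum\<close>

context form_operator
begin

text \<open>The weak form of \<open>(T - s) u = f\<close>.\<close>

definition solves :: "real \<Rightarrow> ('a \<Rightarrow> complex) \<Rightarrow> ('a \<Rightarrow> complex) \<Rightarrow> bool" where
  "solves s u f \<longleftrightarrow> u \<in> Q \<and> f \<in> L2_space M \<and> (\<forall>q\<in>Q. a u q = s * ip u q + ip f q)"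

definition regular :: "real \<Rightarrow> bool" where
  "regular s \<longleftrightarrow> (\<forall>f\<in>L2_space M. \<exists>u. solves s u f) \<and>
     (\<exists>C>0. \<forall>u f. solves s u f \<longrightarrow> L2_norm M u \<le> C * L2_norm M f)"

lemma solvesD:
  assumes "solves s u f"
  shows "u \<in> Q" "u \<in> L2_space M" "f \<in> L2_space M" "q \<in> Q \<Longrightarrow> a u q = s * ip u q + ip f q"
  using assms by (auto simp: solves_def)

lemma solves_iff: "solves s u f \<longleftrightarrow> f \<in> L2_space M \<and> (u, \<lambda>x. complex_of_real s * u x + f x) \<in> T"
  by (auto simp: solves_def T_def ip_simps)

lemma regular_of_resolvent:
  assumes "complex_of_real s \<in> resolvent_set M T"
  shows "regular s"
  unfolding regular_def
proof (intro conjI ballI)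
  fix f assume "f \<in> L2_space M"
  then show "\<exists>u. solves s u f"
    using assms by (auto simp: resolvent_set_def solves_iff)
next
  obtain C where C: "\<And>u g. (u, g) \<in> T \<Longrightarrow> L2_norm M u \<le> C * L2_norm M (\<lambda>x. g x - complex_of_real s * u x)"
    using assms unfolding resolvent_set_def by blast
  have "L2_norm M u \<le> max 1 C * L2_norm M f" if "solves s u f" for u f
  proof -
    have "L2_norm M u \<le> C * L2_norm M f"
      using C[of u "\<lambda>x. complex_of_real s * u x + f x"] that by (simp add: solves_iff)
    also have "\<dots> \<le> max 1 C * L2_norm M f"
      by (intro mult_right_mono) auto
    finally show ?thesis .
  qed
  then show "\<exists>C>0. \<forall>u f. solves s u f \<longrightarrow> L2_norm M u \<le> C * L2_norm M f"
    by (intro exI[of _ "max 1 C"]) auto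
qed

lemma solves_scale: "solves s u f \<Longrightarrow> solves s (\<lambda>x. c * u x) (\<lambda>x. c * f x)"
  by (auto simp: solves_def sesquilinear ip_simps algebra_simps)

lemma solves_shift:
  "solves s u f \<Longrightarrow> solves (s + d) u (\<lambda>x. f x - complex_of_real d * u x)"
  by (auto simp: solves_def ip_simps algebra_simps)

lemma solves_add: "solves s u f \<Longrightarrow> solves s v g \<Longrightarrow> solves s (\<lambda>x. u x + v x) (\<lambda>x. f x + g x)"
  by (auto simp: solves_def sesquilinear ip_simps algebra_simps)

lemma solves_symmetric:
  assumes "solves s u f" and "solves s v g"
  shows "ip f v = ip u g"
proof -
  have "s * ip u v + ip f v = cnj (s * ip v u + ip g u)"
    using assms hermitian[of v u] by (auto simp: solves_def)
  also have "\<dots> = s * ip u v + ip u g"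
    using assms L2.hermitian[of v M u] L2.hermitian[of g M u] by (auto simp: solves_def)
  finally show ?thesis by simp
qed

lemma solves_orthogonal:
  assumes "solves s u f" and e: "(e, \<lambda>x. complex_of_real r * e x) \<in> T" and "r \<noteq> s" and "ip f e = 0"
  shows "ip u e = 0"
proof -
  have "solves s e (\<lambda>x. complex_of_real (r - s) * e x)"
    using e by (auto simp: solves_def eigen_iff ip_simps algebra_simps)
  from solves_symmetric[OF assms(1) this] show ?thesis
    using assms by (auto simp: eigen_iff ip_simps solves_def)
qed

lemma regular_not_eigen:
  assumes "regular s" and "(w, \<lambda>x. complex_of_real s * w x) \<in> T"
  shows "L2_norm M w = 0"
proof -
  obtain C where C: "\<And>u f. solves s u f \<Longrightarrow> L2_norm M u \<le> C * L2_norm M f"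
    using assms(1) by (auto simp: regular_def)
  have "solves s w (\<lambda>x. 0)"
    using assms(2) by (auto simp: solves_iff)
  from C[OF this] show ?thesis
    using L2_norm_nonneg[of M w] by (simp add: L2_norm_eq L2.zero_left)
qed

text \<open>The resolvent of a self-adjoint operator at \<open>s\<close> has a norm of at most the inverse distance of \<open>s\<close> to
the spectrum. Let \<open>R\<close> be the resolvent at \<open>s\<close> and \<open>1 / d\<close> its norm, and suppose \<open>d < \<delta>\<close>. For a unit vector
\<open>v = R g\<close> with \<open>|g|\<close> close to \<open>d\<close> the vector \<open>h = (1 - d\<^sup>2 R\<^sup>2) g\<close> is small. But \<open>1 - d\<^sup>2 R\<^sup>2\<close> is the product of
\<open>1 - d R\<close> and \<open>1 + d R\<close>, both of which are bounded below, because \<open>s + d\<close> and \<open>s - d\<close> are regular.\<close>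

lemma regular_interval_estimate:
  assumes "0 < \<delta>" and reg: "\<And>r. s - \<delta> < r \<Longrightarrow> r < s + \<delta> \<Longrightarrow> regular r" and u: "solves s u f"
  shows "\<delta> * L2_norm M u \<le> L2_norm M f"
proof (rule ccontr)
  assume "\<not> ?thesis"
  then have less: "L2_norm M f < \<delta> * L2_norm M u" by simp
  define R where "R = {L2_norm M f | u f. solves s u f \<and> L2_norm M u = 1}"
  have normalize: "L2_norm M g / L2_norm M v \<in> R" if "solves s v g" "L2_norm M v > 0" for v g
  proof -
    define c where "c = complex_of_real (1 / L2_norm M v)"
    have "solves s (\<lambda>x. c * v x) (\<lambda>x. c * g x)"
      using that(1) by (rule solves_scale)
    moreover have "L2_norm M (\<lambda>x. c * v x) = 1" "L2_norm M (\<lambda>x. c * g x) = L2_norm M g / L2_norm M v"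
      using that solvesD[OF that(1)] by (subst L2_norm_scale; simp add: c_def norm_divide)+
    ultimately show ?thesis
      unfolding R_def by (intro CollectI exI[of _ "\<lambda>x. c * v x"] exI[of _ "\<lambda>x. c * g x"]) simp
  qed
  have "0 < \<delta> * L2_norm M u"
    using less L2_norm_nonneg[of M f] by linarith
  then have u_pos: "L2_norm M u > 0"
    using \<open>0 < \<delta>\<close> by (simp add: zero_less_mult_iff)
  have bdd: "bdd_below R"
    by (rule bdd_belowI[of _ 0]) (auto simp: R_def)
  define d where "d = Inf R"
  have "d \<le> L2_norm M f / L2_norm M u"
    unfolding d_def using normalize[OF u u_pos] bdd by (rule cInf_lower)
  also have "\<dots> < \<delta>"
    using less u_pos by (simp add: field_simps)
  finally have d_less: "d < \<delta>" .
  have "regular s"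
    using reg[of s] \<open>0 < \<delta>\<close> by simp
  then obtain C where C: "C > 0" "\<And>u f. solves s u f \<Longrightarrow> L2_norm M u \<le> C * L2_norm M f"
    by (auto simp: regular_def)
  have "1 / C \<le> d"
    unfolding d_def
  proof (rule cInf_greatest)
    show "R \<noteq> {}"
      using normalize[OF u u_pos] by blast
    show "1 / C \<le> r" if "r \<in> R" for r
      using that C by (force simp: R_def field_simps)
  qed
  then have d_pos: "0 < d"
    using C(1) by (intro less_le_trans[of 0 "1 / C" d]) auto
  have "regular (s + d)" "regular (s - d)"
    using d_less d_pos by (auto intro!: reg)
  then obtain C1 C2 where C1: "C1 > 0" "\<And>u f. solves (s + d) u f \<Longrightarrow> L2_norm M u \<le> C1 * L2_norm M f"
    and C2: "C2 > 0" "\<And>u f. solves (s - d) u f \<Longrightarrow> L2_norm M u \<le> C2 * L2_norm M f"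
    unfolding regular_def by metis
  \<comment> \<open>\<open>K\<close> bounds \<open>|v| / |h|\<close>, and \<open>\<eta>\<close> is so small that \<open>|h| \<le> 1 / (K sqrt 2)\<close>\<close>
  define K where "K = (1 + d * C2) * C1"
  have K: "K > 0"
    using C1(1) C2(1) d_pos by (simp add: K_def add_pos_pos)
  define \<eta> where "\<eta> = min 1 (1 / (2 * K\<^sup>2 * (2 * d + 1)))"
  have \<eta>: "\<eta> > 0" "\<eta> \<le> 1"
    using K d_pos by (auto simp: \<eta>_def)
  have "\<exists>r\<in>R. r < d + \<eta>"
    using cInf_lessD[of R "d + \<eta>"] normalize[OF u u_pos] \<eta>(1) by (auto simp: d_def)
  then obtain v g where v: "solves s v g" "L2_norm M v = 1" and g_less: "L2_norm M g < d + \<eta>"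
    by (auto simp: R_def)
  note vD = solvesD[OF v(1)]
  obtain p where p: "solves s p v"
    using \<open>regular s\<close> vD(2) by (auto simp: regular_def)
  note pD = solvesD[OF p]
  have p_norm: "d * L2_norm M p \<le> 1"
  proof (cases "L2_norm M p = 0")
    case False
    then have "L2_norm M p > 0"
      using L2_norm_nonneg[of M p] by linarith
    moreover from normalize[OF p this] have "d \<le> 1 / L2_norm M p"
      unfolding d_def v(2) using bdd by (intro cInf_lower) auto
    ultimately show ?thesis
      by (simp add: field_simps)
  qed simp
  define h where "h = (\<lambda>x. g x - complex_of_real (d\<^sup>2) * p x)"
  have hL: "h \<in> L2_space M"
    unfolding h_def using vD pD by auto
  have "ip g p = ip v v"
    using solves_symmetric[OF v(1) p] by simp
  then have "Re (ip g p) = 1"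
    using v(2) by (simp add: L2_norm_eq)
  then have "(L2_norm M h)\<^sup>2 = (L2_norm M g)\<^sup>2 - 2 * d\<^sup>2 + (d\<^sup>2)\<^sup>2 * (L2_norm M p)\<^sup>2"
    unfolding L2_norm_sq h_def using vD pD
    by (subst L2.diag_diff, simp, simp, subst L2.diag_scale) (simp_all add: L2.scale_right del: of_real_power)
  also have "(d\<^sup>2)\<^sup>2 * (L2_norm M p)\<^sup>2 = d\<^sup>2 * (d * L2_norm M p)\<^sup>2"
    by (simp add: power_mult_distrib power2_eq_square)
  also have "\<dots> \<le> d\<^sup>2 * 1\<^sup>2"
    using p_norm d_pos by (intro mult_left_mono power_mono) auto
  also have "(L2_norm M g)\<^sup>2 \<le> (d + \<eta>)\<^sup>2"
    using g_less by (intro power_mono) auto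
  finally have "(L2_norm M h)\<^sup>2 \<le> 2 * d * \<eta> + \<eta>\<^sup>2"
    by (simp add: power2_sum)
  also have "\<eta>\<^sup>2 \<le> \<eta>"
    using \<eta> by (simp add: power2_eq_square mult_left_le)
  also have "2 * d * \<eta> + \<eta> = (2 * d + 1) * \<eta>"
    by (simp add: algebra_simps)
  also have "\<dots> \<le> (2 * d + 1) * (1 / (2 * K\<^sup>2 * (2 * d + 1)))"
    using d_pos by (intro mult_left_mono) (auto simp: \<eta>_def)
  also have "\<dots> = 1 / (2 * K\<^sup>2)"
    using d_pos by simp
  finally have h2: "K\<^sup>2 * (L2_norm M h)\<^sup>2 \<le> 1 / 2"
    using K by (simp add: field_simps)
  define q where "q = (\<lambda>x. complex_of_real d * p x + v x)"
  have "solves s q (\<lambda>x. complex_of_real d * v x + g x)"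
    unfolding q_def by (intro solves_add solves_scale p v)
  from solves_shift[OF this, of d] have "solves (s + d) q h"
    by (simp add: q_def h_def algebra_simps power2_eq_square)
  from C1(2)[OF this] have q_norm: "L2_norm M q \<le> C1 * L2_norm M h" .
  from solves_shift[OF p, of "- d"] have "solves (s - d) p q"
    by (simp add: q_def algebra_simps)
  from C2(2)[OF this] have p_q: "L2_norm M p \<le> C2 * L2_norm M q" .
  have "L2_norm M v \<le> L2_norm M q + L2_norm M (\<lambda>x. complex_of_real d * p x)"
    using L2_norm_triangle_diff[of v M q] vD(2) pD(2) L2_norm_minus[of M "\<lambda>x. complex_of_real d * p x"]
    by (simp add: q_def)
  also have "L2_norm M (\<lambda>x. complex_of_real d * p x) = d * L2_norm M p"
    using pD(2) d_pos by (simp add: L2_norm_scale)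
  also have "d * L2_norm M p \<le> d * (C2 * L2_norm M q)"
    using p_q d_pos by (intro mult_left_mono) auto
  also have "L2_norm M q + d * (C2 * L2_norm M q) = (1 + d * C2) * L2_norm M q"
    by (simp add: algebra_simps)
  also have "\<dots> \<le> (1 + d * C2) * (C1 * L2_norm M h)"
    using q_norm d_pos C2(1) by (intro mult_left_mono) auto
  also have "\<dots> = K * L2_norm M h"
    by (simp add: K_def)
  finally have "1 \<le> K * L2_norm M h"
    using v(2) by simp
  then have "1\<^sup>2 \<le> (K * L2_norm M h)\<^sup>2"
    by (intro power_mono) auto
  with h2 show False
    by (simp add: power_mult_distrib)
qed

text \<open>In terms of the spectrum: \<open>2 \<delta> x \<le> x\<^sup>2\<close> holds for all \<open>x\<close> outside the open interval from \<open>0\<close> to \<open>2 \<delta>\<close>. The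
proof expands the square in the resolvent estimate at the midpoint \<open>m + \<delta>\<close>.\<close>

lemma spectral_gap_estimate:
  assumes "0 < \<delta>" and reg: "\<And>r. m < r \<Longrightarrow> r < m + 2 * \<delta> \<Longrightarrow> regular r" and u: "solves m u f"
  shows "2 * \<delta> * Re (ip f u) \<le> (L2_norm M f)\<^sup>2"
proof -
  note uD = solvesD[OF u]
  have "\<delta> * L2_norm M u \<le> L2_norm M (\<lambda>x. f x - complex_of_real \<delta> * u x)"
    using solves_shift[OF u, of \<delta>] by (intro regular_interval_estimate[of \<delta> "m + \<delta>"] reg assms(1)) auto
  then have "(\<delta> * L2_norm M u)\<^sup>2 \<le> (L2_norm M (\<lambda>x. f x - complex_of_real \<delta> * u x))\<^sup>2"
    using assms(1) by (intro power_mono) auto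
  also have "\<dots> = (L2_norm M f)\<^sup>2 - 2 * \<delta> * Re (ip f u) + (\<delta> * L2_norm M u)\<^sup>2"
    unfolding L2_norm_sq power_mult_distrib using uD
    by (subst L2.diag_diff, simp, simp, subst L2.diag_scale) (simp_all add: L2.scale_right)
  finally show ?thesis by simp
qed

text \<open>The resolvent maps the orthogonal complement of an eigenfunction to itself. A function with eigenvalue
\<open>s\<close> itself vanishes almost everywhere, as \<open>s\<close> is regular.\<close>

lemma regular_solves_orthogonal:
  assumes "regular s" and u: "solves s u f" and e: "(e, \<lambda>x. complex_of_real r * e x) \<in> T" and "ip f e = 0"
  shows "ip u e = 0"
proof (cases "r = s")
  case True
  then have "L2_norm M e = 0"
    using regular_not_eigen assms(1) e by blast
  then show ?thesis
    using L2_cauchy_schwarz[of u M e] u e by (auto simp: eigen_iff solves_def)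
next
  case False
  then show ?thesis
    using solves_orthogonal[OF u e] assms(4) by blast
qed

lemma shifted_form:
  assumes "\<And>u v c. u \<in> S \<Longrightarrow> v \<in> S \<Longrightarrow> (\<lambda>x. u x + v x) \<in> S" "\<And>u c. u \<in> S \<Longrightarrow> (\<lambda>x. c * u x) \<in> S"
    and "(\<lambda>x. 0) \<in> S" and "S \<subseteq> Q" and "\<And>v. v \<in> S \<Longrightarrow> m * Re (ip v v) \<le> Re (a v v)"
  shows "hermitian_form S (\<lambda>u v. a u v - complex_of_real m * ip u v)"
proof
  fix u v assume "u \<in> S" "v \<in> S"
  then show "a v u - complex_of_real m * ip v u = cnj (a u v - complex_of_real m * ip u v)"
    using hermitian[of u v] L2.hermitian[of u M v] assms(4) by (auto simp: subset_iff)
qed (use assms in \<open>auto simp: subset_iff sesquilinear ip_simps algebra_simps\<close>)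

definition orthocomplement :: "nat \<Rightarrow> (nat \<Rightarrow> 'a \<Rightarrow> complex) \<Rightarrow> ('a \<Rightarrow> complex) set" where
  "orthocomplement n e = {v \<in> Q. \<forall>i<n. ip v (e i) = 0}"

lemma orthocomplement_form:
  assumes e: "\<And>i. i < n \<Longrightarrow> e i \<in> Q"
    and m: "\<And>v. v \<in> orthocomplement n e \<Longrightarrow> m * Re (ip v v) \<le> Re (a v v)"
  shows "hermitian_form (orthocomplement n e) (\<lambda>u v. a u v - complex_of_real m * ip u v)"
  by (rule shifted_form) (use e m in \<open>auto simp: orthocomplement_def ip_simps\<close>)

lemma solves_in_orthocomplement:
  assumes "\<And>i. i < n \<Longrightarrow> (e i, \<lambda>x. complex_of_real (ev i) * e i x) \<in> T"
    and "regular s" and "solves s u f" and "\<And>i. i < n \<Longrightarrow> ip f (e i) = 0"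
  shows "u \<in> orthocomplement n e"
  using assms regular_solves_orthogonal[OF assms(2,3)] by (auto simp: orthocomplement_def solves_def)

text \<open>Let \<open>b\<close> be the form \<open>a - m\<close>, which is nonnegative on the complement. If \<open>v\<close> is a unit vector and
\<open>(T - m) w = v\<close>, then the Cauchy-Schwarz inequality gives \<open>1 = |b w v|\<^sup>2 \<le> b w w * b v v \<le> C * b v v\<close>,
while \<open>b v v\<close> can be made arbitrarily small.\<close>

lemma regular_not_bottom:
  assumes e: "\<And>i. i < n \<Longrightarrow> (e i, \<lambda>x. complex_of_real (ev i) * e i x) \<in> T"
    and "regular m"
    and m: "\<And>v. v \<in> orthocomplement n e \<Longrightarrow> m * Re (ip v v) \<le> Re (a v v)"
    and approx: "\<And>\<eta>. \<eta> > 0 \<Longrightarrow> \<exists>v\<in>orthocomplement n e. L2_norm M v = 1 \<and> Re (a v v) < m + \<eta>"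
  shows False
proof -
  interpret b: hermitian_form "orthocomplement n e" "\<lambda>u v. a u v - complex_of_real m * ip u v"
    using e m by (intro orthocomplement_form) (auto simp: eigen_iff)
  obtain C where C: "C > 0" "\<And>u f. solves m u f \<Longrightarrow> L2_norm M u \<le> C * L2_norm M f"
    using assms(2) by (auto simp: regular_def)
  obtain v where v: "v \<in> orthocomplement n e" "L2_norm M v = 1" "Re (a v v) < m + 1 / (2 * C)"
    using approx[of "1 / (2 * C)"] C by auto
  then have vL: "v \<in> L2_space M" "v \<in> Q"
    by (auto simp: orthocomplement_def)
  have vv: "ip v v = 1"
    using L2.diag_real[OF vL(1)] v(2) by (simp add: L2_norm_eq)
  obtain w where w: "solves m w v"
    using assms(2) vL unfolding regular_def by blast
  have wS: "w \<in> orthocomplement n e"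
    by (rule solves_in_orthocomplement[OF e assms(2) w]) (use v in \<open>auto simp: orthocomplement_def\<close>)
  have "(cmod (a w v - complex_of_real m * ip w v))\<^sup>2 \<le>
      Re (a w w - complex_of_real m * ip w w) * Re (a v v - complex_of_real m * ip v v)"
    by (rule b.cauchy_schwarz[OF wS v(1)])
  also have "a w v - complex_of_real m * ip w v = 1"
    using solvesD(4)[OF w vL(2)] vv by simp
  also have "a w w - complex_of_real m * ip w w = ip v w"
    using solvesD(4)[OF w solvesD(1)[OF w]] by simp
  finally have "1 \<le> Re (ip v w) * (Re (a v v) - m)"
    using vv by simp
  also have "\<dots> \<le> C * (Re (a v v) - m)"
  proof (rule mult_right_mono)
    have "Re (ip v w) \<le> L2_norm M v * L2_norm M w"
      using L2_cauchy_schwarz_Re[of v M w] vL solvesD(2)[OF w] by linarith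
    also have "\<dots> \<le> C"
      using C(2)[OF w] v(2) by simp
    finally show "Re (ip v w) \<le> C" .
    show "0 \<le> Re (a v v) - m"
      using m[OF v(1)] vv by simp
  qed
  also have "\<dots> \<le> C * (1 / (2 * C))"
    using v(3) C(1) by (intro mult_left_mono) auto
  finally show False
    using C(1) by simp
qed

end

text \<open>Here \<open>A\<close>, \<open>C\<close> and \<open>X\<close> stand for \<open>|y|\<^sup>2\<close>, \<open>|y'|\<^sup>2\<close> and \<open>Re (y, y')\<close>, where \<open>(B + \<epsilon>) y = (B + \<epsilon>') y' = v\<close> and \<open>B\<close> is a
positive operator; the last hypothesis is the positivity of \<open>B\<close> on \<open>y' - y\<close>. The conclusion says that
\<open>\<epsilon> y - \<epsilon>' y'\<close> has a nonnegative product with \<open>\<epsilon>' y'\<close>.\<close>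

lemma resolvent_family_monotone:
  fixes A C X \<epsilon> \<epsilon>' :: real
  assumes "0 < \<epsilon>'" and "\<epsilon>' \<le> \<epsilon>" and "0 \<le> A" and "0 \<le> C" and X: "\<bar>X\<bar> \<le> sqrt A * sqrt C"
    and pos: "\<epsilon> * A + \<epsilon>' * C \<le> (\<epsilon> + \<epsilon>') * X"
  shows "\<epsilon>' * C \<le> \<epsilon> * X"
proof -
  define p q where "p = sqrt A" and "q = sqrt C"
  have pq: "0 \<le> p" "0 \<le> q" "A = p\<^sup>2" "C = q\<^sup>2"
    using assms by (auto simp: p_def q_def)
  have "(\<epsilon> + \<epsilon>') * X \<le> (\<epsilon> + \<epsilon>') * (p * q)"
    using X assms(1,2) by (intro mult_left_mono) (auto simp: p_def q_def)
  with pos have neg: "(p - q) * (\<epsilon> * p - \<epsilon>' * q) \<le> 0"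
    by (simp add: pq algebra_simps power2_eq_square)
  have "\<epsilon>' * q \<le> \<epsilon> * p"
  proof (rule ccontr)
    assume c: "\<not> ?thesis"
    then have "q \<le> p"
      using neg by (simp add: mult_le_0_iff)
    then have "\<epsilon>' * q \<le> \<epsilon> * p"
      using assms(1,2) pq by (intro mult_mono) auto
    with c show False by simp
  qed
  then have "(\<epsilon>' * q)\<^sup>2 \<le> (\<epsilon> * p)\<^sup>2"
    using assms(1) pq by (intro power_mono) auto
  then have le: "\<epsilon>' * \<epsilon>' * C \<le> \<epsilon> * \<epsilon> * A"
    by (simp add: pq power2_eq_square mult_ac)
  have "\<epsilon> * (\<epsilon> * A + \<epsilon>' * C) \<le> \<epsilon> * ((\<epsilon> + \<epsilon>') * X)"
    using pos assms by (intro mult_left_mono) auto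
  with le have "(\<epsilon> + \<epsilon>') * (\<epsilon>' * C) \<le> (\<epsilon> + \<epsilon>') * (\<epsilon> * X)"
    by (simp add: algebra_simps)
  then show ?thesis
    using assms(1,2) by simp
qed

context form_operator
begin

text \<open>As \<open>\<epsilon>\<close> tends to \<open>0\<close>, the functions \<open>w = \<epsilon> (T - m + \<epsilon>)\<inverse> v\<close> converge to the projection of \<open>v\<close> to the kernel of
\<open>T - m\<close>. They form a Cauchy sequence because \<open>|w - w'|\<^sup>2 \<le> |w|\<^sup>2 - |w'|\<^sup>2\<close> for decreasing \<open>\<epsilon>\<close>, and the limit is not
zero because the gap estimate bounds \<open>|v - w|\<^sup>2\<close> by \<open>(a v v - m) / (2 \<delta>) < 1 / 4\<close>.\<close>

lemma isolated_bottom_eigenvector: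
  assumes e: "\<And>i. i < n \<Longrightarrow> (e i, \<lambda>x. complex_of_real (ev i) * e i x) \<in> T"
    and m: "\<And>v. v \<in> orthocomplement n e \<Longrightarrow> m * Re (ip v v) \<le> Re (a v v)"
    and "0 < \<delta>" and reg: "\<And>s. s \<noteq> m \<Longrightarrow> m - 2 * \<delta> < s \<Longrightarrow> s < m + 2 * \<delta> \<Longrightarrow> regular s"
    and v: "v \<in> orthocomplement n e" "L2_norm M v = 1" "Re (a v v) < m + \<delta> / 2"
  shows "\<exists>w\<in>orthocomplement n e. (w, \<lambda>x. complex_of_real m * w x) \<in> T \<and> 0 < L2_norm M w"
proof -
  define S where "S = orthocomplement n e"
  define b where "b u v = a u v - complex_of_real m * ip u v" for u v
  interpret b: hermitian_form S b
    unfolding S_def b_def using e m by (intro orthocomplement_form) (auto simp: eigen_iff)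
  have vS: "v \<in> S" and vQ: "v \<in> Q" and vL: "v \<in> L2_space M" and ve: "\<And>i. i < n \<Longrightarrow> ip v (e i) = 0"
    using v by (auto simp: S_def orthocomplement_def)
  have vv: "ip v v = 1"
    using L2.diag_real[OF vL] v(2) by (simp add: L2_norm_eq)
  define \<epsilon> where "\<epsilon> k = \<delta> / (real k + 1)" for k
  have \<epsilon>: "0 < \<epsilon> k" "\<epsilon> k \<le> \<delta>" for k
    using \<open>0 < \<delta>\<close> by (auto simp: \<epsilon>_def field_simps)
  have \<epsilon>_mono: "\<epsilon> k \<le> \<epsilon> j" if "j \<le> k" for j k
    using that \<open>0 < \<delta>\<close> by (auto simp: \<epsilon>_def intro!: divide_left_mono)
  have \<epsilon>_lim: "\<epsilon> \<longlonglongrightarrow> 0"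
    unfolding \<epsilon>_def using tendsto_mult[OF tendsto_const[of \<delta>] LIMSEQ_inverse_real_of_nat]
    by (simp add: divide_inverse add.commute)
  have reg_\<epsilon>: "regular (m - \<epsilon> k)" for k
    using \<epsilon>[of k] \<open>0 < \<delta>\<close> by (intro reg) auto
  have "\<exists>y. solves (m - \<epsilon> k) y v" for k
    using reg_\<epsilon>[of k] vL by (auto simp: regular_def)
  then obtain y where y: "\<And>k. solves (m - \<epsilon> k) (y k) v"
    by metis
  have yS: "y k \<in> S" for k
    unfolding S_def by (rule solves_in_orthocomplement[OF e reg_\<epsilon> y ve])
  have yQ: "y k \<in> Q" and yL: "y k \<in> L2_space M" for k
    using solvesD[OF y] by auto
  define w where "w k = (\<lambda>x. complex_of_real (\<epsilon> k) * y k x)" for k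
  have wQ: "w k \<in> Q" and wL: "w k \<in> L2_space M" for k
    using yQ by (auto simp: w_def)
  define g where "g k = (\<lambda>x. v x - w k x)" for k
  have gL: "g k \<in> L2_space M" for k
    using vL wL by (auto simp: g_def)
  have ym: "solves m (y k) (g k)" for k
    using solves_shift[OF y[of k], of "\<epsilon> k"] by (simp add: g_def w_def)
  have b_y: "b (y k) q = ip (g k) q" if "q \<in> Q" for k q
    using solvesD(4)[OF ym that] by (simp add: b_def)

  have w_lower: "1 / 2 \<le> L2_norm M (w k)" for k
  proof -
    define G where "G = (L2_norm M (g k))\<^sup>2"
    have "v = (\<lambda>x. g k x + complex_of_real (\<epsilon> k) * y k x)"
      by (auto simp: g_def w_def)
    then have "ip (g k) v = ip (g k) (\<lambda>x. g k x + complex_of_real (\<epsilon> k) * y k x)"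
      by simp
    also have "\<dots> = ip (g k) (g k) + \<epsilon> k * ip (g k) (y k)"
      using gL yL by (simp add: ip_simps)
    finally have "Re (b (y k) v) = G + \<epsilon> k * Re (b (y k) (y k))"
      using b_y vQ yQ by (simp add: G_def L2_norm_sq)
    moreover have "0 \<le> \<epsilon> k * Re (b (y k) (y k))"
      using b.nonneg[OF yS] \<epsilon> by (simp add: less_imp_le)
    ultimately have "G \<le> Re (b (y k) v)"
      by simp
    also have "\<dots> \<le> cmod (b (y k) v)"
      by (rule complex_Re_le_cmod)
    finally have "G\<^sup>2 \<le> (cmod (b (y k) v))\<^sup>2"
      by (intro power_mono) (auto simp: G_def)
    also have "\<dots> \<le> Re (b (y k) (y k)) * Re (b v v)"
      by (rule b.cauchy_schwarz[OF yS vS])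
    also have "\<dots> \<le> (G / (2 * \<delta>)) * (\<delta> / 2)"
    proof (rule mult_mono)
      have "2 * \<delta> * Re (ip (g k) (y k)) \<le> G"
        unfolding G_def using \<open>0 < \<delta>\<close> by (intro spectral_gap_estimate[OF _ _ ym] reg) auto
      then show "Re (b (y k) (y k)) \<le> G / (2 * \<delta>)"
        using b_y yQ \<open>0 < \<delta>\<close> by (simp add: field_simps)
      show "Re (b v v) \<le> \<delta> / 2"
        using v(3) vv by (simp add: b_def)
      show "0 \<le> Re (b v v)"
        using b.nonneg[OF vS] .
      show "0 \<le> G / (2 * \<delta>)"
        using \<open>0 < \<delta>\<close> by (simp add: G_def)
    qed
    also have "\<dots> = G * (1 / 4)"
      using \<open>0 < \<delta>\<close> by simp
    finally have "G * G \<le> G * (1 / 4)"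
      by (simp add: power2_eq_square)
    moreover have "0 \<le> G"
      by (simp add: G_def)
    ultimately have "G \<le> (1 / 2)\<^sup>2"
      by (cases "G = 0") (auto simp: power2_eq_square)
    then have "L2_norm M (g k) \<le> 1 / 2"
      unfolding G_def by (rule power2_le_imp_le) simp
    then show ?thesis
      using L2_norm_triangle_diff[OF vL wL, of k] v(2) by (simp add: g_def)
  qed

  have w_diff: "(L2_norm M (\<lambda>x. w k x - w j x))\<^sup>2 \<le> (L2_norm M (w j))\<^sup>2 - (L2_norm M (w k))\<^sup>2"
    if jk: "j \<le> k" for j k
  proof -
    define A C X where "A = Re (ip (y j) (y j))" and "C = Re (ip (y k) (y k))" and "X = Re (ip (y j) (y k))"
    have X': "Re (ip (y k) (y j)) = X"
      unfolding X_def using L2.Re_comm[OF yL yL] .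
    have "0 \<le> Re (b (\<lambda>x. y k x - y j x) (\<lambda>x. y k x - y j x))"
      using yS by (intro b.nonneg) auto
    also have "b (\<lambda>x. y k x - y j x) (\<lambda>x. y k x - y j x) =
        ip (g k) (\<lambda>x. y k x - y j x) - ip (g j) (\<lambda>x. y k x - y j x)"
      using yS yQ b_y by (subst b.diff_left) auto
    also have "\<dots> = ip (\<lambda>x. g k x - g j x) (\<lambda>x. y k x - y j x)"
      using gL yL by (subst L2.diff_left) auto
    also have "(\<lambda>x. g k x - g j x) = (\<lambda>x. w j x - w k x)"
      by (auto simp: g_def)
    also have "Re (ip (\<lambda>x. w j x - w k x) (\<lambda>x. y k x - y j x)) = (\<epsilon> j + \<epsilon> k) * X - \<epsilon> j * A - \<epsilon> k * C"
      unfolding w_def using yL X' by (simp add: ip_simps A_def C_def X_def algebra_simps)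
    finally have pos: "\<epsilon> j * A + \<epsilon> k * C \<le> (\<epsilon> j + \<epsilon> k) * X"
      by simp
    have "\<epsilon> k * C \<le> \<epsilon> j * X"
    proof (rule resolvent_family_monotone[OF _ _ _ _ _ pos])
      show "\<bar>X\<bar> \<le> sqrt A * sqrt C"
        unfolding A_def C_def X_def by (rule L2.cauchy_schwarz_Re[OF yL yL])
    qed (use \<epsilon> \<epsilon>_mono[OF jk] L2.nonneg[OF yL] in \<open>auto simp: A_def C_def\<close>)
    then have "\<epsilon> k * (\<epsilon> k * C) \<le> \<epsilon> k * (\<epsilon> j * X)"
      using \<epsilon>[of k] by (intro mult_left_mono) auto
    moreover have "Re (ip (w k) (w j)) = \<epsilon> k * (\<epsilon> j * X)"
      unfolding w_def using yL X' by (simp add: ip_simps)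
    moreover have "Re (ip (w k) (w k)) = \<epsilon> k * (\<epsilon> k * C)"
      unfolding w_def using yL by (simp add: ip_simps C_def)
    ultimately show ?thesis
      unfolding L2_norm_sq using L2.diag_diff[OF wL wL, of k j] by linarith
  qed

  define W where "W k = (L2_norm M (w k))\<^sup>2" for k
  have W_dec: "W k \<le> W j" if "j \<le> k" for j k
    using order_trans[OF zero_le_power2 w_diff[OF that]] by (simp add: W_def)
  have "decseq W"
    using W_dec by (simp add: decseq_def)
  then obtain L where "W \<longlonglongrightarrow> L"
    using decseq_convergent[of W 0] by (auto simp: W_def)
  then have W_cauchy: "Cauchy W"
    by (rule LIMSEQ_imp_Cauchy)
  have "\<exists>w0\<in>L2_space M. (\<lambda>k. L2_norm M (\<lambda>x. w k x - w0 x)) \<longlonglongrightarrow> 0"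
  proof (rule L2_complete[OF wL])
    fix r :: real assume "0 < r"
    then obtain N where N: "\<And>j k. j \<ge> N \<Longrightarrow> k \<ge> N \<Longrightarrow> dist (W j) (W k) < r\<^sup>2"
      using metric_CauchyD[OF W_cauchy, of "r\<^sup>2"] by auto
    show "\<exists>N. \<forall>j\<ge>N. \<forall>k\<ge>j. L2_norm M (\<lambda>x. w k x - w j x) \<le> r"
    proof (intro exI[of _ N] allI impI)
      fix j k assume "N \<le> j" "j \<le> k"
      then have "(L2_norm M (\<lambda>x. w k x - w j x))\<^sup>2 \<le> r\<^sup>2"
        using w_diff[of j k] N[of j k] by (simp add: W_def dist_real_def)
      then show "L2_norm M (\<lambda>x. w k x - w j x) \<le> r"
        by (rule power2_le_imp_le) (use \<open>0 < r\<close> in simp)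
    qed
  qed
  then obtain w0 where w0: "w0 \<in> L2_space M" and w_lim: "(\<lambda>k. L2_norm M (\<lambda>x. w k x - w0 x)) \<longlonglongrightarrow> 0"
    by blast

  \<comment> \<open>\<open>w0\<close> is an element of the Hilbert space only; the resolvent at the fixed point \<open>s\<close> yields an
    element \<open>z\<close> of the domain of \<open>T\<close> that equals \<open>w0\<close> almost everywhere\<close>
  define s where "s = m - \<epsilon> 0"
  obtain C where C: "C > 0" "\<And>u f. solves s u f \<Longrightarrow> L2_norm M u \<le> C * L2_norm M f"
    using reg_\<epsilon>[of 0] by (auto simp: regular_def s_def)
  have "(\<lambda>x. complex_of_real (\<epsilon> 0) * w0 x) \<in> L2_space M"
    using w0 by simp
  then obtain z where z: "solves s z (\<lambda>x. complex_of_real (\<epsilon> 0) * w0 x)"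
    using reg_\<epsilon>[of 0] unfolding regular_def s_def by blast
  note zD = solvesD(1,2)[OF z]
  have wz_bound: "L2_norm M (\<lambda>x. w k x - z x) \<le>
      C * (\<epsilon> k * (1 + L2_norm M (w 0)) + \<epsilon> 0 * L2_norm M (\<lambda>x. w k x - w0 x))" for k
  proof -
    have "solves (m - \<epsilon> k) (w k) (\<lambda>x. complex_of_real (\<epsilon> k) * v x)"
      unfolding w_def by (rule solves_scale[OF y])
    from solves_shift[OF this, of "\<epsilon> k - \<epsilon> 0"]
    have "solves s (w k) (\<lambda>x. complex_of_real (\<epsilon> k) * v x - complex_of_real (\<epsilon> k - \<epsilon> 0) * w k x)"
      by (simp add: s_def)
    from solves_add[OF this solves_scale[OF z, of "- 1"]]
    have "solves s (\<lambda>x. w k x - z x)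
      (\<lambda>x. complex_of_real (\<epsilon> k) * (v x - w k x) + complex_of_real (\<epsilon> 0) * (w k x - w0 x))"
      by (simp add: algebra_simps)
    from C(2)[OF this] have "L2_norm M (\<lambda>x. w k x - z x) \<le> C *
      L2_norm M (\<lambda>x. complex_of_real (\<epsilon> k) * (v x - w k x) + complex_of_real (\<epsilon> 0) * (w k x - w0 x))" .
    also have "\<dots> \<le> C * (\<epsilon> k * L2_norm M (\<lambda>x. v x - w k x) + \<epsilon> 0 * L2_norm M (\<lambda>x. w k x - w0 x))"
    proof (rule mult_left_mono)
      show "L2_norm M (\<lambda>x. complex_of_real (\<epsilon> k) * (v x - w k x) + complex_of_real (\<epsilon> 0) * (w k x - w0 x))
        \<le> \<epsilon> k * L2_norm M (\<lambda>x. v x - w k x) + \<epsilon> 0 * L2_norm M (\<lambda>x. w k x - w0 x)"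
        using L2_norm_triangle[of "\<lambda>x. complex_of_real (\<epsilon> k) * (v x - w k x)" M
            "\<lambda>x. complex_of_real (\<epsilon> 0) * (w k x - w0 x)"] vL wL w0 \<epsilon>[of k] \<epsilon>[of 0]
        by (simp add: L2_norm_scale)
    qed (use C(1) in simp)
    also have "L2_norm M (\<lambda>x. v x - w k x) \<le> 1 + L2_norm M (w 0)"
    proof -
      have "L2_norm M (w k) \<le> L2_norm M (w 0)"
        using W_dec[of 0 k] unfolding W_def by (rule power2_le_imp_le) auto
      moreover have "L2_norm M (\<lambda>x. v x - w k x) \<le> L2_norm M v + L2_norm M (w k)"
        using L2_norm_triangle[of v M "\<lambda>x. - w k x"] vL wL L2_norm_minus[of M "w k"] by simp
      ultimately show ?thesis
        using v(2) by simp
    qed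
    finally show ?thesis
      using C(1) \<epsilon>[of k] by (simp add: mult_left_mono)
  qed
  have wz_lim: "(\<lambda>k. L2_norm M (\<lambda>x. w k x - z x)) \<longlonglongrightarrow> 0"
  proof (rule tendsto_sandwich[OF _ _ tendsto_const])
    have "(\<lambda>k. C * (\<epsilon> k * (1 + L2_norm M (w 0)) + \<epsilon> 0 * L2_norm M (\<lambda>x. w k x - w0 x)))
        \<longlonglongrightarrow> C * (0 * (1 + L2_norm M (w 0)) + \<epsilon> 0 * 0)"
      by (intro tendsto_intros \<epsilon>_lim w_lim)
    then show "(\<lambda>k. C * (\<epsilon> k * (1 + L2_norm M (w 0)) + \<epsilon> 0 * L2_norm M (\<lambda>x. w k x - w0 x))) \<longlonglongrightarrow> 0"
      by simp
  qed (use wz_bound in auto)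
  have "L2_norm M (\<lambda>x. w0 x - z x) \<le> 0"
  proof (rule LIMSEQ_le_const)
    show "(\<lambda>k. L2_norm M (\<lambda>x. w k x - w0 x) + L2_norm M (\<lambda>x. w k x - z x)) \<longlonglongrightarrow> 0"
      using tendsto_add[OF w_lim wz_lim] by simp
    show "\<exists>N. \<forall>k\<ge>N. L2_norm M (\<lambda>x. w0 x - z x) \<le>
        L2_norm M (\<lambda>x. w k x - w0 x) + L2_norm M (\<lambda>x. w k x - z x)"
      using L2_norm_triangle[of "\<lambda>x. w0 x - w k x" M "\<lambda>x. w k x - z x" for k] w0 wL zD
      by (auto simp: L2_norm_minus_commute[of M w0])
  qed
  then have w0z: "L2_norm M (\<lambda>x. w0 x - z x) = 0"
    using L2_norm_nonneg[of M "\<lambda>x. w0 x - z x"] by linarith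
  have w0_z: "ip w0 q = ip z q" if "q \<in> Q" for q
    using L2_cauchy_schwarz[of "\<lambda>x. w0 x - z x" M q] w0z w0 zD that by (simp add: ip_simps)
  have "a z q = complex_of_real m * ip z q" if "q \<in> Q" for q
    using solvesD(4)[OF z that] w0_z[OF that] that w0 by (simp add: ip_simps s_def left_diff_distrib)
  then have eigen: "(z, \<lambda>x. complex_of_real m * z x) \<in> T"
    using zD by (simp add: eigen_iff)
  have "ip z (e i) = 0" if i: "i < n" for i
  proof -
    have eL: "e i \<in> L2_space M"
      using e[OF i] by (auto simp: eigen_iff)
    have "ip (w k) (e i) = 0" for k
      using yS[of k] i yL eL by (auto simp: S_def orthocomplement_def w_def ip_simps)
    then have "cmod (ip z (e i)) \<le> L2_norm M (\<lambda>x. w k x - z x) * L2_norm M (e i)" for k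
      using L2_cauchy_schwarz[of "\<lambda>x. w k x - z x" M "e i"] wL[of k] zD eL by (simp add: ip_simps)
    then have "cmod (ip z (e i)) \<le> 0"
      using tendsto_mult_right[OF wz_lim, of "L2_norm M (e i)"] by (intro LIMSEQ_le_const[where a = "cmod (ip z (e i))"]) auto
    then show ?thesis by simp
  qed
  then have "z \<in> orthocomplement n e"
    using zD by (simp add: orthocomplement_def)
  moreover have "1 / 2 \<le> L2_norm M z"
  proof (rule LIMSEQ_le_const)
    show "(\<lambda>k. L2_norm M z + L2_norm M (\<lambda>x. w k x - z x)) \<longlonglongrightarrow> L2_norm M z"
      using tendsto_add[OF tendsto_const wz_lim] by simp
    show "\<exists>N. \<forall>k\<ge>N. 1 / 2 \<le> L2_norm M z + L2_norm M (\<lambda>x. w k x - z x)"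
      using w_lower L2_norm_triangle_diff[OF wL zD(2)] order_trans by blast
  qed
  ultimately show ?thesis
    using eigen by (intro bexI[of _ z]) auto
qed

lemma resolvent_or_isolated:
  assumes "ereal s < essential_threshold M T"
  shows "complex_of_real s \<in> resolvent_set M T \<or> complex_of_real s isolated_in spectrum M T"
proof -
  have "complex_of_real s \<notin> essential_spectrum M T"
  proof
    assume "complex_of_real s \<in> essential_spectrum M T"
    then have "essential_threshold M T \<le> ereal s"
      unfolding essential_threshold_def by (intro Inf_lower) auto
    with assms show False by simp
  qed
  then show ?thesis
    by (auto simp: essential_spectrum_def spectrum_def discrete_spectrum_def)
qed

text \<open>The half of the min-max principle that bounds eigenvalues from above. If the count were smaller, the
form on the orthogonal complement of a maximal family of eigenfunctions would have a lower bound \<open>m \<le> t\<close>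
that is approached but, by maximality, is not an eigenvalue there.\<close>

theorem form_bound_imp_eigen_count:
  assumes V: "\<And>i. i < j \<Longrightarrow> \<phi> i \<in> Q" and indep: "L2_independent M j \<phi>"
    and bound: "\<And>c v. v = (\<lambda>x. \<Sum>i<j. c i * \<phi> i x) \<Longrightarrow> Re (a v v) \<le> t * Re (ip v v)"
    and thr: "ereal t < essential_threshold M T"
  shows "enat j \<le> eigen_count M T {..t}"
proof (rule ccontr)
  assume less: "\<not> ?thesis"
  define P where "P l \<longleftrightarrow> (\<exists>e ev. orthonormal_eigen {..t} l e ev)" for l
  have "P 0"
    by (auto simp: P_def orthonormal_eigen_def)
  have "\<not> P j"
    using less count_of_orthonormal_eigen by (auto simp: P_def)
  \<comment> \<open>the longest orthonormal family of eigenfunctions with eigenvalues up to \<open>t\<close>\<close>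
  have "\<exists>l<j. P l \<and> \<not> P (Suc l)"
    using \<open>P 0\<close> \<open>\<not> P j\<close> by (metis (full_types) dec_induct le0 less_Suc_eq_le not_less_eq)
  then obtain l e ev where l: "l < j" and e: "orthonormal_eigen {..t} l e ev" and max: "\<not> P (Suc l)"
    by (auto simp: P_def)
  have eT: "(e i, \<lambda>x. complex_of_real (ev i) * e i x) \<in> T" if "i < l" for i
    using e that by (auto simp: orthonormal_eigen_def)
  then have eQ: "e i \<in> Q" if "i < l" for i
    using that by (auto simp: eigen_iff)
  have no_eigen: False
    if "w \<in> orthocomplement l e" "(w, \<lambda>x. complex_of_real s * w x) \<in> T" "0 < L2_norm M w" "s \<le> t" for w s
    using orthonormal_eigen_extend[OF e that(2)] that max
    by (auto simp: P_def orthocomplement_def L2_norm_eq)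
  define S where "S = orthocomplement l e"
  have S_Q: "v \<in> Q" if "v \<in> S" for v
    using that by (simp add: S_def orthocomplement_def)
  have S_scale: "(\<lambda>x. c * v x) \<in> S" if "v \<in> S" for c v
    using that eQ by (auto simp: S_def orthocomplement_def ip_simps)
  define R where "R = {Re (a v v) | v. v \<in> S \<and> L2_norm M v = 1}"
  have normalize: "Re (a v v) / Re (ip v v) \<in> R" if "v \<in> S" "Re (ip v v) > 0" for v
  proof -
    define c where "c = complex_of_real (1 / L2_norm M v)"
    have vQ: "v \<in> Q" using S_Q that by simp
    have N: "L2_norm M v > 0" "(L2_norm M v)\<^sup>2 = Re (ip v v)"
      using that by (auto simp: L2_norm_eq)
    have "L2_norm M (\<lambda>x. c * v x) = 1"
      using N vQ by (subst L2_norm_scale) (auto simp: c_def norm_divide)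
    moreover have "Re (a (\<lambda>x. c * v x) (\<lambda>x. c * v x)) = Re (a v v) / Re (ip v v)"
      unfolding N(2)[symmetric] using vQ by (subst diag_scale) (auto simp: c_def norm_divide power_divide)
    ultimately show ?thesis
      unfolding R_def using S_scale[OF that(1), of c] by (intro CollectI exI[of _ "\<lambda>x. c * v x"]) simp
  qed
  have bdd: "bdd_below R"
    by (rule bdd_belowI[of _ 0]) (use nonneg S_Q in \<open>auto simp: R_def\<close>)
  define m where "m = Inf R"
  have m_le: "m * Re (ip v v) \<le> Re (a v v)" if "v \<in> S" for v
  proof (cases "Re (ip v v) = 0")
    case True
    then show ?thesis using nonneg S_Q[OF that] by simp
  next
    case False
    then have "Re (ip v v) > 0"
      using L2.nonneg[of v M] S_Q[OF that] by simp
    moreover from normalize[OF that this] have "m \<le> Re (a v v) / Re (ip v v)"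
      unfolding m_def using bdd by (rule cInf_lower)
    ultimately show ?thesis
      by (simp add: field_simps)
  qed
  \<comment> \<open>fewer orthogonality conditions than dimensions\<close>
  have "card {..<l} < card {..<j}"
    using l by simp
  from homogeneous_system_nontrivial[OF _ _ this, of "\<lambda>k i. ip (\<phi> i) (e k)"]
  obtain c where c: "\<exists>i<j. c i \<noteq> 0" and c0: "\<And>k. k < l \<Longrightarrow> (\<Sum>i<j. c i * ip (\<phi> i) (e k)) = 0"
    by auto
  define v where "v = (\<lambda>x. \<Sum>i<j. c i * \<phi> i x)"
  have vQ: "v \<in> Q"
    unfolding v_def using V by (intro sum_in) auto
  have "ip v (e k) = 0" if "k < l" for k
    unfolding v_def using c0[OF that] eQ[OF that] V by (subst L2.sum_left) auto
  then have vS: "v \<in> S"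
    using vQ by (simp add: S_def orthocomplement_def)
  have "Re (ip v v) \<noteq> 0"
  proof
    assume "Re (ip v v) = 0"
    then have "AE x in M. v x = 0"
      using L2_norm_eq_0_iff[OF Q_L2[OF vQ]] by (simp add: L2_norm_eq)
    then show False
      using indep c unfolding L2_independent_def v_def by blast
  qed
  then have v_pos: "Re (ip v v) > 0"
    using L2.nonneg[of v M] vQ by simp
  have "m \<le> Re (a v v) / Re (ip v v)"
    unfolding m_def using normalize[OF vS v_pos] bdd by (rule cInf_lower)
  also have "\<dots> \<le> t"
    using bound[OF v_def] v_pos by (simp add: field_simps)
  finally have "m \<le> t" .
  have approx: "\<exists>v\<in>S. L2_norm M v = 1 \<and> Re (a v v) < m + \<eta>" if "\<eta> > 0" for \<eta>
  proof -
    have "\<exists>r\<in>R. r < m + \<eta>"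
      using that normalize[OF vS v_pos] by (intro cInf_lessD) (auto simp: m_def)
    then show ?thesis by (auto simp: R_def)
  qed
  have "ereal m < essential_threshold M T"
    using \<open>m \<le> t\<close> thr by (meson ereal_less_eq(3) order_le_less_trans)
  then consider "complex_of_real m \<in> resolvent_set M T" | "complex_of_real m isolated_in spectrum M T"
    using resolvent_or_isolated by blast
  then show False
  proof cases
    case 1
    show False
      by (rule regular_not_bottom[OF eT regular_of_resolvent[OF 1] m_le[unfolded S_def] approx[unfolded S_def]])
  next
    case 2
    then obtain U where U: "open U" "U \<inter> spectrum M T = {complex_of_real m}"
      by (auto simp: isolated_in_def)
    then obtain r where r: "r > 0" "ball (complex_of_real m) r \<subseteq> U"
      using openE by blast
    have reg: "regular s" if "s \<noteq> m" "m - 2 * (r / 2) < s" "s < m + 2 * (r / 2)" for s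
    proof (rule regular_of_resolvent)
      have "dist (complex_of_real m) (complex_of_real s) < r"
        using that by (simp add: dist_norm flip: of_real_diff)
      then have "complex_of_real s \<in> U"
        using r by auto
      then have "complex_of_real s \<notin> spectrum M T"
        using U(2) that(1) by (metis IntI of_real_eq_iff singletonD)
      then show "complex_of_real s \<in> resolvent_set M T"
        by (simp add: spectrum_def)
    qed
    obtain u where u: "u \<in> S" "L2_norm M u = 1" "Re (a u u) < m + (r / 2) / 2"
      using approx[of "(r / 2) / 2"] r(1) by auto
    have "\<exists>w\<in>orthocomplement l e. (w, \<lambda>x. complex_of_real m * w x) \<in> T \<and> 0 < L2_norm M w"
      by (rule isolated_bottom_eigenvector[where \<delta> = "r / 2", OF eT m_le[unfolded S_def] _ reg])
        (use u r in \<open>auto simp: S_def\<close>)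
    then show False
      using no_eigen \<open>m \<le> t\<close> by blast
  qed
qed

end


section \<open>Smooth functions\<close>

lemma has_derivative_partial_deriv:
  "(f has_derivative D) (at x) \<Longrightarrow> partial_deriv b f x = D b"
  unfolding partial_deriv_def by (simp add: frechet_derivative_at[symmetric])

lemma differentiable_partial_deriv:
  "f differentiable (at x) \<Longrightarrow> (f has_derivative frechet_derivative f (at x)) (at x)"
  by (simp add: frechet_derivative_works)

lemma k_times_cont_diff_SucD: "k_times_cont_diff (Suc k) f \<Longrightarrow> k_times_cont_diff k f"
proof (induction k arbitrary: f)
  case 0
  then show ?case
    by (simp add: continuous_on_eq_continuous_at differentiable_imp_continuous_within)
next
  case (Suc k)
  show ?case
    using Suc.prems Suc.IH by auto
qed

lemma k_times_cont_diff_continuous: "k_times_cont_diff k f \<Longrightarrow> continuous_on UNIV f"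
proof (induction k)
  case (Suc k)
  then show ?case
    using k_times_cont_diff_SucD by blast
qed simp

lemma partial_deriv_add:
  assumes "f differentiable (at x)" and "g differentiable (at x)"
  shows "partial_deriv b (\<lambda>x. f x + g x) x = partial_deriv b f x + partial_deriv b g x"
proof -
  have "((\<lambda>x. f x + g x) has_derivative (\<lambda>h. frechet_derivative f (at x) h + frechet_derivative g (at x) h)) (at x)"
    using assms by (intro has_derivative_add differentiable_partial_deriv)
  from has_derivative_partial_deriv[OF this] show ?thesis
    by (simp add: partial_deriv_def)
qed

lemma partial_deriv_mult:
  assumes "f differentiable (at x)" and "g differentiable (at x)"
  shows "partial_deriv b (\<lambda>x. f x * g x) x = f x * partial_deriv b g x + partial_deriv b f x * g x"
proof -
  have "((\<lambda>x. f x * g x) has_derivative (\<lambda>h. f x * frechet_derivative g (at x) h + frechet_derivative f (at x) h * g x)) (at x)"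
    using assms by (intro has_derivative_mult differentiable_partial_deriv)
  from has_derivative_partial_deriv[OF this] show ?thesis
    by (simp add: partial_deriv_def)
qed

lemma partial_deriv_const: "partial_deriv b (\<lambda>x. c) x = 0"
  by (rule has_derivative_partial_deriv) (rule has_derivative_const)

lemma k_times_cont_diff_const: "k_times_cont_diff k (\<lambda>x. c)"
proof (induction k arbitrary: c)
  case (Suc k)
  have "partial_deriv b (\<lambda>x. c) = (\<lambda>x. 0)" for b :: 'a
    by (rule ext) (rule partial_deriv_const)
  with Suc show ?case by simp
qed simp

lemma k_times_cont_diff_add:
  "k_times_cont_diff k f \<Longrightarrow> k_times_cont_diff k g \<Longrightarrow> k_times_cont_diff k (\<lambda>x. f x + g x)"
proof (induction k arbitrary: f g)
  case (Suc k)
  have "partial_deriv b (\<lambda>x. f x + g x) = (\<lambda>x. partial_deriv b f x + partial_deriv b g x)" for b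
    using Suc.prems by (auto intro!: ext partial_deriv_add)
  with Suc show ?case by (auto intro!: differentiable_add)
qed (auto intro: continuous_intros)

lemma k_times_cont_diff_mult:
  "k_times_cont_diff k f \<Longrightarrow> k_times_cont_diff k g \<Longrightarrow> k_times_cont_diff k (\<lambda>x. f x * g x)"
proof (induction k arbitrary: f g)
  case (Suc k)
  have "partial_deriv b (\<lambda>x. f x * g x) = (\<lambda>x. f x * partial_deriv b g x + partial_deriv b f x * g x)" for b
    using Suc.prems by (auto intro!: ext partial_deriv_mult)
  moreover have "k_times_cont_diff k f" "k_times_cont_diff k g"
    using Suc.prems k_times_cont_diff_SucD by blast+
  ultimately show ?case
    using Suc.prems by (auto intro!: differentiable_mult Suc.IH k_times_cont_diff_add)
qed (auto intro: continuous_intros)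

lemma k_times_cont_diff_sum:
  "(\<And>i. i \<in> I \<Longrightarrow> k_times_cont_diff k (f i)) \<Longrightarrow> k_times_cont_diff k (\<lambda>x. \<Sum>i\<in>I. f i x)"
  by (induction I rule: infinite_finite_induct)
    (auto intro: k_times_cont_diff_const k_times_cont_diff_add)

lemma k_times_cont_diff_prod:
  "(\<And>i. i \<in> I \<Longrightarrow> k_times_cont_diff k (f i)) \<Longrightarrow> k_times_cont_diff k (\<lambda>x. \<Prod>i\<in>I. f i x)"
  by (induction I rule: infinite_finite_induct)
    (auto intro: k_times_cont_diff_const k_times_cont_diff_mult)

definition smooth :: "('a::euclidean_space \<Rightarrow> complex) \<Rightarrow> bool" where
  "smooth f \<longleftrightarrow> (\<forall>k. k_times_cont_diff k f)"

lemma smoothI: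
  assumes "\<And>x. f differentiable (at x)" and "\<And>b. b \<in> Basis \<Longrightarrow> smooth (partial_deriv b f)"
  shows "smooth f"
  unfolding smooth_def
proof
  show "k_times_cont_diff k f" for k
  proof (cases k)
    case 0
    then show ?thesis
      using assms(1) by (simp add: continuous_on_eq_continuous_at differentiable_imp_continuous_within)
  next
    case (Suc k)
    then show ?thesis using assms by (auto simp: smooth_def)
  qed
qed

lemma smoothD: "smooth f \<Longrightarrow> k_times_cont_diff k f"
  by (simp add: smooth_def)

lemma smooth_differentiable: "smooth f \<Longrightarrow> f differentiable (at x)"
  unfolding smooth_def by (metis k_times_cont_diff.simps(2))

lemma smooth_partial_deriv: "smooth f \<Longrightarrow> b \<in> Basis \<Longrightarrow> smooth (partial_deriv b f)"
  unfolding smooth_def by (metis k_times_cont_diff.simps(2))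

lemma smooth_continuous: "smooth f \<Longrightarrow> continuous_on UNIV f"
  unfolding smooth_def using k_times_cont_diff_continuous by blast

lemma smooth_const: "smooth (\<lambda>x. c)"
  by (simp add: smooth_def k_times_cont_diff_const)

lemma smooth_add: "smooth f \<Longrightarrow> smooth g \<Longrightarrow> smooth (\<lambda>x. f x + g x)"
  by (simp add: smooth_def k_times_cont_diff_add)

lemma smooth_mult: "smooth f \<Longrightarrow> smooth g \<Longrightarrow> smooth (\<lambda>x. f x * g x)"
  by (simp add: smooth_def k_times_cont_diff_mult)

lemma smooth_sum: "(\<And>i. i \<in> I \<Longrightarrow> smooth (f i)) \<Longrightarrow> smooth (\<lambda>x. \<Sum>i\<in>I. f i x)"
  by (simp add: smooth_def k_times_cont_diff_sum)

lemma smooth_prod: "(\<And>i. i \<in> I \<Longrightarrow> smooth (f i)) \<Longrightarrow> smooth (\<lambda>x. \<Prod>i\<in>I. f i x)"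
  by (simp add: smooth_def k_times_cont_diff_prod)

lemma smooth_inner: "smooth (\<lambda>x. complex_of_real (v \<bullet> x))"
proof (rule smoothI)
  have d: "((\<lambda>x. complex_of_real (v \<bullet> x)) has_derivative (\<lambda>h. complex_of_real (v \<bullet> h))) (at x)" for x
    by (auto intro!: derivative_eq_intros)
  show "(\<lambda>x. complex_of_real (v \<bullet> x)) differentiable at x" for x
    using d by (auto simp: differentiable_def)
  have "partial_deriv b (\<lambda>x. complex_of_real (v \<bullet> x)) = (\<lambda>x. complex_of_real (v \<bullet> b))" for b
    using has_derivative_partial_deriv[OF d] by auto
  then show "smooth (partial_deriv b (\<lambda>x. complex_of_real (v \<bullet> x)))" for b
    by (simp add: smooth_const)
qed

lemma differentiable_of_real_components:
  fixes \<Phi> :: "'a::euclidean_space \<Rightarrow> 'b::euclidean_space"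
  assumes "\<And>i. i \<in> Basis \<Longrightarrow> (\<lambda>x. complex_of_real (\<Phi> x \<bullet> i)) differentiable (at x)"
  shows "\<Phi> differentiable (at x)"
    and "i \<in> Basis \<Longrightarrow> complex_of_real (frechet_derivative \<Phi> (at x) h \<bullet> i) = frechet_derivative (\<lambda>x. complex_of_real (\<Phi> x \<bullet> i)) (at x) h"
proof -
  have "(\<lambda>x. \<Phi> x \<bullet> i) differentiable (at x)" if "i \<in> Basis" for i
  proof -
    have "((\<lambda>x. Re (complex_of_real (\<Phi> x \<bullet> i))) has_derivative
        (\<lambda>h. Re (frechet_derivative (\<lambda>x. complex_of_real (\<Phi> x \<bullet> i)) (at x) h))) (at x)"
      by (intro has_derivative_Re differentiable_partial_deriv assms that)
    then show ?thesis
      by (auto simp: differentiable_def)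
  qed
  then show D: "\<Phi> differentiable (at x)"
    by (subst differentiable_componentwise_within) auto
  show "complex_of_real (frechet_derivative \<Phi> (at x) h \<bullet> i) = frechet_derivative (\<lambda>x. complex_of_real (\<Phi> x \<bullet> i)) (at x) h"
    if "i \<in> Basis"
  proof -
    have "((\<lambda>x. complex_of_real (\<Phi> x \<bullet> i)) has_derivative (\<lambda>h. complex_of_real (frechet_derivative \<Phi> (at x) h \<bullet> i))) (at x)"
      using differentiable_partial_deriv[OF D]
      by (intro has_derivative_of_real has_derivative_inner_left)
    then show ?thesis
      by (metis frechet_derivative_at)
  qed
qed

lemma partial_deriv_compose:
  fixes \<Phi> :: "'a::euclidean_space \<Rightarrow> 'b::euclidean_space"
  assumes "f differentiable (at (\<Phi> x))"
    and "\<And>i. i \<in> Basis \<Longrightarrow> (\<lambda>x. complex_of_real (\<Phi> x \<bullet> i)) differentiable (at x)"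
  shows "(\<lambda>x. f (\<Phi> x)) differentiable (at x)"
    and "partial_deriv b (\<lambda>x. f (\<Phi> x)) x =
      (\<Sum>i\<in>Basis. partial_deriv b (\<lambda>x. complex_of_real (\<Phi> x \<bullet> i)) x * partial_deriv i f (\<Phi> x))"
proof -
  have \<Phi>: "\<Phi> differentiable (at x)"
    using assms(2) by (rule differentiable_of_real_components)
  have d: "((\<lambda>x. f (\<Phi> x)) has_derivative (\<lambda>h. frechet_derivative f (at (\<Phi> x)) (frechet_derivative \<Phi> (at x) h))) (at x)"
    using has_derivative_compose[OF differentiable_partial_deriv[OF \<Phi>] differentiable_partial_deriv[OF assms(1)]] .
  then show "(\<lambda>x. f (\<Phi> x)) differentiable (at x)"
    by (auto simp: differentiable_def)
  interpret lin: linear "frechet_derivative f (at (\<Phi> x))"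
    using linear_frechet_derivative[OF assms(1)] .
  let ?h = "frechet_derivative \<Phi> (at x) b"
  have "partial_deriv b (\<lambda>x. f (\<Phi> x)) x = frechet_derivative f (at (\<Phi> x)) ?h"
    by (rule has_derivative_partial_deriv[OF d])
  also have "?h = (\<Sum>i\<in>Basis. (?h \<bullet> i) *\<^sub>R i)"
    by (simp add: euclidean_representation)
  also have "frechet_derivative f (at (\<Phi> x)) \<dots> = (\<Sum>i\<in>Basis. (?h \<bullet> i) *\<^sub>R frechet_derivative f (at (\<Phi> x)) i)"
    by (simp add: lin.sum lin.scale)
  also have "\<dots> = (\<Sum>i\<in>Basis. partial_deriv b (\<lambda>x. complex_of_real (\<Phi> x \<bullet> i)) x * partial_deriv i f (\<Phi> x))"
    using differentiable_of_real_components(2)[OF assms(2)]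
    by (intro sum.cong refl) (simp add: partial_deriv_def scaleR_conv_of_real)
  finally show "partial_deriv b (\<lambda>x. f (\<Phi> x)) x = \<dots>" .
qed

text \<open>Induction on the order of differentiability: the partial derivatives of \<open>f \<circ> \<Phi>\<close> are sums of products
of partial derivatives of components of \<open>\<Phi>\<close> with functions \<open>f' \<circ> \<Phi>\<close>, where \<open>f'\<close> is again smooth.\<close>

lemma smooth_compose:
  fixes \<Phi> :: "'a::euclidean_space \<Rightarrow> 'b::euclidean_space"
  assumes f: "smooth f" and \<Phi>: "\<And>i. i \<in> Basis \<Longrightarrow> smooth (\<lambda>x. complex_of_real (\<Phi> x \<bullet> i))"
  shows "smooth (\<lambda>x. f (\<Phi> x))"
proof -
  have "k_times_cont_diff k (\<lambda>x. f (\<Phi> x))" for k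
    using f
  proof (induction k arbitrary: f)
    case 0
    have "continuous (at x) (\<lambda>x. f (\<Phi> x))" for x
      by (rule differentiable_imp_continuous_within[OF partial_deriv_compose(1)])
        (use 0 \<Phi> in \<open>auto intro: smooth_differentiable\<close>)
    then show ?case
      by (simp add: continuous_on_eq_continuous_at)
  next
    case (Suc k)
    have diff: "f differentiable (at (\<Phi> x))" "\<And>i. i \<in> Basis \<Longrightarrow> (\<lambda>x. complex_of_real (\<Phi> x \<bullet> i)) differentiable (at x)" for x
      using Suc.prems \<Phi> by (auto intro: smooth_differentiable)
    have "partial_deriv b (\<lambda>x. f (\<Phi> x)) =
      (\<lambda>x. \<Sum>i\<in>Basis. partial_deriv b (\<lambda>x. complex_of_real (\<Phi> x \<bullet> i)) x * partial_deriv i f (\<Phi> x))" for b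
      by (rule ext) (rule partial_deriv_compose[OF diff])
    moreover have "k_times_cont_diff k
        (\<lambda>x. \<Sum>i\<in>Basis. partial_deriv b (\<lambda>x. complex_of_real (\<Phi> x \<bullet> i)) x * partial_deriv i f (\<Phi> x))"
      if "b \<in> Basis" for b
      using Suc.prems \<Phi> that
      by (intro k_times_cont_diff_sum k_times_cont_diff_mult Suc.IH smoothD[OF smooth_partial_deriv] smooth_partial_deriv)
    ultimately show ?case
      using partial_deriv_compose(1)[OF diff] by auto
  qed
  then show ?thesis by (simp add: smooth_def)
qed

text \<open>For \<open>k = 0\<close> this is the standard smooth function that vanishes exactly for \<open>t \<le> 0\<close>. The
powers of \<open>t\<close> in the denominator make the family closed under differentiation.\<close>

definition flat :: "nat \<Rightarrow> real \<Rightarrow> real" where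
  "flat k t = (if t > 0 then exp (- (1 / t)) / t ^ k else 0)"

lemma flat_tendsto_0: "(flat k \<longlongrightarrow> 0) (at 0)"
proof (rule filterlim_split_at_real)
  have "((\<lambda>t. 0) \<longlongrightarrow> (0::real)) (at_left 0)"
    by simp
  then show "(flat k \<longlongrightarrow> 0) (at_left 0)"
    by (rule Lim_transform_eventually)
      (auto simp: flat_def eventually_at_filter intro!: eventuallyI)
  have "((\<lambda>x. x ^ k / exp x) \<longlongrightarrow> (0::real)) at_top"
    by (rule tendsto_power_div_exp_0)
  then have "((\<lambda>t. inverse t ^ k / exp (inverse t)) \<longlongrightarrow> (0::real)) (at_right 0)"
    by (rule filterlim_compose) (rule filterlim_inverse_at_top_right)
  then show "(flat k \<longlongrightarrow> 0) (at_right 0)"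
    by (rule Lim_transform_eventually)
      (auto simp: flat_def eventually_at_filter exp_minus field_simps intro!: eventuallyI)
qed

lemma flat_has_derivative:
  "(flat k has_real_derivative (flat (k + 2) t - real k * flat (k + 1) t)) (at t)"
proof -
  consider "t > 0" | "t < 0" | "t = 0" by linarith
  then show ?thesis
  proof cases
    case 1
    have "((\<lambda>t. exp (- (1 / t)) / t ^ k) has_real_derivative (flat (k + 2) t - real k * flat (k + 1) t)) (at t)"
    proof (cases k)
      case 0
      then show ?thesis
        using 1 by (auto intro!: derivative_eq_intros simp: flat_def field_simps power2_eq_square)
    next
      case (Suc n)
      have "((\<lambda>t. exp (- (1 / t)) / t ^ Suc n) has_real_derivative
          (exp (- (1 / t)) * (1 / t\<^sup>2) * t ^ Suc n - exp (- (1 / t)) * ((1 + real n) * (1 * t ^ n))) / (t ^ Suc n * t ^ Suc n)) (at t)"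
        using 1 by (intro DERIV_divide DERIV_power_Suc) (auto intro!: derivative_eq_intros simp: power2_eq_square)
      moreover have "(exp (- (1 / t)) * (1 / t\<^sup>2) * t ^ Suc n - exp (- (1 / t)) * ((1 + real n) * (1 * t ^ n))) / (t ^ Suc n * t ^ Suc n)
          = flat (k + 2) t - real k * flat (k + 1) t"
        using 1 by (simp add: Suc flat_def field_simps power2_eq_square)
      ultimately show ?thesis
        by (simp add: Suc)
    qed
    then show ?thesis
      by (rule has_field_derivative_transform_within_open[of _ _ _ "{0<..}"])
        (use 1 in \<open>auto simp: flat_def\<close>)
  next
    case 2
    have "((\<lambda>t. 0) has_real_derivative (flat (k + 2) t - real k * flat (k + 1) t)) (at t)"
      using 2 by (simp add: flat_def)
    then show ?thesis
      by (rule has_field_derivative_transform_within_open[of _ _ _ "{..<0}"])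
        (use 2 in \<open>auto simp: flat_def\<close>)
  next
    case 3
    have "((\<lambda>h. (flat k (0 + h) - flat k 0) / h) \<longlongrightarrow> 0) (at 0)"
      using flat_tendsto_0[of "k + 1"]
      by (rule Lim_transform_eventually) (auto simp: flat_def eventually_at_filter intro!: eventuallyI)
    then show ?thesis
      unfolding 3 by (simp add: DERIV_def flat_def)
  qed
qed

lemma smooth_flat: "smooth (\<lambda>x. complex_of_real (flat k (v \<bullet> x + c)))"
proof -
  have d: "((\<lambda>x. complex_of_real (flat k (v \<bullet> x + c))) has_derivative
      (\<lambda>h. complex_of_real ((v \<bullet> h) * (flat (k + 2) (v \<bullet> x + c) - real k * flat (k + 1) (v \<bullet> x + c))))) (at x)" for x k
  proof -
    have "(flat k has_derivative (\<lambda>h. h * (flat (k + 2) (v \<bullet> x + c) - real k * flat (k + 1) (v \<bullet> x + c)))) (at (v \<bullet> x + c))"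
      using flat_has_derivative[of k "v \<bullet> x + c"] unfolding has_field_derivative_def
      by (rule has_derivative_eq_rhs) (simp add: mult.commute fun_eq_iff)
    moreover have "((\<lambda>x. v \<bullet> x + c) has_derivative (\<lambda>h. v \<bullet> h)) (at x)"
      by (auto intro!: derivative_eq_intros)
    ultimately show ?thesis
      by (intro has_derivative_of_real) (rule has_derivative_compose)
  qed
  have "k_times_cont_diff n (\<lambda>x. complex_of_real (flat k (v \<bullet> x + c)))" for n
  proof (induction n arbitrary: k)
    case 0
    have "continuous (at x) (\<lambda>x. complex_of_real (flat k (v \<bullet> x + c)))" for x
      using d has_derivative_continuous by blast
    then show ?case
      unfolding k_times_cont_diff.simps by (intro continuous_at_imp_continuous_on ballI)
  next
    case (Suc n)
    have "partial_deriv b (\<lambda>x. complex_of_real (flat k (v \<bullet> x + c))) =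
        (\<lambda>x. complex_of_real (v \<bullet> b) * (complex_of_real (flat (k + 2) (v \<bullet> x + c))
          + complex_of_real (- real k) * complex_of_real (flat (k + 1) (v \<bullet> x + c))))" for b
      using has_derivative_partial_deriv[OF d] by auto
    moreover have "k_times_cont_diff n (\<lambda>x. complex_of_real (v \<bullet> b) * (complex_of_real (flat (k + 2) (v \<bullet> x + c))
          + complex_of_real (- real k) * complex_of_real (flat (k + 1) (v \<bullet> x + c))))" for b
      by (intro k_times_cont_diff_mult k_times_cont_diff_add k_times_cont_diff_const Suc.IH)
    moreover have "(\<lambda>x. complex_of_real (flat k (v \<bullet> x + c))) differentiable at x" for x
      using d by (auto simp: differentiable_def)
    ultimately show ?case by auto
  qed
  then show ?thesis by (simp add: smooth_def)
qed

text \<open>Positive exactly on the open box, and increasing to its indicator function as \<open>n\<close> tends to infinity.\<close>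

definition box_bump :: "nat \<Rightarrow> 'a::euclidean_space \<Rightarrow> 'a \<Rightarrow> 'a \<Rightarrow> real" where
  "box_bump n a b x = (\<Prod>i\<in>Basis. flat 0 (real (Suc n) * (x \<bullet> i - a \<bullet> i)) * flat 0 (real (Suc n) * (b \<bullet> i - x \<bullet> i)))"

lemma flat_bounds: "0 \<le> flat 0 t" "flat 0 t \<le> 1"
  by (auto simp: flat_def)

lemma box_bump_bounds: "0 \<le> box_bump n a b x" "box_bump n a b x \<le> 1"
  unfolding box_bump_def using flat_bounds by (auto intro!: prod_nonneg prod_le_1 mult_le_one)

lemma box_bump_eq_0: "x \<notin> box a b \<Longrightarrow> box_bump n a b x = 0"
  by (auto simp: box_bump_def mem_box flat_def zero_less_mult_iff)

lemma box_bump_tendsto: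
  fixes x :: "'a::euclidean_space"
  assumes "x \<in> box a b"
  shows "(\<lambda>n. box_bump n a b x) \<longlonglongrightarrow> 1"
proof -
  have flat: "(\<lambda>n. flat 0 (real (Suc n) * t)) \<longlonglongrightarrow> 1" if "t > 0" for t
  proof -
    have "(\<lambda>n. exp (- ((1 / t) * inverse (real (Suc n))))) \<longlonglongrightarrow> exp (- ((1 / t) * 0))"
      by (intro tendsto_intros LIMSEQ_inverse_real_of_nat)
    moreover have "flat 0 (real (Suc n) * t) = exp (- ((1 / t) * inverse (real (Suc n))))" for n
      using that by (simp add: flat_def divide_inverse mult.commute)
    ultimately show ?thesis
      by simp
  qed
  have "(\<lambda>n. \<Prod>i\<in>(Basis :: 'a set). flat 0 (real (Suc n) * (x \<bullet> i - a \<bullet> i)) * flat 0 (real (Suc n) * (b \<bullet> i - x \<bullet> i)))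
      \<longlonglongrightarrow> (\<Prod>i\<in>(Basis :: 'a set). (1::real) * 1)"
    by (rule tendsto_prod, rule tendsto_mult; rule flat) (use assms in \<open>auto simp: mem_box\<close>)
  then show ?thesis by (simp add: box_bump_def)
qed

lemma smooth_box_bump: "smooth (\<lambda>x. complex_of_real (box_bump n a b x))"
proof -
  have "smooth (\<lambda>x. complex_of_real (flat 0 (real (Suc n) * (x \<bullet> i - a \<bullet> i))) *
      complex_of_real (flat 0 (real (Suc n) * (b \<bullet> i - x \<bullet> i))))" for i
    using smooth_mult[OF smooth_flat[of 0 "real (Suc n) *\<^sub>R i" "- real (Suc n) * (a \<bullet> i)"]
        smooth_flat[of 0 "- real (Suc n) *\<^sub>R i" "real (Suc n) * (b \<bullet> i)"]]
    by (simp add: algebra_simps inner_commute)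
  then show ?thesis
    unfolding box_bump_def of_real_prod of_real_mult by (intro smooth_prod)
qed


section \<open>Test functions and the fundamental lemma\<close>

lemma test_functions_iff:
  "\<phi> \<in> test_functions \<Omega> \<longleftrightarrow> smooth \<phi> \<and> (\<exists>K. compact K \<and> K \<subseteq> \<Omega> \<and> (\<forall>x. x \<notin> K \<longrightarrow> \<phi> x = 0))"
proof
  assume "\<phi> \<in> test_functions \<Omega>"
  then show "smooth \<phi> \<and> (\<exists>K. compact K \<and> K \<subseteq> \<Omega> \<and> (\<forall>x. x \<notin> K \<longrightarrow> \<phi> x = 0))"
    using closure_subset[of "{x. \<phi> x \<noteq> 0}"]
    by (auto simp: test_functions_def smooth_def intro!: exI[of _ "closure {x. \<phi> x \<noteq> 0}"])
next
  assume "smooth \<phi> \<and> (\<exists>K. compact K \<and> K \<subseteq> \<Omega> \<and> (\<forall>x. x \<notin> K \<longrightarrow> \<phi> x = 0))"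
  then obtain K where K: "smooth \<phi>" "compact K" "K \<subseteq> \<Omega>" "\<And>x. x \<notin> K \<Longrightarrow> \<phi> x = 0"
    by blast
  have sub: "closure {x. \<phi> x \<noteq> 0} \<subseteq> K"
    using K by (intro closure_minimal) (auto intro: compact_imp_closed)
  then have "compact (closure {x. \<phi> x \<noteq> 0})"
    using K(2) by (metis closed_closure compact_Int_closed inf.absorb_iff2)
  then show "\<phi> \<in> test_functions \<Omega>"
    using sub K by (auto simp: test_functions_def smooth_def)
qed

lemma partial_deriv_eq_0:
  assumes "closed K" and "\<And>x. x \<notin> K \<Longrightarrow> f x = 0" and "x \<notin> K"
  shows "partial_deriv b f x = 0"
proof (rule has_derivative_partial_deriv[where D = "\<lambda>h. 0"])
  show "(f has_derivative (\<lambda>h. 0)) (at x)"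
  proof (rule has_derivative_transform_within_open[where s = "- K" and f = "\<lambda>x. 0"])
    show "((\<lambda>x. 0) has_derivative (\<lambda>h. 0)) (at x)"
      by (rule has_derivative_const)
  qed (use assms in \<open>auto simp: open_Compl\<close>)
qed

lemma test_partial_deriv: "\<phi> \<in> test_functions \<Omega> \<Longrightarrow> b \<in> Basis \<Longrightarrow> partial_deriv b \<phi> \<in> test_functions \<Omega>"
  unfolding test_functions_iff
  using partial_deriv_eq_0[OF compact_imp_closed] by (metis smooth_partial_deriv)

lemma test_mult_smooth: "\<phi> \<in> test_functions \<Omega> \<Longrightarrow> smooth f \<Longrightarrow> (\<lambda>x. f x * \<phi> x) \<in> test_functions \<Omega>"
  unfolding test_functions_iff by (auto intro: smooth_mult)

lemma test_zero: "(\<lambda>x. 0) \<in> test_functions \<Omega>"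
  unfolding test_functions_iff by (auto intro: smooth_const exI[of _ "{}"])

lemma test_add: "\<phi> \<in> test_functions \<Omega> \<Longrightarrow> \<psi> \<in> test_functions \<Omega> \<Longrightarrow> (\<lambda>x. \<phi> x + \<psi> x) \<in> test_functions \<Omega>"
  unfolding test_functions_iff
proof (elim conjE exE, intro conjI)
  fix K L
  assume "compact K" "K \<subseteq> \<Omega>" "\<forall>x. x \<notin> K \<longrightarrow> \<phi> x = 0" "compact L" "L \<subseteq> \<Omega>" "\<forall>x. x \<notin> L \<longrightarrow> \<psi> x = 0"
  then show "\<exists>K. compact K \<and> K \<subseteq> \<Omega> \<and> (\<forall>x. x \<notin> K \<longrightarrow> \<phi> x + \<psi> x = 0)"
    by (intro exI[of _ "K \<union> L"]) auto
qed (auto intro: smooth_add)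

lemma test_scale: "\<phi> \<in> test_functions \<Omega> \<Longrightarrow> (\<lambda>x. c * \<phi> x) \<in> test_functions \<Omega>"
  by (rule test_mult_smooth[OF _ smooth_const])

lemma borel_measurable_lebesgue_on:
  "f \<in> borel_measurable borel \<Longrightarrow> f \<in> borel_measurable (lebesgue_on \<Omega>)"
  by (intro measurable_restrict_space1 measurable_completion) simp

lemma integrable_lebesgue_on_iff:
  fixes f :: "'a::euclidean_space \<Rightarrow> 'b::{banach, second_countable_topology}"
  assumes "open \<Omega>" and "f \<in> borel_measurable borel" and "\<And>x. x \<notin> \<Omega> \<Longrightarrow> f x = 0"
  shows "integrable (lebesgue_on \<Omega>) f \<longleftrightarrow> integrable lborel f"
    and "(\<integral>x. f x \<partial>lebesgue_on \<Omega>) = (\<integral>x. f x \<partial>lborel)"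
proof -
  have eq: "(\<lambda>x. indicator \<Omega> x *\<^sub>R f x) = f"
    using assms(3) by (auto simp: indicator_def)
  have \<Omega>: "\<Omega> \<inter> space lebesgue \<in> sets lebesgue"
    using assms(1) by auto
  show "integrable (lebesgue_on \<Omega>) f \<longleftrightarrow> integrable lborel f"
    unfolding integrable_restrict_space[OF \<Omega>] eq
    using assms(2) by (intro integrable_completion) simp
  show "(\<integral>x. f x \<partial>lebesgue_on \<Omega>) = (\<integral>x. f x \<partial>lborel)"
    unfolding integral_restrict_space[OF \<Omega>] eq
    using assms(2) by (intro integral_completion) simp
qed

lemma integrable_compact_support:
  fixes f :: "'a::euclidean_space \<Rightarrow> 'b::{banach, second_countable_topology}"
  assumes "continuous_on UNIV f" and "compact K" and "\<And>x. x \<notin> K \<Longrightarrow> f x = 0"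
  shows "integrable lborel f"
proof -
  have eq: "(\<lambda>x. indicator K x *\<^sub>R f x) = f"
    using assms(3) by (auto simp: indicator_def)
  show ?thesis
    using borel_integrable_compact[OF assms(2) continuous_on_subset[OF assms(1)]] by (simp add: eq)
qed

lemma smooth_borel: "smooth f \<Longrightarrow> f \<in> borel_measurable borel"
  by (intro borel_measurable_continuous_onI smooth_continuous)

lemma test_L2:
  assumes "open \<Omega>" and "\<phi> \<in> test_functions \<Omega>"
  shows "\<phi> \<in> L2_space (lebesgue_on \<Omega>)"
proof -
  obtain K where K: "smooth \<phi>" "compact K" "K \<subseteq> \<Omega>" "\<And>x. x \<notin> K \<Longrightarrow> \<phi> x = 0"
    using assms(2) by (auto simp: test_functions_iff)
  have "integrable lborel (\<lambda>x. (cmod (\<phi> x))\<^sup>2)"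
    using K by (intro integrable_compact_support[of _ K]) (auto intro!: continuous_intros smooth_continuous)
  moreover have "(\<lambda>x. (cmod (\<phi> x))\<^sup>2) \<in> borel_measurable borel"
    using smooth_borel[OF K(1)] by measurable
  ultimately have "integrable (lebesgue_on \<Omega>) (\<lambda>x. (cmod (\<phi> x))\<^sup>2)"
    using K assms(1) by (subst integrable_lebesgue_on_iff) auto
  then show ?thesis
    using smooth_borel[OF K(1)] by (simp add: L2_space_def borel_measurable_lebesgue_on)
qed

lemma integral_translation:
  fixes f :: "'a::euclidean_space \<Rightarrow> 'b::{banach, second_countable_topology}"
  assumes "f \<in> borel_measurable borel"
  shows "(\<integral>x. f (c + x) \<partial>lborel) = (\<integral>x. f x \<partial>lborel)"
proof -
  have "(\<integral>x. f x \<partial>lborel) = (\<integral>x. f x \<partial>(distr lborel borel ((+) c)))"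
    by (simp add: lborel_distr_plus)
  also have "\<dots> = (\<integral>x. f (c + x) \<partial>lborel)"
    using assms by (subst integral_distr) auto
  finally show ?thesis by simp
qed

lemma integrable_translation:
  fixes f :: "'a::euclidean_space \<Rightarrow> 'b::{banach, second_countable_topology}"
  assumes "integrable lborel f"
  shows "integrable lborel (\<lambda>x. f (c + x))"
proof -
  have "integrable (distr lborel borel ((+) c)) f"
    using assms by (simp add: lborel_distr_plus)
  then show ?thesis
    using assms by (subst (asm) integrable_distr_eq) auto
qed

text \<open>The difference quotients of \<open>f\<close> have integral zero by translation invariance. They vanish outside a
fixed ball and are bounded by the maximum of the derivative, so dominated convergence applies.\<close>

lemma integral_partial_deriv_eq_0:
  fixes f :: "'a::euclidean_space \<Rightarrow> complex"
  assumes f: "smooth f" and K: "compact K" and f0: "\<And>x. x \<notin> K \<Longrightarrow> f x = 0" and b: "b \<in> Basis"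
  shows "(\<integral>x. partial_deriv b f x \<partial>lborel) = 0"
proof -
  define t where "t n = inverse (real (Suc n))" for n
  have t: "0 < t n" "t n \<le> 1" for n
    by (auto simp: t_def field_simps)
  have t_lim: "t \<longlonglongrightarrow> 0"
    unfolding t_def by (rule LIMSEQ_inverse_real_of_nat)
  have f_meas [measurable]: "f \<in> borel_measurable borel"
    using f by (rule smooth_borel)
  have int_f: "integrable lborel f"
    using f K f0 by (intro integrable_compact_support[of f K]) (auto intro: smooth_continuous)
  have cont: "continuous_on UNIV (partial_deriv b f)"
    using f b by (intro smooth_continuous smooth_partial_deriv)
  have D0: "partial_deriv b f x = 0" if "x \<notin> K" for x
    using partial_deriv_eq_0[OF compact_imp_closed[OF K] f0 that] .
  have "bounded (partial_deriv b f ` K)"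
    using K cont by (intro compact_imp_bounded compact_continuous_image) (auto intro: continuous_on_subset)
  then obtain C where C: "C \<ge> 0" "\<And>x. x \<in> K \<Longrightarrow> cmod (partial_deriv b f x) \<le> C"
    unfolding bounded_pos by (metis image_eqI less_imp_le)
  have C': "cmod (partial_deriv b f x) \<le> C" for x
    using C D0[of x] by (cases "x \<in> K") auto
  have line: "((\<lambda>s. f (x + s *\<^sub>R b)) has_derivative (\<lambda>h. h *\<^sub>R partial_deriv b f (x + s *\<^sub>R b))) (at s within S)" for x s S
  proof -
    have D: "(f has_derivative frechet_derivative f (at (x + s *\<^sub>R b))) (at (x + s *\<^sub>R b))"
      using smooth_differentiable[OF f] by (rule differentiable_partial_deriv)
    interpret lin: linear "frechet_derivative f (at (x + s *\<^sub>R b))"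
      using has_derivative_linear[OF D] .
    have "((\<lambda>s. x + s *\<^sub>R b) has_derivative (\<lambda>h. h *\<^sub>R b)) (at s within S)"
      by (auto intro!: derivative_eq_intros)
    from has_derivative_compose[OF this D] show ?thesis
      by (simp add: lin.scale partial_deriv_def)
  qed
  obtain B where B: "B > 0" "\<And>x. x \<in> K \<Longrightarrow> norm x \<le> B"
    using compact_imp_bounded[OF K] by (auto simp: bounded_pos)
  define q where "q n x = (f (x + t n *\<^sub>R b) - f x) / complex_of_real (t n)" for n x
  have q_bound: "cmod (q n x) \<le> C * indicator (cball 0 (B + 1)) x" for n x
  \<comment> \<open>the step size is at most one, so outside this ball both points of the quotient miss \<open>K\<close>\<close>
  proof (cases "x \<in> cball 0 (B + 1)")
    case True
    have "cmod (f (x + t n *\<^sub>R b) - f (x + 0 *\<^sub>R b)) \<le> C * norm (t n - 0)"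
    proof (rule differentiable_bound[where S = UNIV and f' = "\<lambda>s h. h *\<^sub>R partial_deriv b f (x + s *\<^sub>R b)"])
      show "onorm (\<lambda>h. h *\<^sub>R partial_deriv b f (x + s *\<^sub>R b)) \<le> C" for s :: real
      proof (rule onorm_bound[OF C(1)])
        fix h :: real
        show "norm (h *\<^sub>R partial_deriv b f (x + s *\<^sub>R b)) \<le> C * norm h"
          using mult_right_mono[OF C'[of "x + s *\<^sub>R b"], of "\<bar>h\<bar>"] by (simp add: mult.commute)
      qed
    qed (auto intro: line)
    then show ?thesis
      using True t[of n] by (simp add: q_def norm_divide field_simps)
  next
    case False
    then have far: "norm x > B + 1" by simp
    then have "x \<notin> K" using B by fastforce
    moreover have "x + t n *\<^sub>R b \<notin> K"
    proof
      assume "x + t n *\<^sub>R b \<in> K"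
      then have "norm (x + t n *\<^sub>R b) \<le> B" by (rule B)
      moreover have "norm x \<le> norm (x + t n *\<^sub>R b) + norm (t n *\<^sub>R b)"
        using norm_triangle_ineq4[of "x + t n *\<^sub>R b" "t n *\<^sub>R b"] by simp
      moreover have "norm (t n *\<^sub>R b) \<le> 1"
        using t[of n] b by simp
      ultimately show False using far by linarith
    qed
    ultimately show ?thesis
      using f0 False by (simp add: q_def)
  qed
  have q_lim: "(\<lambda>n. q n x) \<longlonglongrightarrow> partial_deriv b f x" for x
  proof -
    define p where "p = partial_deriv b f x"
    have "((\<lambda>s. f (x + s *\<^sub>R b)) has_derivative (\<lambda>h. h *\<^sub>R p)) (at 0)"
      using line[of x 0 UNIV] by (simp add: p_def)
    then have "((\<lambda>h. norm (f (x + h *\<^sub>R b) - f x - h *\<^sub>R p) / norm h) \<longlongrightarrow> 0) (at 0)"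
      by (simp add: has_derivative_at)
    moreover have "filterlim t (at 0) sequentially"
      unfolding filterlim_at using t_lim t by (simp add: less_imp_neq[symmetric])
    ultimately have "(\<lambda>n. norm (f (x + t n *\<^sub>R b) - f x - t n *\<^sub>R p) / norm (t n)) \<longlonglongrightarrow> 0"
      by (rule filterlim_compose)
    moreover have "norm (f (x + t n *\<^sub>R b) - f x - t n *\<^sub>R p) / norm (t n) = norm (q n x - p)" for n
    proof -
      have "q n x - p = (f (x + t n *\<^sub>R b) - f x - t n *\<^sub>R p) / complex_of_real (t n)"
        using t[of n] by (simp add: q_def diff_divide_distrib scaleR_conv_of_real)
      then show ?thesis by (simp add: norm_divide)
    qed
    ultimately have "(\<lambda>n. q n x - p) \<longlonglongrightarrow> 0"
      by (simp add: tendsto_norm_zero_iff)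
    then show ?thesis
      unfolding p_def by (simp add: LIM_zero_iff)
  qed
  have "(\<lambda>n. \<integral>x. q n x \<partial>lborel) \<longlonglongrightarrow> (\<integral>x. partial_deriv b f x \<partial>lborel)"
  proof (rule integral_dominated_convergence[where w = "\<lambda>x. C * indicator (cball 0 (B + 1)) x"])
    show "partial_deriv b f \<in> borel_measurable lborel"
      using cont by (auto intro: borel_measurable_continuous_onI)
    show "q n \<in> borel_measurable lborel" for n
      unfolding q_def by measurable
    show "integrable lborel (\<lambda>x. C * indicator (cball 0 (B + 1)) x)"
      using emeasure_lborel_cball_finite by (intro integrable_mult_right) (auto intro!: integrable_real_indicator)
  qed (use q_lim q_bound in auto)
  moreover have "(\<integral>x. q n x \<partial>lborel) = 0" for n
  proof -
    have "(\<integral>x. q n x \<partial>lborel) = (\<integral>x. (f (t n *\<^sub>R b + x) - f x) / complex_of_real (t n) \<partial>lborel)"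
      by (simp add: q_def add.commute)
    also have "\<dots> = ((\<integral>x. f (t n *\<^sub>R b + x) \<partial>lborel) - (\<integral>x. f x \<partial>lborel)) / complex_of_real (t n)"
      using int_f integrable_translation[OF int_f] by simp
    finally show ?thesis
      by (simp add: integral_translation)
  qed
  ultimately show ?thesis
    by (simp add: LIMSEQ_const_iff)
qed

lemma integral_by_parts_test:
  assumes "open \<Omega>" and f: "smooth f" and \<psi>: "\<psi> \<in> test_functions \<Omega>" and b: "b \<in> Basis"
  shows "(\<integral>x. f x * partial_deriv b \<psi> x \<partial>lebesgue_on \<Omega>) = - (\<integral>x. partial_deriv b f x * \<psi> x \<partial>lebesgue_on \<Omega>)"
proof -
  obtain K where K: "smooth \<psi>" "compact K" "K \<subseteq> \<Omega>" "\<And>x. x \<notin> K \<Longrightarrow> \<psi> x = 0"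
    using \<psi> by (auto simp: test_functions_iff)
  have D0: "partial_deriv b \<psi> x = 0" if "x \<notin> K" for x
    using partial_deriv_eq_0[OF compact_imp_closed[OF K(2)] K(4) that] .
  have s: "smooth (\<lambda>x. f x * partial_deriv b \<psi> x)" "smooth (\<lambda>x. partial_deriv b f x * \<psi> x)"
    using f K(1) b by (auto intro: smooth_mult smooth_partial_deriv)
  have i: "integrable lborel (\<lambda>x. f x * partial_deriv b \<psi> x)" "integrable lborel (\<lambda>x. partial_deriv b f x * \<psi> x)"
    using s K D0 by (auto intro!: integrable_compact_support[of _ K] smooth_continuous)
  have "(\<integral>x. partial_deriv b (\<lambda>x. f x * \<psi> x) x \<partial>lborel) = 0"
    by (rule integral_partial_deriv_eq_0[of _ K]) (use f K b in \<open>auto intro: smooth_mult\<close>)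
  also have "(\<integral>x. partial_deriv b (\<lambda>x. f x * \<psi> x) x \<partial>lborel) =
      (\<integral>x. f x * partial_deriv b \<psi> x + partial_deriv b f x * \<psi> x \<partial>lborel)"
    using f K by (intro Bochner_Integration.integral_cong) (auto intro!: partial_deriv_mult smooth_differentiable)
  also have "\<dots> = (\<integral>x. f x * partial_deriv b \<psi> x \<partial>lborel) + (\<integral>x. partial_deriv b f x * \<psi> x \<partial>lborel)"
    using i by (rule Bochner_Integration.integral_add)
  finally have "(\<integral>x. f x * partial_deriv b \<psi> x \<partial>lborel) = - (\<integral>x. partial_deriv b f x * \<psi> x \<partial>lborel)"
    by (simp add: eq_neg_iff_add_eq_0)
  moreover have "(\<integral>x. f x * partial_deriv b \<psi> x \<partial>lebesgue_on \<Omega>) = (\<integral>x. f x * partial_deriv b \<psi> x \<partial>lborel)"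
    by (rule integrable_lebesgue_on_iff) (use assms(1) K D0 s in \<open>auto intro: smooth_borel\<close>)
  moreover have "(\<integral>x. partial_deriv b f x * \<psi> x \<partial>lebesgue_on \<Omega>) = (\<integral>x. partial_deriv b f x * \<psi> x \<partial>lborel)"
    by (rule integrable_lebesgue_on_iff) (use assms(1) K s in \<open>auto intro: smooth_borel\<close>)
  ultimately show ?thesis by simp
qed

text \<open>The positive and the negative part of \<open>h\<close> are densities of finite measures that agree on boxes, hence
on all Borel sets.\<close>

lemma AE_zero_of_box_integrals_real:
  fixes h :: "'a::euclidean_space \<Rightarrow> real"
  assumes h: "integrable lborel h" and box0: "\<And>a b. (\<integral>x. h x * indicator (box a b) x \<partial>lborel) = 0"
  shows "AE x in lborel. h x = 0"
proof -
  have [measurable]: "h \<in> borel_measurable borel"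
    using h by (auto dest: borel_measurable_integrable)
  define P where "P = (\<lambda>x. ennreal (max 0 (h x)))"
  define N where "N = (\<lambda>x. ennreal (max 0 (- h x)))"
  have [measurable]: "P \<in> borel_measurable borel" "N \<in> borel_measurable borel"
    unfolding P_def N_def by measurable
  have int: "integrable lborel (\<lambda>x. max 0 (h x) * indicator (box a b) x)"
    "integrable lborel (\<lambda>x. max 0 (- h x) * indicator (box a b) x)" for a b
    by (rule Bochner_Integration.integrable_bound[OF h]; auto simp: indicator_def)+
  have eq: "emeasure (density lborel P) (box a b) = emeasure (density lborel N) (box a b)" for a b
  proof -
    have "emeasure (density lborel P) (box a b) = (\<integral>\<^sup>+x. ennreal (max 0 (h x) * indicator (box a b) x) \<partial>lborel)"
      by (subst emeasure_density) (auto simp: P_def indicator_def intro!: nn_integral_cong)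
    also have "\<dots> = ennreal (\<integral>x. max 0 (h x) * indicator (box a b) x \<partial>lborel)"
      by (rule nn_integral_eq_integral[OF int(1)]) auto
    also have "(\<integral>x. max 0 (h x) * indicator (box a b) x \<partial>lborel) = (\<integral>x. max 0 (- h x) * indicator (box a b) x \<partial>lborel)"
    proof -
      have "(\<integral>x. max 0 (h x) * indicator (box a b) x \<partial>lborel) - (\<integral>x. max 0 (- h x) * indicator (box a b) x \<partial>lborel)
          = (\<integral>x. max 0 (h x) * indicator (box a b) x - max 0 (- h x) * indicator (box a b) x \<partial>lborel)"
        using int by simp
      also have "\<dots> = (\<integral>x. h x * indicator (box a b) x \<partial>lborel)"
        by (intro Bochner_Integration.integral_cong) (auto simp: indicator_def max_def)
      finally show ?thesis using box0[of a b] by simp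
    qed
    also have "ennreal \<dots> = (\<integral>\<^sup>+x. ennreal (max 0 (- h x) * indicator (box a b) x) \<partial>lborel)"
      by (rule nn_integral_eq_integral[OF int(2), symmetric]) auto
    also have "\<dots> = emeasure (density lborel N) (box a b)"
      by (subst emeasure_density) (auto simp: N_def indicator_def intro!: nn_integral_cong)
    finally show ?thesis .
  qed
  have fin: "emeasure (density lborel P) X \<noteq> \<infinity>" if "X \<in> sets borel" for X
  proof -
    have "emeasure (density lborel P) X \<le> (\<integral>\<^sup>+x. ennreal (norm (h x)) \<partial>lborel)"
      using that by (subst emeasure_density) (auto simp: P_def indicator_def intro!: nn_integral_mono ennreal_leI)
    also have "\<dots> < \<infinity>"
      using h by (simp add: integrable_iff_bounded)
    finally show ?thesis by simp
  qed
  have "density lborel P = density lborel N"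
  proof (rule measure_eqI_generator_eq[where E = "range (\<lambda>(a, b). box a b :: 'a set)" and \<Omega> = UNIV
        and A = "\<lambda>n. box (- real n *\<^sub>R One) (real n *\<^sub>R One)"])
    show "Int_stable (range (\<lambda>(a, b). box a b :: 'a set))"
      by (auto simp: Int_stable_def box_Int_box)
    show "sets (density lborel P) = sigma_sets UNIV (range (\<lambda>(a, b). box a b))"
      "sets (density lborel N) = sigma_sets UNIV (range (\<lambda>(a, b). box a b))"
      by (simp_all add: borel_eq_box)
    show "(\<Union>n. box (- real n *\<^sub>R One) (real n *\<^sub>R One)) = (UNIV :: 'a set)"
      using UN_box_eq_UNIV by simp
    show "emeasure (density lborel P) (box (- real i *\<^sub>R One) (real i *\<^sub>R One)) \<noteq> \<infinity>" for i
      by (rule fin) simp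
  qed (use eq in auto)
  then have "AE x in lborel. P x = N x"
    by (intro sigma_finite_measure.density_unique[OF sigma_finite_lborel]) auto
  then show ?thesis
  proof eventually_elim
    fix x assume "P x = N x"
    then have "max 0 (h x) = max 0 (- h x)"
      unfolding P_def N_def by (metis ennreal_inj max.cobounded1)
    then show "h x = 0"
      by (simp add: max_def split: if_splits)
  qed
qed

lemma AE_zero_of_box_integrals_lebesgue_real:
  fixes h :: "'a::euclidean_space \<Rightarrow> real"
  assumes h: "integrable lebesgue h" and box0: "\<And>a b. (\<integral>x. h x * indicator (box a b) x \<partial>lebesgue) = 0"
  shows "AE x in lebesgue. h x = 0"
proof -
  have h_meas: "h \<in> borel_measurable lebesgue"
    using h by (rule borel_measurable_integrable)
  then obtain r where r [measurable]: "r \<in> borel_measurable lborel" and hr: "AE x in lborel. h x = r x"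
    using completion_ex_borel_measurable_real by blast
  have hr': "AE x in lebesgue. h x = r x"
    using hr by (rule AE_completion)
  have r_leb: "r \<in> borel_measurable lebesgue"
    by (rule measurable_completion[OF r])
  have "integrable lebesgue r"
    using integrable_cong_AE[OF h_meas r_leb hr'] h by simp
  then have "integrable lborel r"
    using r by (simp add: integrable_completion)
  moreover have "(\<integral>x. r x * indicator (box a b) x \<partial>lborel) = 0" for a b
  proof -
    have "(\<integral>x. r x * indicator (box a b) x \<partial>lborel) = (\<integral>x. r x * indicator (box a b) x \<partial>lebesgue)"
      by (rule integral_completion[symmetric]) simp
    also have "\<dots> = (\<integral>x. h x * indicator (box a b) x \<partial>lebesgue)"
      by (rule integral_cong_AE)
        (use hr' in \<open>auto intro!: borel_measurable_times r_leb h_meas borel_measurable_indicator fmeasurableD[OF lmeasurable_box]\<close>)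
    finally show ?thesis using box0 by simp
  qed
  ultimately have "AE x in lborel. r x = 0"
    by (rule AE_zero_of_box_integrals_real)
  then have "AE x in lebesgue. r x = 0"
    by (rule AE_completion)
  with hr' show ?thesis
    by eventually_elim simp
qed

lemma AE_zero_of_box_integrals:
  fixes h :: "'a::euclidean_space \<Rightarrow> complex"
  assumes h: "integrable lebesgue h" and box0: "\<And>a b. (\<integral>x. h x * indicator (box a b) x \<partial>lebesgue) = 0"
  shows "AE x in lebesgue. h x = 0"
proof -
  have int: "integrable lebesgue (\<lambda>x. h x * indicator (box a b) x)" for a b
  proof -
    have "(\<lambda>x. h x * indicator (box a b) x) = (\<lambda>x. indicat_real (box a b) x *\<^sub>R h x)"
      by (auto simp: indicator_def)
    then show ?thesis
      using integrable_mult_indicator[OF fmeasurableD[OF lmeasurable_box] h, of a b] by simp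
  qed
  have "(\<integral>x. Re (h x) * indicator (box a b) x \<partial>lebesgue) = 0" for a b
  proof -
    have "(\<integral>x. Re (h x) * indicator (box a b) x \<partial>lebesgue) = (\<integral>x. Re (h x * indicator (box a b) x) \<partial>lebesgue)"
      by (rule Bochner_Integration.integral_cong) (auto simp: indicator_def)
    also have "\<dots> = Re (\<integral>x. h x * indicator (box a b) x \<partial>lebesgue)"
      by (rule integral_Re[OF int])
    finally show ?thesis
      by (simp add: box0)
  qed
  then have re: "AE x in lebesgue. Re (h x) = 0"
    using h by (intro AE_zero_of_box_integrals_lebesgue_real) auto
  have "(\<integral>x. Im (h x) * indicator (box a b) x \<partial>lebesgue) = 0" for a b
  proof -
    have "(\<integral>x. Im (h x) * indicator (box a b) x \<partial>lebesgue) = (\<integral>x. Im (h x * indicator (box a b) x) \<partial>lebesgue)"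
      by (rule Bochner_Integration.integral_cong) (auto simp: indicator_def)
    also have "\<dots> = Im (\<integral>x. h x * indicator (box a b) x \<partial>lebesgue)"
      by (rule integral_Im[OF int])
    finally show ?thesis
      by (simp add: box0)
  qed
  then have im: "AE x in lebesgue. Im (h x) = 0"
    using h by (intro AE_zero_of_box_integrals_lebesgue_real) auto
  from re im show ?thesis
    by eventually_elim (simp add: complex_eq_iff)
qed

text \<open>Testing with \<open>box_bump\<close> shows that \<open>g\<close> has integral zero over every box whose closure lies in \<open>\<Omega>\<close>. Countably
many such boxes cover \<open>\<Omega>\<close>.\<close>

lemma fundamental_lemma:
  fixes g :: "'a::euclidean_space \<Rightarrow> complex"
  assumes "open \<Omega>" and g: "g \<in> L2_space (lebesgue_on \<Omega>)"
    and zero: "\<And>\<phi>. \<phi> \<in> test_functions \<Omega> \<Longrightarrow> (\<integral>x. g x * \<phi> x \<partial>lebesgue_on \<Omega>) = 0"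
  shows "AE x in lebesgue_on \<Omega>. g x = 0"
proof -
  have \<Omega>: "\<Omega> \<inter> space lebesgue \<in> sets lebesgue"
    using assms(1) by auto
  have g_meas: "g \<in> borel_measurable (lebesgue_on \<Omega>)"
    using g by (rule L2_spaceD)
  have int: "integrable (lebesgue_on \<Omega>) (\<lambda>x. g x * indicator (box a b) x)" if "box a b \<subseteq> \<Omega>" for a b
  proof (rule L2_integrable_mult[OF g])
    have "integrable (lebesgue_on \<Omega>) (\<lambda>x. indicat_real (box a b) x)"
      using that assms(1) emeasure_lborel_box_finite
      by (subst integrable_lebesgue_on_iff) (auto simp: indicator_def intro!: integrable_real_indicator)
    moreover have "(\<lambda>x. (cmod (indicator (box a b) x))\<^sup>2) = indicat_real (box a b)"
      by (auto simp: indicator_def)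
    moreover have "(indicator (box a b) :: 'a \<Rightarrow> complex) \<in> borel_measurable (lebesgue_on \<Omega>)"
      by (intro borel_measurable_lebesgue_on) auto
    ultimately show "indicator (box a b) \<in> L2_space (lebesgue_on \<Omega>)"
      by (simp add: L2_space_def)
  qed
  have box0: "(\<integral>x. g x * indicator (box a b) x \<partial>lebesgue_on \<Omega>) = 0" if ab: "cbox a b \<subseteq> \<Omega>" for a b
  proof -
    have box: "box a b \<subseteq> \<Omega>"
      using ab box_subset_cbox by blast
    have "(\<lambda>n. \<integral>x. g x * complex_of_real (box_bump n a b x) \<partial>lebesgue_on \<Omega>) \<longlonglongrightarrow>
        (\<integral>x. g x * indicator (box a b) x \<partial>lebesgue_on \<Omega>)"
    proof (rule integral_dominated_convergence[where w = "\<lambda>x. cmod (g x * indicator (box a b) x)"])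
      show "(\<lambda>x. g x * indicator (box a b) x) \<in> borel_measurable (lebesgue_on \<Omega>)"
        using int[OF box] by (rule borel_measurable_integrable)
      show "(\<lambda>x. g x * complex_of_real (box_bump n a b x)) \<in> borel_measurable (lebesgue_on \<Omega>)" for n
        by (intro borel_measurable_times g_meas borel_measurable_lebesgue_on smooth_borel smooth_box_bump)
      show "integrable (lebesgue_on \<Omega>) (\<lambda>x. cmod (g x * indicator (box a b) x))"
        using int[OF box] by (rule integrable_norm)
      show "AE x in lebesgue_on \<Omega>. (\<lambda>n. g x * complex_of_real (box_bump n a b x)) \<longlonglongrightarrow> g x * indicator (box a b) x"
      proof (rule AE_I2)
        fix x
        show "(\<lambda>n. g x * complex_of_real (box_bump n a b x)) \<longlonglongrightarrow> g x * indicator (box a b) x"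
        proof (cases "x \<in> box a b")
          case True
          have "(\<lambda>n. g x * complex_of_real (box_bump n a b x)) \<longlonglongrightarrow> g x * complex_of_real 1"
            by (intro tendsto_intros box_bump_tendsto[OF True])
          then show ?thesis using True by simp
        qed (simp add: box_bump_eq_0)
      qed
      show "AE x in lebesgue_on \<Omega>. cmod (g x * complex_of_real (box_bump n a b x)) \<le> cmod (g x * indicator (box a b) x)" for n
      proof (rule AE_I2)
        fix x
        show "cmod (g x * complex_of_real (box_bump n a b x)) \<le> cmod (g x * indicator (box a b) x)"
          using box_bump_bounds[of n a b x] box_bump_eq_0[of x a b n]
          by (cases "x \<in> box a b") (auto simp: norm_mult mult_left_le)
      qed
    qed
    moreover have "(\<integral>x. g x * complex_of_real (box_bump n a b x) \<partial>lebesgue_on \<Omega>) = 0" for n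
    proof (rule zero)
      show "(\<lambda>x. complex_of_real (box_bump n a b x)) \<in> test_functions \<Omega>"
        unfolding test_functions_iff
        using ab box_subset_cbox[of a b] by (auto intro!: exI[of _ "cbox a b"] box_bump_eq_0 smooth_box_bump)
    qed
    ultimately show ?thesis
      by (simp add: LIMSEQ_const_iff)
  qed
  have ae_box: "AE x in lebesgue. x \<in> box p q \<longrightarrow> g x = 0" if pq: "cbox p q \<subseteq> \<Omega>" for p q
  proof -
    have box: "box p q \<subseteq> \<Omega>"
      using pq box_subset_cbox by blast
    define h where "h x = g x * indicator (box p q) x" for x
    have ind: "indicator \<Omega> x *\<^sub>R (g x * indicator (box p q) x) = h x" for x
      using box by (auto simp: h_def indicator_def)
    have "integrable lebesgue h"
      using int[OF box] unfolding integrable_restrict_space[OF \<Omega>] ind .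
    moreover have "(\<integral>x. h x * indicator (box c d) x \<partial>lebesgue) = 0" for c d
    proof -
      obtain a b where ab: "box p q \<inter> box c d = box a b"
        using box_Int_box by blast
      have "(\<integral>x. h x * indicator (box c d) x \<partial>lebesgue) = (\<integral>x. indicator \<Omega> x *\<^sub>R (g x * indicator (box a b) x) \<partial>lebesgue)"
        using ab[symmetric] box by (intro Bochner_Integration.integral_cong) (auto simp: h_def indicator_def)
      also have "\<dots> = (\<integral>x. g x * indicator (box a b) x \<partial>lebesgue_on \<Omega>)"
        by (rule integral_restrict_space[OF \<Omega>, symmetric])
      also have "\<dots> = 0"
      proof (cases "box a b = {}")
        case False
        have "cbox a b = closure (box a b)"
          using False by (simp add: closure_box)
        also have "\<dots> \<subseteq> cbox p q"
          using ab box_subset_cbox[of p q] by (intro closure_minimal) auto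
        finally show ?thesis
          using pq by (intro box0) auto
      qed simp
      finally show ?thesis .
    qed
    ultimately have "AE x in lebesgue. h x = 0"
      by (rule AE_zero_of_box_integrals)
    then show ?thesis
      by eventually_elim (auto simp: h_def)
  qed
  have ae_cbox: "AE x in lebesgue. x \<in> cbox p q \<longrightarrow> g x = 0" if pq: "cbox p q \<subseteq> \<Omega>" for p q
  proof -
    have "cbox p q - box p q \<in> null_sets lebesgue"
      using negligible_frontier_interval negligible_iff_null_sets by blast
    then have "AE x in lebesgue. x \<notin> cbox p q - box p q"
      by (rule AE_not_in)
    with ae_box[OF pq] show ?thesis
      by eventually_elim auto
  qed
  obtain D where D: "countable D" "D \<subseteq> Pow \<Omega>" "\<And>X. X \<in> D \<Longrightarrow> \<exists>a b. X = cbox a b" "\<Union>D = \<Omega>"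
    using open_countable_Union_open_cbox[OF assms(1)] by metis
  have "AE x in lebesgue. \<forall>X\<in>D. x \<in> X \<longrightarrow> g x = 0"
    unfolding AE_ball_countable[OF D(1)]
  proof
    fix X assume X: "X \<in> D"
    then obtain a b where "X = cbox a b" "X \<subseteq> \<Omega>"
      using D by blast
    then show "AE x in lebesgue. x \<in> X \<longrightarrow> g x = 0"
      using ae_cbox by auto
  qed
  then have "AE x in lebesgue. x \<in> \<Omega> \<longrightarrow> g x = 0"
    by eventually_elim (use D(4) in blast)
  then show ?thesis
    by (simp add: AE_restrict_space_iff[OF \<Omega>])
qed


section \<open>The Dirichlet form\<close>

lemma weak_deriv_unique:
  assumes "open \<Omega>" and "g \<in> L2_space (lebesgue_on \<Omega>)" and "h \<in> L2_space (lebesgue_on \<Omega>)"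
    and "is_weak_deriv \<Omega> b u g" and "is_weak_deriv \<Omega> b u h"
  shows "AE x in lebesgue_on \<Omega>. g x = h x"
proof -
  have "AE x in lebesgue_on \<Omega>. g x - h x = 0"
  proof (rule fundamental_lemma[OF assms(1)])
    fix \<phi> assume \<phi>: "\<phi> \<in> test_functions \<Omega>"
    then have \<phi>L: "\<phi> \<in> L2_space (lebesgue_on \<Omega>)"
      using assms(1) by (intro test_L2)
    have "(\<integral>x. (g x - h x) * \<phi> x \<partial>lebesgue_on \<Omega>) =
        (\<integral>x. g x * \<phi> x \<partial>lebesgue_on \<Omega>) - (\<integral>x. h x * \<phi> x \<partial>lebesgue_on \<Omega>)"
      using assms(2,3) \<phi>L by (simp add: left_diff_distrib L2_integrable_mult)
    also have "\<dots> = 0"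
      using assms(4,5) \<phi> unfolding is_weak_deriv_def by (metis diff_self neg_equal_iff_equal)
    finally show "(\<integral>x. (g x - h x) * \<phi> x \<partial>lebesgue_on \<Omega>) = 0" .
  qed (use assms in simp)
  then show ?thesis by simp
qed

lemma H1_weak_deriv:
  assumes "u \<in> H1 \<Omega>" and "b \<in> Basis"
  shows "weak_deriv \<Omega> b u \<in> L2_space (lebesgue_on \<Omega>)" and "is_weak_deriv \<Omega> b u (weak_deriv \<Omega> b u)"
proof -
  have "\<exists>g. g \<in> L2_space (lebesgue_on \<Omega>) \<and> is_weak_deriv \<Omega> b u g"
    using assms by (auto simp: H1_def)
  from someI_ex[OF this] show "weak_deriv \<Omega> b u \<in> L2_space (lebesgue_on \<Omega>)"
    and "is_weak_deriv \<Omega> b u (weak_deriv \<Omega> b u)"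
    by (auto simp: weak_deriv_def)
qed

lemma H1_L2: "u \<in> H1 \<Omega> \<Longrightarrow> u \<in> L2_space (lebesgue_on \<Omega>)"
  by (simp add: H1_def)

lemma H1I:
  assumes "open \<Omega>" and "u \<in> L2_space (lebesgue_on \<Omega>)"
    and "\<And>b. b \<in> Basis \<Longrightarrow> g b \<in> L2_space (lebesgue_on \<Omega>)" and "\<And>b. b \<in> Basis \<Longrightarrow> is_weak_deriv \<Omega> b u (g b)"
  shows "u \<in> H1 \<Omega>" and "b \<in> Basis \<Longrightarrow> AE x in lebesgue_on \<Omega>. weak_deriv \<Omega> b u x = g b x"
proof -
  show u: "u \<in> H1 \<Omega>"
    using assms by (auto simp: H1_def)
  show "AE x in lebesgue_on \<Omega>. weak_deriv \<Omega> b u x = g b x" if "b \<in> Basis"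
    using weak_deriv_unique[OF assms(1)] H1_weak_deriv[OF u that] assms(3,4)[OF that] by blast
qed

lemma is_weak_deriv_add:
  assumes "open \<Omega>" and "b \<in> Basis" and "u \<in> L2_space (lebesgue_on \<Omega>)" "v \<in> L2_space (lebesgue_on \<Omega>)"
    "g \<in> L2_space (lebesgue_on \<Omega>)" "h \<in> L2_space (lebesgue_on \<Omega>)"
    and "is_weak_deriv \<Omega> b u g" and "is_weak_deriv \<Omega> b v h"
  shows "is_weak_deriv \<Omega> b (\<lambda>x. u x + v x) (\<lambda>x. g x + h x)"
  unfolding is_weak_deriv_def
proof
  fix \<phi> assume \<phi>: "\<phi> \<in> test_functions \<Omega>"
  have "\<phi> \<in> L2_space (lebesgue_on \<Omega>)" "partial_deriv b \<phi> \<in> L2_space (lebesgue_on \<Omega>)"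
    using \<phi> assms(1,2) by (auto intro!: test_L2 test_partial_deriv)
  then show "(\<integral>x. (u x + v x) * partial_deriv b \<phi> x \<partial>lebesgue_on \<Omega>) = - (\<integral>x. (g x + h x) * \<phi> x \<partial>lebesgue_on \<Omega>)"
    using assms \<phi> by (simp add: distrib_right L2_integrable_mult is_weak_deriv_def)
qed

lemma is_weak_deriv_scale:
  assumes "is_weak_deriv \<Omega> b u g"
  shows "is_weak_deriv \<Omega> b (\<lambda>x. c * u x) (\<lambda>x. c * g x)"
  using assms by (simp add: is_weak_deriv_def mult.assoc)

lemma H1_add:
  assumes "open \<Omega>" and "u \<in> H1 \<Omega>" and "v \<in> H1 \<Omega>"
  shows "(\<lambda>x. u x + v x) \<in> H1 \<Omega>"
    and "b \<in> Basis \<Longrightarrow> AE x in lebesgue_on \<Omega>. weak_deriv \<Omega> b (\<lambda>x. u x + v x) x = weak_deriv \<Omega> b u x + weak_deriv \<Omega> b v x"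
proof -
  show "(\<lambda>x. u x + v x) \<in> H1 \<Omega>"
    by (rule H1I(1)[OF assms(1), where g = "\<lambda>b x. weak_deriv \<Omega> b u x + weak_deriv \<Omega> b v x"])
      (use assms in \<open>auto intro!: is_weak_deriv_add H1_weak_deriv L2_space_add intro: H1_L2\<close>)
  show "AE x in lebesgue_on \<Omega>. weak_deriv \<Omega> b (\<lambda>x. u x + v x) x = weak_deriv \<Omega> b u x + weak_deriv \<Omega> b v x"
    if "b \<in> Basis"
    by (rule H1I(2)[OF assms(1), where g = "\<lambda>b x. weak_deriv \<Omega> b u x + weak_deriv \<Omega> b v x"])
      (use assms that in \<open>auto intro!: is_weak_deriv_add H1_weak_deriv L2_space_add intro: H1_L2\<close>)
qed

lemma H1_scale:
  assumes "open \<Omega>" and "u \<in> H1 \<Omega>"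
  shows "(\<lambda>x. c * u x) \<in> H1 \<Omega>"
    and "b \<in> Basis \<Longrightarrow> AE x in lebesgue_on \<Omega>. weak_deriv \<Omega> b (\<lambda>x. c * u x) x = c * weak_deriv \<Omega> b u x"
proof -
  show "(\<lambda>x. c * u x) \<in> H1 \<Omega>"
    by (rule H1I(1)[OF assms(1), where g = "\<lambda>b x. c * weak_deriv \<Omega> b u x"])
      (use assms in \<open>auto intro!: is_weak_deriv_scale H1_weak_deriv L2.scale_in intro: H1_L2\<close>)
  show "AE x in lebesgue_on \<Omega>. weak_deriv \<Omega> b (\<lambda>x. c * u x) x = c * weak_deriv \<Omega> b u x"
    if "b \<in> Basis"
    by (rule H1I(2)[OF assms(1), where g = "\<lambda>b x. c * weak_deriv \<Omega> b u x"])
      (use assms that in \<open>auto intro!: is_weak_deriv_scale H1_weak_deriv L2.scale_in intro: H1_L2\<close>)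
qed

lemma test_H1:
  assumes "open \<Omega>" and "\<phi> \<in> test_functions \<Omega>"
  shows "\<phi> \<in> H1 \<Omega>"
    and "b \<in> Basis \<Longrightarrow> AE x in lebesgue_on \<Omega>. weak_deriv \<Omega> b \<phi> x = partial_deriv b \<phi> x"
proof -
  have w: "is_weak_deriv \<Omega> b \<phi> (partial_deriv b \<phi>)" if "b \<in> Basis" for b
    unfolding is_weak_deriv_def using assms that by (auto intro!: integral_by_parts_test simp: test_functions_iff)
  show "\<phi> \<in> H1 \<Omega>"
    by (rule H1I(1)[OF assms(1), where g = "\<lambda>b. partial_deriv b \<phi>"])
      (use assms w in \<open>auto intro!: test_L2 test_partial_deriv\<close>)
  show "AE x in lebesgue_on \<Omega>. weak_deriv \<Omega> b \<phi> x = partial_deriv b \<phi> x" if "b \<in> Basis"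
    by (rule H1I(2)[OF assms(1), where g = "\<lambda>b. partial_deriv b \<phi>"])
      (use assms w that in \<open>auto intro!: test_L2 test_partial_deriv\<close>)
qed

text \<open>Weak derivatives are chosen and determined almost everywhere only, so the linearity of \<open>weak_deriv\<close>
holds almost everywhere and becomes an identity after integration.\<close>

lemma hermitian_form_H1:
  assumes "open \<Omega>"
  shows "hermitian_form (H1 \<Omega>) (dirichlet_form \<Omega>)"
proof
  show "(\<lambda>x. 0) \<in> H1 \<Omega>"
    using test_H1(1)[OF assms test_zero] .
  show "(\<lambda>x. u x + v x) \<in> H1 \<Omega>" if "u \<in> H1 \<Omega>" "v \<in> H1 \<Omega>" for u v
    using assms that by (rule H1_add)
  show "(\<lambda>x. c * u x) \<in> H1 \<Omega>" if "u \<in> H1 \<Omega>" for u c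
    using assms that by (rule H1_scale)
  show "dirichlet_form \<Omega> (\<lambda>x. u x + v x) w = dirichlet_form \<Omega> u w + dirichlet_form \<Omega> v w"
    if "u \<in> H1 \<Omega>" "v \<in> H1 \<Omega>" "w \<in> H1 \<Omega>" for u v w
    unfolding dirichlet_form_def sum.distrib[symmetric]
  proof (rule sum.cong[OF refl])
    fix b :: 'a assume b: "b \<in> Basis"
    note D = H1_weak_deriv(1)[OF _ b]
    have "L2_inner (lebesgue_on \<Omega>) (weak_deriv \<Omega> b (\<lambda>x. u x + v x)) (weak_deriv \<Omega> b w) =
        L2_inner (lebesgue_on \<Omega>) (\<lambda>x. weak_deriv \<Omega> b u x + weak_deriv \<Omega> b v x) (weak_deriv \<Omega> b w)"
      by (rule L2_inner_cong_AE) (use that D H1_add[OF assms that(1,2)] b in \<open>auto intro!: L2_spaceD(1) L2_space_add\<close>)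
    also have "\<dots> = L2_inner (lebesgue_on \<Omega>) (weak_deriv \<Omega> b u) (weak_deriv \<Omega> b w)
        + L2_inner (lebesgue_on \<Omega>) (weak_deriv \<Omega> b v) (weak_deriv \<Omega> b w)"
      using that D by (simp add: L2.add_left)
    finally show "L2_inner (lebesgue_on \<Omega>) (weak_deriv \<Omega> b (\<lambda>x. u x + v x)) (weak_deriv \<Omega> b w) = \<dots>" .
  qed
  show "dirichlet_form \<Omega> (\<lambda>x. c * u x) w = c * dirichlet_form \<Omega> u w"
    if "u \<in> H1 \<Omega>" "w \<in> H1 \<Omega>" for u w c
    unfolding dirichlet_form_def sum_distrib_left
  proof (rule sum.cong[OF refl])
    fix b :: 'a assume b: "b \<in> Basis"
    note D = H1_weak_deriv(1)[OF _ b]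
    have "L2_inner (lebesgue_on \<Omega>) (weak_deriv \<Omega> b (\<lambda>x. c * u x)) (weak_deriv \<Omega> b w) =
        L2_inner (lebesgue_on \<Omega>) (\<lambda>x. c * weak_deriv \<Omega> b u x) (weak_deriv \<Omega> b w)"
      by (rule L2_inner_cong_AE) (use that D H1_scale[OF assms that(1), where c = c] b in \<open>auto intro!: L2_spaceD(1) L2.scale_in\<close>)
    also have "\<dots> = c * L2_inner (lebesgue_on \<Omega>) (weak_deriv \<Omega> b u) (weak_deriv \<Omega> b w)"
      using that D by (simp add: L2.scale_left)
    finally show "L2_inner (lebesgue_on \<Omega>) (weak_deriv \<Omega> b (\<lambda>x. c * u x)) (weak_deriv \<Omega> b w) = \<dots>" .
  qed
  show "dirichlet_form \<Omega> v u = cnj (dirichlet_form \<Omega> u v)" if "u \<in> H1 \<Omega>" "v \<in> H1 \<Omega>" for u v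
    unfolding dirichlet_form_def cnj_sum
    using that by (intro sum.cong refl L2.hermitian) (auto intro: H1_weak_deriv)
  show "0 \<le> Re (dirichlet_form \<Omega> u u)" for u
    unfolding dirichlet_form_def Re_sum by (intro sum_nonneg) (simp add: L2_inner_self)
qed

text \<open>The norm of \<open>H1\<close> comes from a Hermitian form as well, which provides its triangle inequality.\<close>

lemma H1_norm_eq: "H1_norm \<Omega> u = sqrt (Re (L2_inner (lebesgue_on \<Omega>) u u + dirichlet_form \<Omega> u u))"
  by (simp add: H1_norm_def L2_norm_sq dirichlet_form_def Re_sum)

lemma hermitian_form_H1_norm:
  assumes "open \<Omega>"
  shows "hermitian_form (H1 \<Omega>) (\<lambda>u v. L2_inner (lebesgue_on \<Omega>) u v + dirichlet_form \<Omega> u v)"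
proof -
  interpret D: hermitian_form "H1 \<Omega>" "dirichlet_form \<Omega>"
    using assms by (rule hermitian_form_H1)
  show ?thesis
  proof
    show "L2_inner (lebesgue_on \<Omega>) v u + dirichlet_form \<Omega> v u = cnj (L2_inner (lebesgue_on \<Omega>) u v + dirichlet_form \<Omega> u v)"
      if "u \<in> H1 \<Omega>" "v \<in> H1 \<Omega>" for u v
      using D.hermitian[OF that] L2.hermitian[OF H1_L2[OF that(1)] H1_L2[OF that(2)]] by simp
    show "0 \<le> Re (L2_inner (lebesgue_on \<Omega>) u u + dirichlet_form \<Omega> u u)" if "u \<in> H1 \<Omega>" for u
      using D.nonneg[OF that] by (simp add: L2_inner_self)
  qed (auto simp: H1_L2 D.sesquilinear L2.sesquilinear distrib_left)
qed

lemma H1_0I: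
  assumes "u \<in> H1 \<Omega>" and "\<And>n::nat. \<phi> n \<in> test_functions \<Omega>"
    and "(\<lambda>n. H1_norm \<Omega> (\<lambda>x. u x - \<phi> n x)) \<longlonglongrightarrow> 0"
  shows "u \<in> H1_0 \<Omega>"
  using assms by (auto simp: H1_0_def)

lemma H1_0_H1: "u \<in> H1_0 \<Omega> \<Longrightarrow> u \<in> H1 \<Omega>"
  by (simp add: H1_0_def)

lemma test_H1_0:
  assumes "open \<Omega>" and "\<phi> \<in> test_functions \<Omega>"
  shows "\<phi> \<in> H1_0 \<Omega>"
proof -
  interpret N: hermitian_form "H1 \<Omega>" "\<lambda>u v. L2_inner (lebesgue_on \<Omega>) u v + dirichlet_form \<Omega> u v"
    using assms(1) by (rule hermitian_form_H1_norm)
  have "H1_norm \<Omega> (\<lambda>x. 0) = 0"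
    using N.zero_left[OF N.zero_in] by (simp add: H1_norm_eq)
  then show ?thesis
    using assms test_H1(1)[OF assms] by (auto simp: H1_0_def intro!: exI[of _ "\<lambda>_. \<phi>"])
qed

lemma form_operator_H1_0:
  assumes "open \<Omega>"
  shows "form_operator (H1_0 \<Omega>) (dirichlet_form \<Omega>) (lebesgue_on \<Omega>)"
proof -
  interpret D: hermitian_form "H1 \<Omega>" "dirichlet_form \<Omega>"
    using assms by (rule hermitian_form_H1)
  interpret N: hermitian_form "H1 \<Omega>" "\<lambda>u v. L2_inner (lebesgue_on \<Omega>) u v + dirichlet_form \<Omega> u v"
    using assms by (rule hermitian_form_H1_norm)
  have H1_diff: "(\<lambda>x. u x - \<phi> x) \<in> H1 \<Omega>" if "u \<in> H1 \<Omega>" "\<phi> \<in> test_functions \<Omega>" for u \<phi>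
    using D.diff_in[OF that(1) test_H1(1)[OF assms that(2)]] .
  show ?thesis
  proof
    show "(\<lambda>x. 0) \<in> H1_0 \<Omega>"
      using assms test_zero by (rule test_H1_0)
    show "(\<lambda>x. u x + v x) \<in> H1_0 \<Omega>" if uv: "u \<in> H1_0 \<Omega>" "v \<in> H1_0 \<Omega>" for u v
    proof -
      obtain \<phi> \<psi> where \<phi>: "\<And>n. \<phi> n \<in> test_functions \<Omega>" "(\<lambda>n. H1_norm \<Omega> (\<lambda>x. u x - \<phi> n x)) \<longlonglongrightarrow> 0"
        and \<psi>: "\<And>n. \<psi> n \<in> test_functions \<Omega>" "(\<lambda>n. H1_norm \<Omega> (\<lambda>x. v x - \<psi> n x)) \<longlonglongrightarrow> 0"
        using uv unfolding H1_0_def by blast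
      have "(\<lambda>n. H1_norm \<Omega> (\<lambda>x. u x + v x - (\<phi> n x + \<psi> n x))) \<longlonglongrightarrow> 0"
      proof (rule tendsto_sandwich[OF _ _ tendsto_const])
        show "(\<lambda>n. H1_norm \<Omega> (\<lambda>x. u x - \<phi> n x) + H1_norm \<Omega> (\<lambda>x. v x - \<psi> n x)) \<longlonglongrightarrow> 0"
          using tendsto_add[OF \<phi>(2) \<psi>(2)] by simp
        show "\<forall>\<^sub>F n in sequentially. H1_norm \<Omega> (\<lambda>x. u x + v x - (\<phi> n x + \<psi> n x)) \<le>
            H1_norm \<Omega> (\<lambda>x. u x - \<phi> n x) + H1_norm \<Omega> (\<lambda>x. v x - \<psi> n x)"
        proof (rule always_eventually, rule allI)
          fix n
          show "H1_norm \<Omega> (\<lambda>x. u x + v x - (\<phi> n x + \<psi> n x)) \<le>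
              H1_norm \<Omega> (\<lambda>x. u x - \<phi> n x) + H1_norm \<Omega> (\<lambda>x. v x - \<psi> n x)"
            using N.triangle[OF H1_diff H1_diff, of u "\<phi> n" v "\<psi> n"] uv \<phi>(1) \<psi>(1)
            by (simp add: H1_norm_eq H1_0_H1 algebra_simps)
        qed
      qed (simp add: H1_norm_def sum_nonneg)
      then show ?thesis
        by (rule H1_0I[rotated 2]) (use D.add_in uv H1_0_H1 test_add \<phi>(1) \<psi>(1) in blast)+
    qed
    show "(\<lambda>x. c * u x) \<in> H1_0 \<Omega>" if u: "u \<in> H1_0 \<Omega>" for u c
    proof -
      obtain \<phi> where \<phi>: "\<And>n. \<phi> n \<in> test_functions \<Omega>" "(\<lambda>n. H1_norm \<Omega> (\<lambda>x. u x - \<phi> n x)) \<longlonglongrightarrow> 0"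
        using u unfolding H1_0_def by blast
      have "H1_norm \<Omega> (\<lambda>x. c * u x - c * \<phi> n x) = cmod c * H1_norm \<Omega> (\<lambda>x. u x - \<phi> n x)" for n
        using N.diag_scale[OF H1_diff, of u "\<phi> n" c] u \<phi>(1)
        by (simp only: H1_norm_eq right_diff_distrib[symmetric]) (simp add: H1_0_H1 real_sqrt_mult)
      moreover have "(\<lambda>n. cmod c * H1_norm \<Omega> (\<lambda>x. u x - \<phi> n x)) \<longlonglongrightarrow> 0"
        using tendsto_mult_right_zero[OF \<phi>(2)] .
      ultimately have "(\<lambda>n. H1_norm \<Omega> (\<lambda>x. c * u x - c * \<phi> n x)) \<longlonglongrightarrow> 0"
        by simp
      then show ?thesis
        by (rule H1_0I[rotated 2]) (use D.scale_in u H1_0_H1 test_scale \<phi>(1) in blast)+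
    qed
    show "dirichlet_form \<Omega> v u = cnj (dirichlet_form \<Omega> u v)" if "u \<in> H1_0 \<Omega>" "v \<in> H1_0 \<Omega>" for u v
      using that by (intro D.hermitian H1_0_H1)
  qed (simp_all add: H1_0_H1 H1_L2 D.sesquilinear D.nonneg)
qed

lemma dirichlet_laplacian_eq:
  assumes "open \<Omega>"
  shows "dirichlet_laplacian \<Omega> = form_operator.T (H1_0 \<Omega>) (dirichlet_form \<Omega>) (lebesgue_on \<Omega>)"
proof -
  interpret form_operator "H1_0 \<Omega>" "dirichlet_form \<Omega>" "lebesgue_on \<Omega>"
    using assms by (rule form_operator_H1_0)
  show ?thesis
    by (simp add: dirichlet_laplacian_def T_def)
qed

lemma dirichlet_form_test:
  assumes "open \<Omega>" and "\<phi> \<in> test_functions \<Omega>"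
  shows "Re (dirichlet_form \<Omega> \<phi> \<phi>) = (\<integral>x. (\<Sum>b\<in>Basis. (cmod (partial_deriv b \<phi> x))\<^sup>2) \<partial>lborel)"
proof -
  obtain K where K: "smooth \<phi>" "compact K" "K \<subseteq> \<Omega>" "\<And>x. x \<notin> K \<Longrightarrow> \<phi> x = 0"
    using assms(2) by (auto simp: test_functions_iff)
  have D0: "partial_deriv b \<phi> x = 0" if "x \<notin> K" for x b
    using partial_deriv_eq_0[OF compact_imp_closed[OF K(2)] K(4) that] .
  have cont: "continuous_on UNIV (\<lambda>x. (cmod (partial_deriv b \<phi> x))\<^sup>2)" if "b \<in> Basis" for b
    using K(1) that by (intro continuous_intros smooth_continuous smooth_partial_deriv)
  have "Re (dirichlet_form \<Omega> \<phi> \<phi>) = (\<Sum>b\<in>Basis. \<integral>x. (cmod (partial_deriv b \<phi> x))\<^sup>2 \<partial>lborel)"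
    unfolding dirichlet_form_def Re_sum
  proof (rule sum.cong[OF refl])
    fix b :: 'a assume b: "b \<in> Basis"
    have P: "partial_deriv b \<phi> \<in> L2_space (lebesgue_on \<Omega>)"
      using assms b by (intro test_L2 test_partial_deriv)
    have "L2_inner (lebesgue_on \<Omega>) (weak_deriv \<Omega> b \<phi>) (weak_deriv \<Omega> b \<phi>) =
        L2_inner (lebesgue_on \<Omega>) (partial_deriv b \<phi>) (partial_deriv b \<phi>)"
      by (rule L2_inner_cong_AE)
        (use P test_H1[OF assms] b H1_weak_deriv(1) in \<open>auto intro!: L2_spaceD(1)\<close>)
    then have "Re (L2_inner (lebesgue_on \<Omega>) (weak_deriv \<Omega> b \<phi>) (weak_deriv \<Omega> b \<phi>)) =
        (\<integral>x. (cmod (partial_deriv b \<phi> x))\<^sup>2 \<partial>lebesgue_on \<Omega>)"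
      by (simp add: L2_inner_self)
    also have "\<dots> = (\<integral>x. (cmod (partial_deriv b \<phi> x))\<^sup>2 \<partial>lborel)"
      by (rule integrable_lebesgue_on_iff) (use assms(1) cont[OF b] D0 K(3) in \<open>auto intro: borel_measurable_continuous_onI\<close>)
    finally show "Re (L2_inner (lebesgue_on \<Omega>) (weak_deriv \<Omega> b \<phi>) (weak_deriv \<Omega> b \<phi>)) = \<dots>" .
  qed
  also have "\<dots> = (\<integral>x. (\<Sum>b\<in>Basis. (cmod (partial_deriv b \<phi> x))\<^sup>2) \<partial>lborel)"
    by (rule Bochner_Integration.integral_sum[symmetric])
      (use cont D0 K(2) in \<open>auto intro!: integrable_compact_support[of _ K]\<close>)
  finally show ?thesis .
qed

lemma L2_inner_test:
  assumes "open \<Omega>" and "\<phi> \<in> test_functions \<Omega>"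
  shows "Re (L2_inner (lebesgue_on \<Omega>) \<phi> \<phi>) = (\<integral>x. (cmod (\<phi> x))\<^sup>2 \<partial>lborel)"
proof -
  obtain K where K: "smooth \<phi>" "compact K" "K \<subseteq> \<Omega>" "\<And>x. x \<notin> K \<Longrightarrow> \<phi> x = 0"
    using assms(2) by (auto simp: test_functions_iff)
  have [measurable]: "\<phi> \<in> borel_measurable borel"
    using K(1) by (rule smooth_borel)
  show ?thesis
    unfolding L2_inner_self by (rule integrable_lebesgue_on_iff) (use assms(1) K in auto)
qed


section \<open>The geometry of polyhedral layers\<close>

text \<open>The horizontal unit vector from the axis of the polyhedral angle towards its \<open>j\<close>-th face.\<close>

definition face_dir :: "nat \<Rightarrow> nat \<Rightarrow> real^3" where
  "face_dir N j = vector [cos (real j * (2 * pi / real N)), sin (real j * (2 * pi / real N)), 0]"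

text \<open>The signed distance to the plane of the \<open>j\<close>-th face, positive on the side of the polyhedral angle.\<close>

definition face_dist :: "nat \<Rightarrow> real \<Rightarrow> nat \<Rightarrow> real^3 \<Rightarrow> real" where
  "face_dist N \<theta> j x = x $ 3 * sin \<theta> - cos \<theta> * (face_dir N j \<bullet> x)"

lemma face_dir_inner: "face_dir N j \<bullet> x =
    cos (real j * (2 * pi / real N)) * x $ 1 + sin (real j * (2 * pi / real N)) * x $ 2"
  by (simp add: face_dir_def inner_vec_def sum_3)

lemma norm_face_dir: "norm (face_dir N j) = 1"
  by (simp add: norm_eq_sqrt_inner face_dir_inner) (simp add: face_dir_def flip: power2_eq_square)

lemma polyhedral_angle_eq: "polyhedral_angle N \<theta> = {x. \<forall>j<N. 0 < face_dist N \<theta> j x}"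
proof (intro set_eqI iffI)
  fix x assume "x \<in> polyhedral_angle N \<theta>"
  then obtain r \<phi> z where x: "x = cylindrical r \<phi> z"
    and pos: "\<And>j. j < N \<Longrightarrow> z * sin \<theta> - r * cos \<theta> * cos (\<phi> - real j * (2 * pi / real N)) > 0"
    by (auto simp: polyhedral_angle_def)
  show "x \<in> {x. \<forall>j<N. 0 < face_dist N \<theta> j x}"
    using pos by (auto simp: x face_dist_def face_dir_inner cylindrical_def cos_diff algebra_simps)
next
  fix x assume x: "x \<in> {x. \<forall>j<N. 0 < face_dist N \<theta> j x}"
  define z where "z = Complex (x $ 1) (x $ 2)"
  have "rcis (cmod z) (Arg z) = z"
    by (rule rcis_cmod_Arg)
  then have eq: "x $ 1 = cmod z * cos (Arg z)" "x $ 2 = cmod z * sin (Arg z)"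
    by (auto simp: z_def complex_eq_iff)
  have "x = cylindrical (cmod z) (Arg z) (x $ 3)"
    by (simp add: cylindrical_def vec_eq_iff forall_3 eq[symmetric])
  moreover have "x $ 3 * sin \<theta> - cmod z * cos \<theta> * cos (Arg z - real j * (2 * pi / real N)) = face_dist N \<theta> j x" for j
    by (simp add: face_dist_def face_dir_inner cos_diff eq algebra_simps)
  ultimately show "x \<in> polyhedral_angle N \<theta>"
    using x unfolding polyhedral_angle_def by (intro CollectI exI[of _ "cmod z"] exI[of _ "Arg z"] exI[of _ "x $ 3"]) auto
qed

definition face_normal :: "nat \<Rightarrow> real \<Rightarrow> nat \<Rightarrow> real^3" where
  "face_normal N \<theta> j = sin \<theta> *\<^sub>R axis 3 1 - cos \<theta> *\<^sub>R face_dir N j"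

lemma face_dist_eq: "face_dist N \<theta> j x = face_normal N \<theta> j \<bullet> x"
  by (simp add: face_dist_def face_normal_def inner_diff_left inner_axis' algebra_simps)

lemma face_normal_unit: "face_normal N \<theta> j \<bullet> face_normal N \<theta> j = 1"
proof -
  have "face_dir N j \<bullet> axis 3 1 = 0"
    by (simp add: face_dir_inner axis_def)
  then have "face_normal N \<theta> j \<bullet> face_normal N \<theta> j = (sin \<theta>)\<^sup>2 + (cos \<theta>)\<^sup>2 * (face_dir N j \<bullet> face_dir N j)"
    by (simp add: face_normal_def inner_diff_left inner_diff_right inner_commute[of "axis 3 1"]
        power2_eq_square inner_axis_axis)
  also have "face_dir N j \<bullet> face_dir N j = 1"
    using norm_face_dir[of N j] by (simp add: norm_eq_sqrt_inner)
  finally show ?thesis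
    by simp
qed

lemma face_dist_diff: "face_dist N \<theta> j x - face_dist N \<theta> j y \<le> dist x y"
proof -
  have "face_dist N \<theta> j x - face_dist N \<theta> j y = face_normal N \<theta> j \<bullet> (x - y)"
    by (simp add: face_dist_eq inner_diff_right)
  also have "\<dots> \<le> norm (face_normal N \<theta> j) * norm (x - y)"
    by (rule norm_cauchy_schwarz)
  finally show ?thesis
    by (simp add: norm_eq_sqrt_inner[of "face_normal N \<theta> j"] face_normal_unit dist_norm)
qed

lemma face_foot:
  obtains y where "dist x y = \<bar>face_dist N \<theta> j x\<bar>" and "face_dist N \<theta> j y = 0"
proof
  show "dist x (x - face_dist N \<theta> j x *\<^sub>R face_normal N \<theta> j) = \<bar>face_dist N \<theta> j x\<bar>"
    by (simp add: dist_norm norm_eq_sqrt_inner[of "face_normal N \<theta> j"] face_normal_unit)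
  show "face_dist N \<theta> j (x - face_dist N \<theta> j x *\<^sub>R face_normal N \<theta> j) = 0"
    by (simp add: face_dist_eq inner_diff_right face_normal_unit)
qed

lemma continuous_face_dist: "continuous_on S (face_dist N \<theta> j)"
  unfolding face_dist_def by (intro continuous_intros)

lemma open_polyhedral_angle: "open (polyhedral_angle N \<theta>)"
proof -
  have "polyhedral_angle N \<theta> = (\<Inter>j\<in>{..<N}. {x. 0 < face_dist N \<theta> j x})"
    by (auto simp: polyhedral_angle_eq)
  moreover have "open {x. 0 < face_dist N \<theta> j x}" for j
    by (intro open_Collect_less continuous_face_dist continuous_on_const)
  ultimately show ?thesis
    by (simp add: open_INT)
qed

text \<open>The distance to the boundary of an intersection of half-spaces is the least distance to one of the
bounding planes. The foot of the perpendicular on a plane need not be a boundary point of the angle,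
but it lies outside the open angle, so the segment to it meets the boundary.\<close>

lemma polyhedral_layer_eq:
  assumes "0 < N"
  shows "polyhedral_layer N \<theta> = {x. (\<forall>j<N. 0 < face_dist N \<theta> j x) \<and> (\<exists>j<N. face_dist N \<theta> j x < 1)}"
proof -
  let ?A = "polyhedral_angle N \<theta>"
  have disj: "frontier ?A \<inter> ?A = {}"
    using open_polyhedral_angle by (simp add: frontier_disjoint_eq)
  have near: "\<exists>z\<in>frontier ?A. dist x z \<le> face_dist N \<theta> j x" if x: "x \<in> ?A" and j: "j < N" for x j
  proof -
    obtain y where y: "dist x y = \<bar>face_dist N \<theta> j x\<bar>" "face_dist N \<theta> j y = 0"
      by (rule face_foot)
    have "y \<notin> ?A"
      using y(2) j by (auto simp: polyhedral_angle_eq)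
    then have "closed_segment x y \<inter> frontier ?A \<noteq> {}"
      using x by (intro connected_Int_frontier) auto
    then obtain z where z: "z \<in> closed_segment x y" "z \<in> frontier ?A"
      by blast
    moreover have "dist x z \<le> dist x y"
      using dist_in_closed_segment[OF z(1)] by (simp add: dist_commute)
    moreover have "0 < face_dist N \<theta> j x"
      using x j by (auto simp: polyhedral_angle_eq)
    ultimately show ?thesis
      using y(1) by auto
  qed
  have far: "1 \<le> infdist x (frontier ?A)" if x: "x \<in> ?A" and ge: "\<And>j. j < N \<Longrightarrow> 1 \<le> face_dist N \<theta> j x" for x
  proof -
    have ne: "frontier ?A \<noteq> {}"
      using near[OF x assms] by blast
    show ?thesis
      unfolding infdist_notempty[OF ne]
    proof (rule cINF_greatest[OF ne])
      fix y assume "y \<in> frontier ?A"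
      then have "y \<notin> ?A"
        using disj by blast
      then obtain j where j: "j < N" "face_dist N \<theta> j y \<le> 0"
        by (auto simp: polyhedral_angle_eq not_less)
      then show "1 \<le> dist x y"
        using ge[OF j(1)] face_dist_diff[of N \<theta> j x y] by linarith
    qed
  qed
  show ?thesis
  proof (intro set_eqI iffI)
    fix x assume "x \<in> polyhedral_layer N \<theta>"
    then have x: "x \<in> ?A" "infdist x (frontier ?A) < 1"
      by (auto simp: polyhedral_layer_def)
    then have "\<exists>j<N. face_dist N \<theta> j x < 1"
      using far[OF x(1)] by force
    with x show "x \<in> {x. (\<forall>j<N. 0 < face_dist N \<theta> j x) \<and> (\<exists>j<N. face_dist N \<theta> j x < 1)}"
      by (auto simp: polyhedral_angle_eq)
  next
    fix x assume "x \<in> {x. (\<forall>j<N. 0 < face_dist N \<theta> j x) \<and> (\<exists>j<N. face_dist N \<theta> j x < 1)}"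
    then obtain j where x: "x \<in> ?A" and j: "j < N" "face_dist N \<theta> j x < 1"
      by (auto simp: polyhedral_angle_eq)
    obtain z where z: "z \<in> frontier ?A" "dist x z \<le> face_dist N \<theta> j x"
      using near[OF x j(1)] by blast
    have "infdist x (frontier ?A) \<le> dist x z"
      using z(1) by (rule infdist_le)
    moreover have "0 < infdist x (frontier ?A)"
      using z(1) x disj by (intro infdist_pos_not_in_closed) auto
    ultimately show "x \<in> polyhedral_layer N \<theta>"
      using x z j by (auto simp: polyhedral_layer_def)
  qed
qed

lemma open_polyhedral_layer:
  assumes "0 < N"
  shows "open (polyhedral_layer N \<theta>)"
proof -
  have "polyhedral_layer N \<theta> = polyhedral_angle N \<theta> \<inter> (\<Union>j\<in>{..<N}. {x. face_dist N \<theta> j x < 1})"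
    by (auto simp: polyhedral_layer_eq[OF assms] polyhedral_angle_eq)
  moreover have "open {x. face_dist N \<theta> j x < 1}" for j
    by (intro open_Collect_less continuous_face_dist continuous_on_const)
  ultimately show ?thesis
    using open_polyhedral_angle by (auto intro!: open_Int open_UN)
qed

text \<open>A compact subset of the layer stays away from its inner boundary component, where the least of the face
distances is one. This is the room for replacing the maximum by a soft maximum.\<close>

lemma compact_in_layer_margin:
  assumes "0 < N" and K: "compact K" "K \<subseteq> polyhedral_layer N \<theta>"
  shows "\<exists>\<eta>>0. \<forall>x\<in>K. \<exists>j<N. face_dist N \<theta> j x < 1 - \<eta>"
proof -
  define C where "C n = (\<Union>j\<in>{..<N}. {x. face_dist N \<theta> j x < 1 - 1 / real (Suc n)})" for n
  have "open (C n)" for n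
    unfolding C_def by (intro open_UN ballI open_Collect_less continuous_face_dist continuous_on_const)
  moreover have "K \<subseteq> (\<Union>n. C n)"
  proof
    fix x assume "x \<in> K"
    then obtain j where j: "j < N" "face_dist N \<theta> j x < 1"
      using K(2) by (auto simp: polyhedral_layer_eq[OF assms(1)])
    then obtain n where "1 / real (Suc n) < 1 - face_dist N \<theta> j x"
      using reals_Archimedean[of "1 - face_dist N \<theta> j x"] by (auto simp: inverse_eq_divide)
    then show "x \<in> (\<Union>n. C n)"
      using j by (auto simp: C_def intro!: exI[of _ n] bexI[of _ j])
  qed
  ultimately obtain I where I: "finite I" "K \<subseteq> (\<Union>n\<in>I. C n)"
    using compactE_image[OF K(1), of UNIV C] by (metis iso_tuple_UNIV_I)
  define m where "m = Max (insert 0 I)"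
  have "\<exists>j<N. face_dist N \<theta> j x < 1 - 1 / real (Suc m)" if xK: "x \<in> K" for x
  proof -
    obtain n j where n: "n \<in> I" "j < N" "face_dist N \<theta> j x < 1 - 1 / real (Suc n)"
      using xK I(2) unfolding C_def by blast
    have "n \<le> m"
      using I(1) n(1) by (simp add: m_def)
    then have "1 / real (Suc m) \<le> 1 / real (Suc n)"
      by (intro divide_left_mono) auto
    with n show ?thesis by force
  qed
  then show ?thesis
    by (intro exI[of _ "1 / real (Suc m)"]) auto
qed


section \<open>A smooth maximum\<close>

definition soft_weight :: "nat \<Rightarrow> (nat \<Rightarrow> 'a::euclidean_space) \<Rightarrow> real \<Rightarrow> nat \<Rightarrow> 'a \<Rightarrow> real" where
  "soft_weight N e \<epsilon> j p = exp ((e j \<bullet> p) / \<epsilon>) / (\<Sum>i<N. exp ((e i \<bullet> p) / \<epsilon>))"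

text \<open>This exceeds the maximum of the \<open>e j \<bullet> p\<close> by at most \<open>\<epsilon> ln N\<close>, and its gradient is the convex combination
of the vectors \<open>e j\<close> with the coefficients \<open>soft_weight\<close>.\<close>

definition soft_max :: "nat \<Rightarrow> (nat \<Rightarrow> 'a::euclidean_space) \<Rightarrow> real \<Rightarrow> 'a \<Rightarrow> real" where
  "soft_max N e \<epsilon> p = \<epsilon> * ln (\<Sum>j<N. exp ((e j \<bullet> p) / \<epsilon>))"

lemma soft_sum_pos: "0 < (N :: nat) \<Longrightarrow> 0 < (\<Sum>i<N. exp ((e i \<bullet> p) / \<epsilon>))"
  by (intro sum_pos) auto

lemma soft_weight_nonneg: "0 \<le> soft_weight N e \<epsilon> j p"
  by (auto simp: soft_weight_def intro!: divide_nonneg_nonneg sum_nonneg)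

lemma soft_weight_sum: "0 < N \<Longrightarrow> (\<Sum>j<N. soft_weight N e \<epsilon> j p) = 1"
  using soft_sum_pos[of N e p \<epsilon>] by (simp add: soft_weight_def flip: sum_divide_distrib)

lemma soft_max_ge:
  assumes "0 < \<epsilon>" and "j < N"
  shows "e j \<bullet> p \<le> soft_max N e \<epsilon> p"
proof -
  have "(e j \<bullet> p) / \<epsilon> = ln (exp ((e j \<bullet> p) / \<epsilon>))"
    by simp
  also have "\<dots> \<le> ln (\<Sum>j<N. exp ((e j \<bullet> p) / \<epsilon>))"
    using assms by (subst ln_le_cancel_iff) (auto intro!: soft_sum_pos member_le_sum)
  finally show ?thesis
    using assms(1) by (simp add: soft_max_def field_simps)
qed

lemma soft_max_le:
  assumes "0 < \<epsilon>" and "0 < N" and le: "\<And>j. j < N \<Longrightarrow> e j \<bullet> p \<le> m"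
  shows "soft_max N e \<epsilon> p \<le> m + \<epsilon> * ln (real N)"
proof -
  have "(\<Sum>j<N. exp ((e j \<bullet> p) / \<epsilon>)) \<le> (\<Sum>j<N. exp (m / \<epsilon>))"
    using le assms(1) by (intro sum_mono) (auto simp: divide_right_mono)
  then have "ln (\<Sum>j<N. exp ((e j \<bullet> p) / \<epsilon>)) \<le> ln (real N * exp (m / \<epsilon>))"
    using assms(2) soft_sum_pos[OF assms(2), of e p \<epsilon>] by (subst ln_le_cancel_iff) auto
  also have "\<dots> = ln (real N) + m / \<epsilon>"
    using assms(2) by (subst ln_mult) auto
  finally have "\<epsilon> * ln (\<Sum>j<N. exp ((e j \<bullet> p) / \<epsilon>)) \<le> \<epsilon> * (ln (real N) + m / \<epsilon>)"
    using assms(1) by (intro mult_left_mono) auto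
  then show ?thesis
    using assms(1) by (simp add: soft_max_def algebra_simps)
qed

lemma soft_max_has_derivative:
  assumes "0 < \<epsilon>" and "0 < N"
  shows "(soft_max N e \<epsilon> has_derivative (\<lambda>h. \<Sum>j<N. soft_weight N e \<epsilon> j p * (e j \<bullet> h))) (at p)"
proof -
  let ?S = "\<Sum>i<N. exp ((e i \<bullet> p) / \<epsilon>)"
  have S: "?S > 0"
    using assms(2) by (rule soft_sum_pos)
  have "((\<lambda>p. \<epsilon> * ln (\<Sum>j<N. exp ((e j \<bullet> p) / \<epsilon>))) has_derivative
      (\<lambda>h. \<epsilon> * ((\<Sum>j<N. exp ((e j \<bullet> p) / \<epsilon>) * ((e j \<bullet> h) / \<epsilon>)) * inverse ?S))) (at p)"
    using S assms(1) by (auto intro!: derivative_eq_intros simp: field_simps)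
  moreover have "\<epsilon> * ((\<Sum>j<N. exp ((e j \<bullet> p) / \<epsilon>) * ((e j \<bullet> h) / \<epsilon>)) * inverse ?S)
      = (\<Sum>j<N. soft_weight N e \<epsilon> j p * (e j \<bullet> h))" for h
    unfolding sum_distrib_left sum_distrib_right
    using assms(1) by (intro sum.cong refl) (simp add: soft_weight_def divide_inverse mult_ac)
  ultimately show ?thesis
    by (simp add: soft_max_def[abs_def])
qed

lemma soft_weight_has_derivative:
  assumes "0 < \<epsilon>" and "0 < N"
  shows "(soft_weight N e \<epsilon> j has_derivative
    (\<lambda>h. soft_weight N e \<epsilon> j p * ((e j \<bullet> h) / \<epsilon> - (\<Sum>i<N. soft_weight N e \<epsilon> i p * ((e i \<bullet> h) / \<epsilon>))))) (at p)"
proof -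
  let ?S = "\<Sum>i<N. exp ((e i \<bullet> p) / \<epsilon>)"
  have S: "?S > 0"
    using assms(2) by (rule soft_sum_pos)
  have S': "((\<lambda>p. \<Sum>i<N. exp ((e i \<bullet> p) / \<epsilon>)) has_derivative (\<lambda>h. \<Sum>i<N. exp ((e i \<bullet> p) / \<epsilon>) * ((e i \<bullet> h) / \<epsilon>))) (at p)"
    using assms(1) by (auto intro!: derivative_eq_intros simp: field_simps)
  have E': "((\<lambda>p. exp ((e j \<bullet> p) / \<epsilon>)) has_derivative (\<lambda>h. exp ((e j \<bullet> p) / \<epsilon>) * ((e j \<bullet> h) / \<epsilon>))) (at p)"
    using assms(1) by (auto intro!: derivative_eq_intros simp: field_simps)
  have "((\<lambda>p. exp ((e j \<bullet> p) / \<epsilon>) / (\<Sum>i<N. exp ((e i \<bullet> p) / \<epsilon>))) has_derivative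
      (\<lambda>h. (exp ((e j \<bullet> p) / \<epsilon>) * ((e j \<bullet> h) / \<epsilon>) * ?S
        - exp ((e j \<bullet> p) / \<epsilon>) * (\<Sum>i<N. exp ((e i \<bullet> p) / \<epsilon>) * ((e i \<bullet> h) / \<epsilon>))) / (?S * ?S))) (at p)"
    using S by (intro has_derivative_divide'[OF E' S']) auto
  moreover have "(exp ((e j \<bullet> p) / \<epsilon>) * ((e j \<bullet> h) / \<epsilon>) * ?S
        - exp ((e j \<bullet> p) / \<epsilon>) * (\<Sum>i<N. exp ((e i \<bullet> p) / \<epsilon>) * ((e i \<bullet> h) / \<epsilon>))) / (?S * ?S)
      = soft_weight N e \<epsilon> j p * ((e j \<bullet> h) / \<epsilon> - (\<Sum>i<N. soft_weight N e \<epsilon> i p * ((e i \<bullet> h) / \<epsilon>)))" for h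
  proof -
    have eq: "(\<Sum>i<N. soft_weight N e \<epsilon> i p * ((e i \<bullet> h) / \<epsilon>)) = (\<Sum>i<N. exp ((e i \<bullet> p) / \<epsilon>) * ((e i \<bullet> h) / \<epsilon>)) / ?S"
      by (simp add: soft_weight_def sum_divide_distrib mult_ac)
    have quotient: "(E * w * S - E * X) / (S * S) = E / S * (w - X / S)" if "S > 0" for E w S X :: real
      using that by (simp add: field_simps)
    show ?thesis
      unfolding eq unfolding soft_weight_def by (rule quotient[OF S])
  qed
  ultimately show ?thesis
    by (simp add: soft_weight_def[abs_def])
qed

text \<open>The derivatives of the weights are polynomials in the weights, so induction on the order of
differentiability works for all weights simultaneously.\<close>

lemma smooth_soft_weight:
  assumes "0 < \<epsilon>" and "0 < N"
  shows "smooth (\<lambda>p. complex_of_real (soft_weight N e \<epsilon> j p))"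
proof -
  have d: "((\<lambda>p. complex_of_real (soft_weight N e \<epsilon> j p)) has_derivative
    (\<lambda>h. complex_of_real (soft_weight N e \<epsilon> j p * ((e j \<bullet> h) / \<epsilon> - (\<Sum>i<N. soft_weight N e \<epsilon> i p * ((e i \<bullet> h) / \<epsilon>)))))) (at p)" for j p
    using assms by (intro has_derivative_of_real soft_weight_has_derivative)
  have "k_times_cont_diff k (\<lambda>p. complex_of_real (soft_weight N e \<epsilon> j p))" for k
  proof (induction k arbitrary: j)
    case 0
    show ?case
      unfolding k_times_cont_diff.simps
      using d has_derivative_continuous by (intro continuous_at_imp_continuous_on ballI) blast
  next
    case (Suc k)
    have "partial_deriv b (\<lambda>p. complex_of_real (soft_weight N e \<epsilon> j p)) =
      (\<lambda>p. complex_of_real (soft_weight N e \<epsilon> j p) * (complex_of_real ((e j \<bullet> b) / \<epsilon>) +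
        (\<Sum>i<N. complex_of_real (soft_weight N e \<epsilon> i p) * complex_of_real (- ((e i \<bullet> b) / \<epsilon>)))))" for b
      using has_derivative_partial_deriv[OF d] by (auto simp: fun_eq_iff sum_negf)
    moreover have "k_times_cont_diff k (\<lambda>p. complex_of_real (soft_weight N e \<epsilon> j p) * (complex_of_real ((e j \<bullet> b) / \<epsilon>) +
        (\<Sum>i<N. complex_of_real (soft_weight N e \<epsilon> i p) * complex_of_real (- ((e i \<bullet> b) / \<epsilon>)))))" for b
      by (intro k_times_cont_diff_mult k_times_cont_diff_add k_times_cont_diff_sum k_times_cont_diff_const Suc.IH)
    moreover have "(\<lambda>p. complex_of_real (soft_weight N e \<epsilon> j p)) differentiable (at p)" for p
      using d by (auto simp: differentiable_def)
    ultimately show ?case by auto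
  qed
  then show ?thesis
    by (simp add: smooth_def)
qed

lemma smooth_soft_max:
  assumes "0 < \<epsilon>" and "0 < N"
  shows "smooth (\<lambda>p. complex_of_real (soft_max N e \<epsilon> p))"
proof (rule smoothI)
  have d: "((\<lambda>p. complex_of_real (soft_max N e \<epsilon> p)) has_derivative
    (\<lambda>h. complex_of_real (\<Sum>j<N. soft_weight N e \<epsilon> j p * (e j \<bullet> h)))) (at p)" for p
    using assms by (intro has_derivative_of_real soft_max_has_derivative)
  show "(\<lambda>p. complex_of_real (soft_max N e \<epsilon> p)) differentiable (at p)" for p
    using d by (auto simp: differentiable_def)
  have "partial_deriv b (\<lambda>p. complex_of_real (soft_max N e \<epsilon> p)) =
      (\<lambda>p. \<Sum>j<N. complex_of_real (soft_weight N e \<epsilon> j p) * complex_of_real (e j \<bullet> b))" for b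
    using has_derivative_partial_deriv[OF d] by (auto simp: fun_eq_iff)
  moreover have "smooth (\<lambda>p. \<Sum>j<N. complex_of_real (soft_weight N e \<epsilon> j p) * complex_of_real (e j \<bullet> b))" for b
    using assms by (intro smooth_sum smooth_mult smooth_soft_weight smooth_const)
  ultimately show "smooth (partial_deriv b (\<lambda>p. complex_of_real (soft_max N e \<epsilon> p)))" for b
    by simp
qed


section \<open>Transplantation between layers\<close>

text \<open>With \<open>D = c\<^sup>2 - C\<^sup>2\<close> the difference of the two sides is \<open>D / c\<^sup>2\<close> times
\<open>(x + (C / S) g1 z)\<^sup>2 + (y + (C / S) g2 z)\<^sup>2 + (c\<^sup>2 / S\<^sup>2) z\<^sup>2 (1 - g1\<^sup>2 - g2\<^sup>2)\<close>. In the application \<open>c, s\<close> and \<open>C, S\<close> are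
the cosine and sine of the smaller and the larger angle, \<open>(x, y, z)\<close> is a gradient in the layer of the
larger angle, and \<open>(g1, g2)\<close> is the gradient of the soft maximum.\<close>

lemma form_comparison_real:
  fixes c C s S g1 g2 x y z :: real
  assumes "s\<^sup>2 + c\<^sup>2 = 1" and "S\<^sup>2 + C\<^sup>2 = 1" and "0 < c" and "0 < S" and "C\<^sup>2 \<le> c\<^sup>2" and g: "g1\<^sup>2 + g2\<^sup>2 \<le> 1"
  shows "((C/c) * x + ((C\<^sup>2 - c\<^sup>2)/(c*S)) * g1 * z)\<^sup>2 + ((C/c) * y + ((C\<^sup>2 - c\<^sup>2)/(c*S)) * g2 * z)\<^sup>2 + ((s/S) * z)\<^sup>2
    \<le> x\<^sup>2 + y\<^sup>2 + z\<^sup>2"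
proof -
  define D where "D = c\<^sup>2 - C\<^sup>2"
  have s: "s\<^sup>2 = 1 - c\<^sup>2" "c\<^sup>2 = C\<^sup>2 + D" "S\<^sup>2 = 1 - C\<^sup>2"
    using assms(1,2) by (auto simp: D_def)
  define u v w where "u = (C/c) * x + ((C\<^sup>2 - c\<^sup>2)/(c*S)) * g1 * z"
    and "v = (C/c) * y + ((C\<^sup>2 - c\<^sup>2)/(c*S)) * g2 * z" and "w = (s/S) * z"
  have uvw: "(c * S) * u = S * C * x - D * g1 * z" "(c * S) * v = S * C * y - D * g2 * z" "(c * S) * w = c * s * z"
    using assms(3,4) by (simp_all add: u_def v_def w_def D_def field_simps)
  have "(c * S)\<^sup>2 * (u\<^sup>2 + v\<^sup>2 + w\<^sup>2) = ((c * S) * u)\<^sup>2 + ((c * S) * v)\<^sup>2 + ((c * S) * w)\<^sup>2"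
    by (simp add: power_mult_distrib distrib_left)
  also have "\<dots> = (S * C * x - D * g1 * z)\<^sup>2 + (S * C * y - D * g2 * z)\<^sup>2 + (c * s * z)\<^sup>2"
    unfolding uvw ..
  also have "\<dots> = S\<^sup>2 * C\<^sup>2 * (x\<^sup>2 + y\<^sup>2) - 2 * S * C * D * z * (g1 * x + g2 * y) + D\<^sup>2 * (g1\<^sup>2 + g2\<^sup>2) * z\<^sup>2 + c\<^sup>2 * s\<^sup>2 * z\<^sup>2"
    by (simp add: power2_eq_square algebra_simps)
  also have "\<dots> = (c * S)\<^sup>2 * (x\<^sup>2 + y\<^sup>2 + z\<^sup>2)
      - D * ((S * x + C * g1 * z)\<^sup>2 + (S * y + C * g2 * z)\<^sup>2 + c\<^sup>2 * z\<^sup>2 * (1 - (g1\<^sup>2 + g2\<^sup>2)))"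
  proof -
    have e1: "(c * S)\<^sup>2 = (C\<^sup>2 + D) * S\<^sup>2"
      by (simp add: power_mult_distrib s(2))
    have e2: "(S * x + C * g1 * z)\<^sup>2 + (S * y + C * g2 * z)\<^sup>2 =
        S\<^sup>2 * (x\<^sup>2 + y\<^sup>2) + 2 * S * C * z * (g1 * x + g2 * y) + C\<^sup>2 * (g1\<^sup>2 + g2\<^sup>2) * z\<^sup>2"
      by (simp add: power2_eq_square algebra_simps)
    have e3: "c\<^sup>2 * s\<^sup>2 = (C\<^sup>2 + D) * (S\<^sup>2 - D)"
      unfolding s(1) by (simp add: s(2,3))
    show ?thesis
      unfolding e1 e2 e3 unfolding s(2) by (simp add: power2_eq_square algebra_simps)
  qed
  also have "\<dots> \<le> (c * S)\<^sup>2 * (x\<^sup>2 + y\<^sup>2 + z\<^sup>2)"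
  proof -
    have "0 \<le> D * ((S * x + C * g1 * z)\<^sup>2 + (S * y + C * g2 * z)\<^sup>2 + c\<^sup>2 * z\<^sup>2 * (1 - (g1\<^sup>2 + g2\<^sup>2)))"
      using assms(5) g by (intro mult_nonneg_nonneg add_nonneg_nonneg) (auto simp: D_def)
    then show ?thesis by simp
  qed
  finally have "u\<^sup>2 + v\<^sup>2 + w\<^sup>2 \<le> x\<^sup>2 + y\<^sup>2 + z\<^sup>2"
    using assms(3,4) by simp
  then show ?thesis
    by (simp add: u_def v_def w_def)
qed

lemma sum_Basis_3: "(\<Sum>b\<in>(Basis :: (real^3) set). f b) = f (axis 1 1) + f (axis 2 1) + f (axis 3 1)"
proof -
  have B: "(Basis :: (real^3) set) = (\<lambda>i. axis i 1) ` UNIV"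
    by (auto simp: Basis_vec_def)
  have "(\<Sum>b\<in>(Basis :: (real^3) set). f b) = (\<Sum>i\<in>UNIV. f (axis i 1))"
    unfolding B by (subst sum.reindex) (auto simp: inj_on_def axis_eq_axis)
  then show ?thesis
    by (simp add: sum_3)
qed

lemma in_Basis_3: "b \<in> (Basis :: (real^3) set) \<longleftrightarrow> b = axis 1 1 \<or> b = axis 2 1 \<or> b = axis 3 1"
  by (auto simp: Basis_vec_def) (metis exhaust_3)

text \<open>Functions are transplanted from the layer of \<open>\<sigma>\<close> to the layer of \<open>\<theta>\<close> by composition with \<open>layer_map\<close>, which
maps in the opposite direction.\<close>

locale transplantation =
  fixes N :: nat and \<theta> \<sigma> \<epsilon> :: real
  assumes N: "0 < N" and \<theta>: "0 < \<theta>" and \<theta>\<sigma>: "\<theta> < \<sigma>" and \<sigma>: "\<sigma> < pi / 2" and \<epsilon>: "0 < \<epsilon>"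
begin

definition \<kappa> where "\<kappa> = cos \<sigma> / cos \<theta>"
definition \<alpha> where "\<alpha> = sin \<theta> / sin \<sigma>"
definition \<beta> where "\<beta> = ((cos \<sigma>)\<^sup>2 - (cos \<theta>)\<^sup>2) / (cos \<theta> * sin \<sigma>)"

lemma trig: "0 < cos \<theta>" "0 < cos \<sigma>" "0 < sin \<theta>" "0 < sin \<sigma>" "cos \<sigma> < cos \<theta>"
  using \<theta> \<theta>\<sigma> \<sigma> by (auto intro!: cos_gt_zero sin_gt_zero cos_monotone_0_pi)

lemma cos_sq_le: "(cos \<sigma>)\<^sup>2 \<le> (cos \<theta>)\<^sup>2"
  using trig by (intro power_mono) auto

lemma pos: "0 < \<kappa>" "0 < \<alpha>"
  using trig by (auto simp: \<kappa>_def \<alpha>_def)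

abbreviation smax :: "real^3 \<Rightarrow> real" where "smax \<equiv> soft_max N (face_dir N) \<epsilon>"

abbreviation weight :: "nat \<Rightarrow> real^3 \<Rightarrow> real" where "weight \<equiv> soft_weight N (face_dir N) \<epsilon>"

text \<open>The point with the same flattened coordinates as \<open>p\<close> in the layer of the other angle: its horizontal part
is that of \<open>p\<close> times \<open>\<kappa>\<close>, and its height \<open>z'\<close> solves
\<open>z' sin \<sigma> - \<kappa> smax p cos \<sigma> = z sin \<theta> - smax p cos \<theta>\<close>, where \<open>z\<close> is the height of \<open>p\<close>.\<close>

definition layer_map :: "real^3 \<Rightarrow> real^3" where
  "layer_map p = (\<kappa> * p $ 1) *\<^sub>R axis 1 1 + (\<kappa> * p $ 2) *\<^sub>R axis 2 1 + (\<alpha> * p $ 3 + \<beta> * smax p) *\<^sub>R axis 3 1"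

definition layer_map_inv :: "real^3 \<Rightarrow> real^3" where
  "layer_map_inv q = (q $ 1 / \<kappa>) *\<^sub>R axis 1 1 + (q $ 2 / \<kappa>) *\<^sub>R axis 2 1
     + ((q $ 3 - \<beta> * smax ((1 / \<kappa>) *\<^sub>R q)) / \<alpha>) *\<^sub>R axis 3 1"

lemma layer_map_nth:
  "layer_map p $ 1 = \<kappa> * p $ 1" "layer_map p $ 2 = \<kappa> * p $ 2" "layer_map p $ 3 = \<alpha> * p $ 3 + \<beta> * smax p"
  by (simp_all add: layer_map_def axis_def)

lemma layer_map_inv_nth:
  "layer_map_inv q $ 1 = q $ 1 / \<kappa>" "layer_map_inv q $ 2 = q $ 2 / \<kappa>"
  "layer_map_inv q $ 3 = (q $ 3 - \<beta> * smax ((1 / \<kappa>) *\<^sub>R q)) / \<alpha>"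
  by (simp_all add: layer_map_inv_def axis_def)

lemma smax_cong:
  assumes "p $ 1 = q $ 1" and "p $ 2 = q $ 2"
  shows "smax p = smax q"
  using assms by (simp add: soft_max_def face_dir_inner)

lemma layer_map_inverse: "layer_map_inv (layer_map p) = p" "layer_map (layer_map_inv q) = q"
proof -
  have "smax ((1 / \<kappa>) *\<^sub>R layer_map p) = smax p"
    using pos by (intro smax_cong) (simp_all add: layer_map_nth)
  then show "layer_map_inv (layer_map p) = p"
    using pos by (simp add: vec_eq_iff forall_3 layer_map_nth layer_map_inv_nth)
  have "smax (layer_map_inv q) = smax ((1 / \<kappa>) *\<^sub>R q)"
    by (intro smax_cong) (simp_all add: layer_map_inv_nth)
  then show "layer_map (layer_map_inv q) = q"
    using pos by (simp add: vec_eq_iff forall_3 layer_map_nth layer_map_inv_nth)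
qed

lemma continuous_smax: "continuous_on S smax"
  using soft_max_has_derivative[OF \<epsilon> N] has_derivative_continuous
  by (intro continuous_at_imp_continuous_on ballI) blast

lemma continuous_layer_map: "continuous_on S layer_map"
  unfolding layer_map_def by (intro continuous_intros continuous_smax)

lemma continuous_layer_map_inv: "continuous_on S layer_map_inv"
proof -
  have "continuous_on S (\<lambda>q. smax ((1 / \<kappa>) *\<^sub>R q))"
    by (rule continuous_on_compose2[OF continuous_smax[of UNIV]]) (auto intro: continuous_intros)
  then show ?thesis
    unfolding layer_map_inv_def using pos by (intro continuous_intros) auto
qed

lemma face_dist_layer_map:
  "face_dist N \<sigma> j (layer_map p) =
     face_dist N \<theta> j p - (((cos \<theta>)\<^sup>2 - (cos \<sigma>)\<^sup>2) / cos \<theta>) * (smax p - face_dir N j \<bullet> p)"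
proof -
  have "face_dir N j \<bullet> layer_map p = \<kappa> * (face_dir N j \<bullet> p)"
    by (simp add: face_dir_inner layer_map_nth algebra_simps)
  then show ?thesis
    using trig by (simp add: face_dist_def layer_map_nth \<kappa>_def \<alpha>_def \<beta>_def field_simps power2_eq_square)
qed

text \<open>The soft maximum exceeds every \<open>face_dir N j \<bullet> p\<close>, so all face distances at \<open>p\<close> are at least those at the
image and stay positive. It exceeds the largest one by at most \<open>\<epsilon> ln N\<close>, so the least face distance
at \<open>p\<close> is larger than that at the image by at most \<open>\<eta>\<close>.\<close>

lemma layer_map_preimage:
  assumes q: "layer_map p \<in> polyhedral_layer N \<sigma>" and j: "j < N" "face_dist N \<sigma> j (layer_map p) < 1 - \<eta>"
    and small: "(((cos \<theta>)\<^sup>2 - (cos \<sigma>)\<^sup>2) / cos \<theta>) * (\<epsilon> * ln (real N)) \<le> \<eta>"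
  shows "p \<in> polyhedral_layer N \<theta>"
proof -
  define \<delta> where "\<delta> = ((cos \<theta>)\<^sup>2 - (cos \<sigma>)\<^sup>2) / cos \<theta>"
  have \<delta>: "0 \<le> \<delta>"
    using cos_sq_le trig by (simp add: \<delta>_def)
  have "0 < face_dist N \<theta> i p" if "i < N" for i
  proof -
    have "0 < face_dist N \<sigma> i (layer_map p)"
      using q that by (simp add: polyhedral_layer_eq[OF N])
    moreover have "0 \<le> \<delta> * (smax p - face_dir N i \<bullet> p)"
      using \<delta> soft_max_ge[OF \<epsilon> that, of "face_dir N" p] by simp
    ultimately show ?thesis
      by (simp add: face_dist_layer_map \<delta>_def)
  qed
  moreover have "\<exists>i<N. face_dist N \<theta> i p < 1"
  proof -
    \<comment> \<open>attained at the face nearest to \<open>p\<close>, which is also the face nearest to the image\<close>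
    define m where "m = Max ((\<lambda>l. face_dir N l \<bullet> p) ` {..<N})"
    have "m \<in> (\<lambda>l. face_dir N l \<bullet> p) ` {..<N}"
      unfolding m_def using N by (intro Max_in) auto
    moreover have "face_dir N l \<bullet> p \<le> m" if "l < N" for l
      unfolding m_def using that by (intro Max_ge) auto
    ultimately obtain i where i: "i < N" "\<And>l. l < N \<Longrightarrow> face_dir N l \<bullet> p \<le> face_dir N i \<bullet> p"
      by auto
    have "\<delta> * (smax p - face_dir N i \<bullet> p) \<le> \<delta> * (\<epsilon> * ln (real N))"
      using \<delta> soft_max_le[of \<epsilon> N "face_dir N" p, OF \<epsilon> N i(2)] by (intro mult_left_mono) auto
    then have "face_dist N \<theta> i p \<le> face_dist N \<sigma> i (layer_map p) + \<eta>"
      using small by (simp add: face_dist_layer_map \<delta>_def)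
    also have "face_dist N \<sigma> i (layer_map p) \<le> face_dist N \<sigma> j (layer_map p)"
    proof -
      have "face_dir N l \<bullet> layer_map p = \<kappa> * (face_dir N l \<bullet> p)" for l
        by (simp add: face_dir_inner layer_map_nth algebra_simps)
      then show ?thesis
        using i(2)[OF j(1)] pos trig by (simp add: face_dist_def)
    qed
    finally show ?thesis
      using i(1) j(2) by (intro exI[of _ i]) simp
  qed
  ultimately show ?thesis
    by (simp add: polyhedral_layer_eq[OF N])
qed

text \<open>The gradient of the soft maximum.\<close>

definition slope :: "real^3 \<Rightarrow> real^3" where
  "slope p = (\<Sum>j<N. weight j p *\<^sub>R face_dir N j)"

lemma slope_3: "slope p $ 3 = 0"
  by (simp add: slope_def face_dir_def)

lemma slope_le: "(slope p $ 1)\<^sup>2 + (slope p $ 2)\<^sup>2 \<le> 1"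
proof -
  have "norm (slope p) \<le> (\<Sum>j<N. norm (weight j p *\<^sub>R face_dir N j))"
    unfolding slope_def by (rule norm_sum)
  also have "\<dots> = (\<Sum>j<N. weight j p)"
    by (simp add: norm_face_dir soft_weight_nonneg)
  also have "\<dots> = 1"
    by (rule soft_weight_sum[OF N])
  finally have "(norm (slope p))\<^sup>2 \<le> 1\<^sup>2"
    by (intro power_mono) auto
  then show ?thesis
    by (simp add: power2_norm_eq_inner inner_vec_def sum_3 slope_3) (simp add: power2_eq_square)
qed

definition layer_map_deriv :: "real^3 \<Rightarrow> real^3 \<Rightarrow> real^3" where
  "layer_map_deriv p h = (\<kappa> * h $ 1) *\<^sub>R axis 1 1 + (\<kappa> * h $ 2) *\<^sub>R axis 2 1
     + (\<alpha> * h $ 3 + \<beta> * (slope p \<bullet> h)) *\<^sub>R axis 3 1"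

lemma layer_map_has_derivative: "(layer_map has_derivative layer_map_deriv p) (at p within S)"
proof -
  have "(smax has_derivative (\<lambda>h. slope p \<bullet> h)) (at p within S)"
    using soft_max_has_derivative[OF \<epsilon> N, of "face_dir N" p]
    by (simp add: slope_def inner_sum_left has_derivative_at_withinI)
  moreover have "((\<lambda>p. p $ i) has_derivative (\<lambda>h. h $ i)) (at p within S)" for i :: 3
    by (rule bounded_linear.has_derivative[OF bounded_linear_vec_nth]) (rule has_derivative_ident)
  ultimately show ?thesis
    unfolding layer_map_def[abs_def] layer_map_deriv_def[abs_def]
    by (intro derivative_intros)
qed

lemma layer_map_det: "det (matrix (layer_map_deriv p)) = \<kappa>\<^sup>2 * \<alpha>"
proof -
  have "slope p \<bullet> axis 3 1 = 0"
    by (simp add: inner_axis slope_3)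
  then show ?thesis
    by (simp add: det_3 matrix_def layer_map_deriv_def axis_def power2_eq_square)
qed

lemma integral_layer_map:
  fixes k :: "real^3 \<Rightarrow> real"
  assumes k: "continuous_on UNIV k" and K: "compact K" "\<And>x. x \<notin> K \<Longrightarrow> k x = 0"
  shows "\<kappa>\<^sup>2 * \<alpha> * (\<integral>p. k (layer_map p) \<partial>lborel) = (\<integral>q. k q \<partial>lborel)"
proof -
  define J where "J = \<kappa>\<^sup>2 * \<alpha>"
  have J: "0 < J"
    using pos by (simp add: J_def)
  have surj: "range layer_map = UNIV"
    using layer_map_inverse(2) by (metis surjI)
  have inj: "inj layer_map"
    using layer_map_inverse(1) by (metis injI)
  have int_k: "integrable lborel k"
    using k K by (intro integrable_compact_support[of k K]) auto
  have kl: "continuous_on UNIV (\<lambda>p. J * k (layer_map p))"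
    by (intro continuous_intros continuous_on_compose2[OF k continuous_layer_map]) auto
  have int_kl: "integrable lborel (\<lambda>p. J * k (layer_map p))"
  proof (rule integrable_compact_support[OF kl])
    show "compact (layer_map_inv ` K)"
      using continuous_layer_map_inv K(1) by (intro compact_continuous_image)
    show "J * k (layer_map p) = 0" if "p \<notin> layer_map_inv ` K" for p
      using that K(2)[of "layer_map p"] layer_map_inverse(1)[of p] by (metis image_eqI mult_zero_right)
  qed
  \<comment> \<open>the change of variables formula is one for vector-valued functions\<close>
  define f :: "real^3 \<Rightarrow> real^1" where "f q = vec (k q)" for q
  have "integrable lborel (\<lambda>x. norm (k x))"
    using int_k by (rule integrable_norm)
  then have "k absolutely_integrable_on UNIV"
    unfolding absolutely_integrable_on_def using int_k by (auto intro: integrable_on_lborel)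
  then have "f absolutely_integrable_on range layer_map"
    by (simp add: surj absolutely_integrable_on_1_iff f_def)
  with has_absolute_integral_change_of_variables[where S = UNIV and g = layer_map and g' = layer_map_deriv
      and f = f and b = "integral UNIV f"]
  have "integral UNIV (\<lambda>x. \<bar>det (matrix (layer_map_deriv x))\<bar> *\<^sub>R f (layer_map x)) = integral UNIV f"
    using layer_map_has_derivative inj surj by auto
  then have "integral UNIV (\<lambda>x. J *\<^sub>R f (layer_map x)) $ 1 = integral UNIV f $ 1"
    using J by (simp add: layer_map_det J_def)
  then have "integral UNIV (\<lambda>p. J * k (layer_map p)) = integral UNIV k"
    by (simp add: integral_on_1_eq f_def)
  then show ?thesis
    using integral_lborel[OF int_k] integral_lborel[OF int_kl] by (simp add: J_def)
qed

lemma smooth_layer_map: "i \<in> Basis \<Longrightarrow> smooth (\<lambda>p. complex_of_real (layer_map p \<bullet> i))"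
proof -
  have "smooth (\<lambda>p :: real^3. complex_of_real (\<kappa> * p $ i))" for i
    using smooth_mult[OF smooth_const[of "complex_of_real \<kappa>"] smooth_inner[of "axis i (1::real)"]]
    by (simp add: inner_axis' inner_real_def)
  moreover have "smooth (\<lambda>p. complex_of_real (\<alpha> * p $ 3 + \<beta> * smax p))"
    using smooth_add[OF smooth_mult[OF smooth_const[of "complex_of_real \<alpha>"] smooth_inner[of "axis 3 (1::real) :: real^3"]]
        smooth_mult[OF smooth_const[of "complex_of_real \<beta>"] smooth_soft_max[OF \<epsilon> N]]]
    by (simp add: inner_axis' inner_real_def)
  ultimately show "i \<in> Basis \<Longrightarrow> smooth (\<lambda>p. complex_of_real (layer_map p \<bullet> i))"
    by (auto simp: in_Basis_3 inner_axis layer_map_nth)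
qed

text \<open>The derivative of \<open>layer_map\<close> is real, so \<open>form_comparison_real\<close> applies to the real and the imaginary
parts of the gradient separately.\<close>

lemma gradient_layer_map:
  assumes \<phi>: "smooth \<phi>"
  shows "(\<Sum>b\<in>Basis. (cmod (partial_deriv b (\<lambda>p. \<phi> (layer_map p)) p))\<^sup>2)
    \<le> (\<Sum>b\<in>Basis. (cmod (partial_deriv b \<phi> (layer_map p)))\<^sup>2)"
proof -
  let ?q = "layer_map p"
  let ?D = "frechet_derivative \<phi> (at ?q)"
  have D: "(\<phi> has_derivative ?D) (at ?q)"
    using \<phi> by (intro differentiable_partial_deriv smooth_differentiable)
  interpret lin: linear ?D
    using has_derivative_linear[OF D] .
  have P: "partial_deriv b (\<lambda>p. \<phi> (layer_map p)) p = ?D (layer_map_deriv p b)" for b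
    using has_derivative_partial_deriv[OF has_derivative_compose[OF layer_map_has_derivative D]] .
  define X Y Z where "X = partial_deriv (axis 1 1) \<phi> ?q" and "Y = partial_deriv (axis 2 1) \<phi> ?q"
    and "Z = partial_deriv (axis 3 1) \<phi> ?q"
  define g1 g2 where "g1 = slope p $ 1" and "g2 = slope p $ 2"
  have "layer_map_deriv p (axis 1 1) = \<kappa> *\<^sub>R axis 1 1 + (\<beta> * g1) *\<^sub>R axis 3 1"
    "layer_map_deriv p (axis 2 1) = \<kappa> *\<^sub>R axis 2 1 + (\<beta> * g2) *\<^sub>R axis 3 1"
    "layer_map_deriv p (axis 3 1) = \<alpha> *\<^sub>R axis 3 1"
    by (simp_all add: layer_map_deriv_def inner_axis slope_3 g1_def g2_def) (simp_all add: axis_def)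
  then have P123: "partial_deriv (axis 1 1) (\<lambda>p. \<phi> (layer_map p)) p = \<kappa> *\<^sub>R X + (\<beta> * g1) *\<^sub>R Z"
    "partial_deriv (axis 2 1) (\<lambda>p. \<phi> (layer_map p)) p = \<kappa> *\<^sub>R Y + (\<beta> * g2) *\<^sub>R Z"
    "partial_deriv (axis 3 1) (\<lambda>p. \<phi> (layer_map p)) p = \<alpha> *\<^sub>R Z"
    unfolding P by (simp_all add: lin.add lin.scale X_def Y_def Z_def partial_deriv_def)
  have "(\<kappa> * x + \<beta> * g1 * z)\<^sup>2 + (\<kappa> * y + \<beta> * g2 * z)\<^sup>2 + (\<alpha> * z)\<^sup>2 \<le> x\<^sup>2 + y\<^sup>2 + z\<^sup>2" for x y z
    unfolding \<kappa>_def \<beta>_def \<alpha>_def using trig cos_sq_le slope_le[of p]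
    by (intro form_comparison_real) (auto simp: g1_def g2_def)
  from this[of "Re X" "Re Z" "Re Y"] this[of "Im X" "Im Z" "Im Y"] show ?thesis
    unfolding sum_Basis_3 P123 X_def[symmetric] Y_def[symmetric] Z_def[symmetric]
    by (simp add: cmod_power2 mult.assoc del: norm_scaleR)
qed

lemma layer_map_test:
  assumes \<phi>: "smooth \<phi>" and K: "compact K" "K \<subseteq> polyhedral_layer N \<sigma>" "\<And>x. x \<notin> K \<Longrightarrow> \<phi> x = 0"
    and margin: "\<And>q. q \<in> K \<Longrightarrow> \<exists>j<N. face_dist N \<sigma> j q < 1 - \<eta>"
    and small: "(((cos \<theta>)\<^sup>2 - (cos \<sigma>)\<^sup>2) / cos \<theta>) * (\<epsilon> * ln (real N)) \<le> \<eta>"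
  shows "(\<lambda>p. \<phi> (layer_map p)) \<in> test_functions (polyhedral_layer N \<theta>)"
  unfolding test_functions_iff
proof (intro conjI exI[of _ "layer_map_inv ` K"] allI impI subsetI)
  show "smooth (\<lambda>p. \<phi> (layer_map p))"
    using \<phi> smooth_layer_map by (rule smooth_compose)
  show "compact (layer_map_inv ` K)"
    using continuous_layer_map_inv K(1) by (intro compact_continuous_image)
  show "\<phi> (layer_map p) = 0" if "p \<notin> layer_map_inv ` K" for p
    using that K(3)[of "layer_map p"] layer_map_inverse(1)[of p] by (metis image_eqI)
  show "p \<in> polyhedral_layer N \<theta>" if "p \<in> layer_map_inv ` K" for p
  proof -
    have "layer_map p \<in> K"
      using that layer_map_inverse(2) by auto
    then show ?thesis
      using layer_map_preimage[OF _ _ _ small] margin K(2) by blast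
  qed
qed

lemma transplanted_norm:
  assumes "\<phi> \<in> test_functions \<Omega>"
  shows "\<kappa>\<^sup>2 * \<alpha> * (\<integral>p. (cmod (\<phi> (layer_map p)))\<^sup>2 \<partial>lborel) = (\<integral>q. (cmod (\<phi> q))\<^sup>2 \<partial>lborel)"
proof -
  obtain K where K: "smooth \<phi>" "compact K" "K \<subseteq> \<Omega>" "\<And>x. x \<notin> K \<Longrightarrow> \<phi> x = 0"
    using assms by (auto simp: test_functions_iff)
  show ?thesis
    by (rule integral_layer_map[of _ K]) (use K in \<open>auto intro!: continuous_intros smooth_continuous\<close>)
qed

lemma transplanted_form:
  assumes \<phi>: "\<phi> \<in> test_functions \<Omega>" and \<chi>: "(\<lambda>p. \<phi> (layer_map p)) \<in> test_functions \<Omega>'"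
  shows "\<kappa>\<^sup>2 * \<alpha> * (\<integral>p. (\<Sum>b\<in>Basis. (cmod (partial_deriv b (\<lambda>p. \<phi> (layer_map p)) p))\<^sup>2) \<partial>lborel)
    \<le> (\<integral>q. (\<Sum>b\<in>Basis. (cmod (partial_deriv b \<phi> q))\<^sup>2) \<partial>lborel)"
proof -
  have cont: "continuous_on UNIV (\<lambda>q. \<Sum>b\<in>Basis. (cmod (partial_deriv b f q))\<^sup>2)" if "smooth f" for f :: "real^3 \<Rightarrow> complex"
    using that by (intro continuous_intros smooth_continuous smooth_partial_deriv)
  obtain K where K: "smooth \<phi>" "compact K" "K \<subseteq> \<Omega>" "\<And>x. x \<notin> K \<Longrightarrow> \<phi> x = 0"
    using \<phi> by (auto simp: test_functions_iff)
  have D0: "partial_deriv b \<phi> x = 0" if "x \<notin> K" for x b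
    using partial_deriv_eq_0[OF compact_imp_closed[OF K(2)] K(4) that] .
  obtain L where L: "smooth (\<lambda>p. \<phi> (layer_map p))" "compact L" "\<And>x. x \<notin> L \<Longrightarrow> \<phi> (layer_map x) = 0"
    using \<chi> by (auto simp: test_functions_iff)
  have E0: "partial_deriv b (\<lambda>p. \<phi> (layer_map p)) x = 0" if "x \<notin> L" for x b
    using partial_deriv_eq_0[OF compact_imp_closed[OF L(2)] L(3) that] .
  let ?k = "\<lambda>q. \<Sum>b\<in>Basis. (cmod (partial_deriv b \<phi> q))\<^sup>2"
  have kl: "continuous_on UNIV (\<lambda>p. ?k (layer_map p))"
    by (rule continuous_on_compose2[OF cont[OF K(1)] continuous_layer_map]) auto
  have k0: "?k (layer_map p) = 0" if "p \<notin> layer_map_inv ` K" for p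
  proof -
    have "layer_map p \<notin> K"
      using that layer_map_inverse(1)[of p] by (metis image_eqI)
    then show ?thesis by (simp add: D0)
  qed
  have "(\<integral>p. (\<Sum>b\<in>Basis. (cmod (partial_deriv b (\<lambda>p. \<phi> (layer_map p)) p))\<^sup>2) \<partial>lborel) \<le> (\<integral>p. ?k (layer_map p) \<partial>lborel)"
  proof (rule integral_mono)
    show "integrable lborel (\<lambda>p. \<Sum>b\<in>Basis. (cmod (partial_deriv b (\<lambda>p. \<phi> (layer_map p)) p))\<^sup>2)"
      using cont[OF L(1)] L(2) E0 by (intro integrable_compact_support[of _ L]) auto
    show "integrable lborel (\<lambda>p. ?k (layer_map p))"
      using kl compact_continuous_image[OF continuous_layer_map_inv K(2)] k0 by (rule integrable_compact_support)
  qed (rule gradient_layer_map[OF K(1)])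
  then have "\<kappa>\<^sup>2 * \<alpha> * (\<integral>p. (\<Sum>b\<in>Basis. (cmod (partial_deriv b (\<lambda>p. \<phi> (layer_map p)) p))\<^sup>2) \<partial>lborel)
      \<le> \<kappa>\<^sup>2 * \<alpha> * (\<integral>p. ?k (layer_map p) \<partial>lborel)"
    using pos by (intro mult_left_mono) auto
  also have "\<dots> = (\<integral>q. ?k q \<partial>lborel)"
    using cont[OF K(1)] K(2) by (rule integral_layer_map) (simp add: D0)
  finally show ?thesis .
qed

end


section \<open>Comparison of the eigenvalues\<close>

context form_operator
begin

lemma eigen_value_nonneg:
  assumes e: "orthonormal_eigen I n e ev" and i: "i < n"
  shows "0 \<le> ev i"
proof -
  have T: "(e i, \<lambda>x. complex_of_real (ev i) * e i x) \<in> T" and "ip (e i) (e i) = 1"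
    using e i by (auto simp: orthonormal_eigen_def)
  then have "a (e i) (e i) = ev i" "e i \<in> Q"
    by (auto simp: eigen_iff)
  with nonneg[of "e i"] show ?thesis by simp
qed

lemma eigen_count_ge_imp_nonneg:
  assumes "enat j \<le> eigen_count M T {..t}" and "1 \<le> j"
  shows "0 \<le> t"
proof -
  obtain e ev where e: "orthonormal_eigen {..t} j e ev"
    using orthonormal_eigen_of_count[OF assms(1)] by blast
  then have "ev 0 \<le> t"
    using assms(2) by (auto simp: orthonormal_eigen_def)
  with eigen_value_nonneg[OF e, of 0] assms(2) show ?thesis by simp
qed

lemma nth_eigenvalue_le:
  assumes "1 \<le> j" and "ereal t < essential_threshold M T" and "enat j \<le> eigen_count M T {..t}"
  shows "nth_eigenvalue M T j \<le> t"
  unfolding nth_eigenvalue_def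
  using assms eigen_count_ge_imp_nonneg
  by (intro cInf_lower bdd_belowI[of _ 0]) auto

lemma has_eigenvalues_imp_count:
  assumes "has_eigenvalues_below_threshold M T k" and "j \<le> k" and "1 \<le> j"
  shows "\<exists>t. ereal t < essential_threshold M T \<and> enat j \<le> eigen_count M T {..t}"
proof -
  have count: "enat j \<le> eigen_count M T {t. ereal t < essential_threshold M T}"
    using assms(1,2) unfolding has_eigenvalues_below_threshold_def by (meson enat_ord_simps(1) order_trans)
  obtain F where F: "finite F" "F \<subseteq> {t. ereal t < essential_threshold M T}"
    "enat j \<le> (\<Sum>t\<in>F. eigen_mult M T (complex_of_real t))"
    using eigen_count_geD[OF count] by blast
  have "F \<noteq> {}"
    using F(3) assms(3) by (auto simp: zero_enat_def)
  then have "Max F \<in> F" "F \<subseteq> {..Max F}"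
    using F(1) by auto
  then show ?thesis
    using F eigen_count_geI[OF F(1), of "{..Max F}" M T] by (intro exI[of _ "Max F"]) (auto intro: order_trans)
qed

text \<open>Let \<open>C\<close> be the length of a coefficient vector. Replacing the eigenfunctions by close elements of \<open>D\<close>
changes the norm and the square root of the form by at most \<open>\<rho> C\<close>. The new Rayleigh quotients are therefore
at most \<open>((sqrt t + \<rho>) / (1 - \<rho>))\<^sup>2\<close>, which tends to \<open>t\<close> with \<open>\<rho>\<close>, and a combination can vanish only if
\<open>C = 0\<close>.\<close>

lemma approximate_eigenspace:
  assumes e: "orthonormal_eigen {..t} j e ev" and "0 \<le> t" and "0 < \<delta>"
    and dense: "\<And>u \<eta>. u \<in> Q \<Longrightarrow> 0 < \<eta> \<Longrightarrow> \<exists>\<phi>\<in>D. sqrt (Re (ip (\<lambda>x. u x - \<phi> x) (\<lambda>x. u x - \<phi> x))) \<le> \<eta> \<and>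
      sqrt (Re (a (\<lambda>x. u x - \<phi> x) (\<lambda>x. u x - \<phi> x))) \<le> \<eta>" and D: "D \<subseteq> Q"
  shows "\<exists>\<phi>. (\<forall>i<j. \<phi> i \<in> D) \<and> L2_independent M j \<phi> \<and>
    (\<forall>c v. v = (\<lambda>x. \<Sum>i<j. c i * \<phi> i x) \<longrightarrow> Re (a v v) \<le> (t + \<delta>) * Re (ip v v))"
proof -
  have eT: "(e i, \<lambda>x. complex_of_real (ev i) * e i x) \<in> T" "ev i \<le> t" if "i < j" for i
    using e that by (auto simp: orthonormal_eigen_def)
  then have eQ: "e i \<in> Q" if "i < j" for i
    using that by (auto simp: eigen_iff)
  have e_ip: "ip (e i) (e k) = (if i = k then 1 else 0)" if "i < j" "k < j" for i k
    using e that by (auto simp: orthonormal_eigen_def)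
  have e_a: "a (e i) (e k) = (if i = k then complex_of_real (ev i) else 0)" if "i < j" "k < j" for i k
    using eT(1)[OF that(1)] eQ[OF that(2)] e_ip[OF that] by (auto simp: eigen_iff)
  have "\<exists>\<rho>>0. \<rho> < 1 \<and> (sqrt t + \<rho>)\<^sup>2 \<le> (t + \<delta>) * (1 - \<rho>)\<^sup>2"
  proof -
    have "((\<lambda>\<rho>. (t + \<delta>) * (1 - \<rho>)\<^sup>2 - (sqrt t + \<rho>)\<^sup>2) \<longlongrightarrow> (t + \<delta>) * (1 - 0)\<^sup>2 - (sqrt t + 0)\<^sup>2) (at_right 0)"
      by (intro tendsto_intros)
    moreover have "0 < (t + \<delta>) * (1 - 0)\<^sup>2 - (sqrt t + 0)\<^sup>2"
      using \<open>0 \<le> t\<close> \<open>0 < \<delta>\<close> by simp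
    ultimately have "\<forall>\<^sub>F \<rho> in at_right 0. 0 < (t + \<delta>) * (1 - \<rho>)\<^sup>2 - (sqrt t + \<rho>)\<^sup>2"
      by (rule order_tendstoD)
    moreover have "\<forall>\<^sub>F \<rho> in at_right (0::real). \<rho> < 1 \<and> 0 < \<rho>"
      by (auto simp: eventually_at_right_field intro: exI[of _ 1])
    ultimately have "\<forall>\<^sub>F \<rho> in at_right (0::real). 0 < \<rho> \<and> \<rho> < 1 \<and> (sqrt t + \<rho>)\<^sup>2 \<le> (t + \<delta>) * (1 - \<rho>)\<^sup>2"
      by eventually_elim auto
    then show ?thesis
      using eventually_happens'[OF trivial_limit_at_right_real] by blast
  qed
  then obtain \<rho> where \<rho>: "0 < \<rho>" "\<rho> < 1" "(sqrt t + \<rho>)\<^sup>2 \<le> (t + \<delta>) * (1 - \<rho>)\<^sup>2"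
    by blast
  define \<eta> where "\<eta> = \<rho> / (real j + 1)"
  have \<eta>: "0 < \<eta>" "real j * \<eta> \<le> \<rho>"
    using \<rho>(1) by (auto simp: \<eta>_def field_simps)
  have "\<forall>i. \<exists>\<phi>. i < j \<longrightarrow> \<phi> \<in> D \<and> sqrt (Re (ip (\<lambda>x. e i x - \<phi> x) (\<lambda>x. e i x - \<phi> x))) \<le> \<eta> \<and>
      sqrt (Re (a (\<lambda>x. e i x - \<phi> x) (\<lambda>x. e i x - \<phi> x))) \<le> \<eta>"
    using dense[OF eQ \<eta>(1)] by blast
  from choice[OF this] obtain \<phi> where \<phi>': "\<forall>i. i < j \<longrightarrow> \<phi> i \<in> D \<and>
      sqrt (Re (ip (\<lambda>x. e i x - \<phi> i x) (\<lambda>x. e i x - \<phi> i x))) \<le> \<eta> \<and>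
      sqrt (Re (a (\<lambda>x. e i x - \<phi> i x) (\<lambda>x. e i x - \<phi> i x))) \<le> \<eta>"
    by (elim exE)
  then have \<phi>: "i < j \<Longrightarrow> \<phi> i \<in> D"
    "i < j \<Longrightarrow> sqrt (Re (ip (\<lambda>x. e i x - \<phi> i x) (\<lambda>x. e i x - \<phi> i x))) \<le> \<eta>"
    "i < j \<Longrightarrow> sqrt (Re (a (\<lambda>x. e i x - \<phi> i x) (\<lambda>x. e i x - \<phi> i x))) \<le> \<eta>" for i
    by auto
  have \<phi>Q: "\<phi> i \<in> Q" if "i < j" for i
    using \<phi>(1)[OF that] D by blast
  have key: "(1 - \<rho>) * sqrt (\<Sum>i<j. (cmod (c i))\<^sup>2) \<le> sqrt (Re (ip v v)) \<and> Re (a v v) \<le> (t + \<delta>) * Re (ip v v)"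
    if v: "v = (\<lambda>x. \<Sum>i<j. c i * \<phi> i x)" for c v
  proof -
    define C where "C = sqrt (\<Sum>i<j. (cmod (c i))\<^sup>2)"
    have C: "0 \<le> C" "C\<^sup>2 = (\<Sum>i<j. (cmod (c i))\<^sup>2)"
      by (auto simp: C_def sum_nonneg)
    define V where "V = (\<lambda>x. \<Sum>i<j. c i * e i x)"
    define d where "d = (\<lambda>x. \<Sum>i<j. c i * (e i x - \<phi> i x))"
    have VQ: "V \<in> Q" and vQ: "v \<in> Q" and dQ: "d \<in> Q"
      unfolding V_def v d_def using eQ \<phi>Q by (auto intro!: sum_in diff_in)
    have "ip V V = (\<Sum>i<j. c i * ip (e i) V)"
      using VQ eQ by (subst (1) V_def) (auto intro!: L2.sum_left)
    also have "\<dots> = (\<Sum>i<j. c i * (\<Sum>k<j. cnj (c k) * ip (e i) (e k)))"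
      unfolding V_def using eQ by (auto intro!: sum.cong L2.sum_right)
    also have "\<dots> = (\<Sum>i<j. c i * cnj (c i))"
    proof (rule sum.cong[OF refl])
      fix i assume "i \<in> {..<j}"
      then have "(\<Sum>k<j. cnj (c k) * ip (e i) (e k)) = (\<Sum>k<j. if k = i then cnj (c k) else 0)"
        by (intro sum.cong) (auto simp: e_ip)
      then show "c i * (\<Sum>k<j. cnj (c k) * ip (e i) (e k)) = c i * cnj (c i)"
        using \<open>i \<in> {..<j}\<close> by simp
    qed
    also have "\<dots> = complex_of_real (C\<^sup>2)"
      unfolding C(2) of_real_sum complex_norm_square ..
    finally have VV: "Re (ip V V) = C\<^sup>2"
      by simp
    have "a V V = (\<Sum>i<j. c i * a (e i) V)"
      using VQ eQ by (subst (1) V_def) (auto intro!: sum_left)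
    also have "\<dots> = (\<Sum>i<j. c i * (\<Sum>k<j. cnj (c k) * a (e i) (e k)))"
      unfolding V_def using eQ by (auto intro!: sum.cong sum_right)
    also have "\<dots> = (\<Sum>i<j. c i * (cnj (c i) * ev i))"
    proof (rule sum.cong[OF refl])
      fix i assume "i \<in> {..<j}"
      then have "(\<Sum>k<j. cnj (c k) * a (e i) (e k)) = (\<Sum>k<j. if k = i then cnj (c k) * ev k else 0)"
        by (intro sum.cong) (auto simp: e_a)
      then show "c i * (\<Sum>k<j. cnj (c k) * a (e i) (e k)) = c i * (cnj (c i) * ev i)"
        using \<open>i \<in> {..<j}\<close> by simp
    qed
    also have "\<dots> = complex_of_real (\<Sum>i<j. ev i * (cmod (c i))\<^sup>2)"
      unfolding of_real_sum of_real_mult complex_norm_square by (simp add: mult_ac)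
    finally have "Re (a V V) = (\<Sum>i<j. ev i * (cmod (c i))\<^sup>2)"
      by (metis Re_complex_of_real)
    also have "\<dots> \<le> (\<Sum>i<j. t * (cmod (c i))\<^sup>2)"
      using eT(2) by (intro sum_mono mult_right_mono) auto
    finally have "Re (a V V) \<le> t * C\<^sup>2"
      by (simp add: C(2) sum_distrib_left)
    then have "sqrt (Re (a V V)) \<le> sqrt (t * C\<^sup>2)"
      by simp
    then have aV: "sqrt (Re (a V V)) \<le> sqrt t * C"
      using C(1) by (simp add: real_sqrt_mult)
    have c_le: "cmod (c i) \<le> C" if "i < j" for i
      unfolding C_def using that by (intro real_le_rsqrt member_le_sum) auto
    have small: "(\<Sum>i<j. cmod (c i) * r i) \<le> \<rho> * C" if "\<And>i. i < j \<Longrightarrow> r i \<le> \<eta>" "\<And>i. i < j \<Longrightarrow> 0 \<le> r i" for r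
    proof -
      have "(\<Sum>i<j. cmod (c i) * r i) \<le> (\<Sum>i<j. C * \<eta>)"
        using that c_le C(1) by (intro sum_mono mult_mono) auto
      also have "\<dots> = (real j * \<eta>) * C"
        by simp
      also have "\<dots> \<le> \<rho> * C"
        using \<eta>(2) C(1) by (intro mult_right_mono)
      finally show ?thesis .
    qed
    have "sqrt (Re (ip d d)) \<le> (\<Sum>i<j. cmod (c i) * sqrt (Re (ip (\<lambda>x. e i x - \<phi> i x) (\<lambda>x. e i x - \<phi> i x))))"
      unfolding d_def by (rule L2.triangle_sum[where u = "\<lambda>i x. e i x - \<phi> i x"]) (use eQ \<phi>Q in auto)
    also have "\<dots> \<le> \<rho> * C"
      using eQ \<phi>Q \<phi>(2) by (intro small) (auto intro!: L2.nonneg)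
    finally have dN: "sqrt (Re (ip d d)) \<le> \<rho> * C" .
    have "sqrt (Re (a d d)) \<le> (\<Sum>i<j. cmod (c i) * sqrt (Re (a (\<lambda>x. e i x - \<phi> i x) (\<lambda>x. e i x - \<phi> i x))))"
      unfolding d_def by (rule triangle_sum[where u = "\<lambda>i x. e i x - \<phi> i x"]) (use eQ \<phi>Q in auto)
    also have "\<dots> \<le> \<rho> * C"
      using eQ \<phi>Q \<phi>(3) by (intro small) (auto intro!: nonneg)
    finally have da: "sqrt (Re (a d d)) \<le> \<rho> * C" .
    have "V = (\<lambda>x. v x + d x)"
      by (auto simp: V_def v d_def sum.distrib[symmetric] algebra_simps)
    then have "C \<le> sqrt (Re (ip v v)) + sqrt (Re (ip d d))"
      using L2.triangle[of v M d] VV C(1) vQ dQ by simp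
    then have lower: "(1 - \<rho>) * C \<le> sqrt (Re (ip v v))"
      using dN by (simp add: algebra_simps)
    have "v = (\<lambda>x. V x + (- d x))"
      by (simp add: \<open>V = (\<lambda>x. v x + d x)\<close>)
    then have "sqrt (Re (a v v)) \<le> sqrt (Re (a V V)) + sqrt (Re (a d d))"
      using triangle[of V "\<lambda>x. - d x"] VQ dQ by (simp add: sesquilinear)
    also have "\<dots> \<le> (sqrt t + \<rho>) * C"
      using aV da by (simp add: algebra_simps)
    finally have "(sqrt (Re (a v v)))\<^sup>2 \<le> ((sqrt t + \<rho>) * C)\<^sup>2"
      using nonneg[OF vQ] by (intro power_mono) auto
    then have "Re (a v v) \<le> (sqrt t + \<rho>)\<^sup>2 * C\<^sup>2"
      using nonneg[OF vQ] by (simp add: power_mult_distrib)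
    also have "\<dots> \<le> ((t + \<delta>) * (1 - \<rho>)\<^sup>2) * C\<^sup>2"
      using \<rho>(3) by (intro mult_right_mono) auto
    also have "\<dots> = (t + \<delta>) * ((1 - \<rho>) * C)\<^sup>2"
      by (simp add: power_mult_distrib)
    also have "\<dots> \<le> (t + \<delta>) * (sqrt (Re (ip v v)))\<^sup>2"
      using lower \<rho>(2) C(1) \<open>0 \<le> t\<close> \<open>0 < \<delta>\<close> by (intro mult_left_mono power_mono) auto
    also have "(sqrt (Re (ip v v)))\<^sup>2 = Re (ip v v)"
      using L2.nonneg[of v M] vQ by simp
    finally show ?thesis
      using lower by (simp add: C_def)
  qed
  have "L2_independent M j \<phi>"
    unfolding L2_independent_def
  proof safe
    fix c :: "nat \<Rightarrow> complex" and i
    assume ae: "AE x in M. (\<Sum>i<j. c i * \<phi> i x) = 0" and i: "i < j"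
    define v where "v = (\<lambda>x. \<Sum>i<j. c i * \<phi> i x)"
    have "v \<in> Q"
      unfolding v_def using \<phi>Q by (intro sum_in) auto
    then have "sqrt (Re (ip v v)) = 0"
      using L2_norm_eq_0_iff[of v M] ae by (simp add: L2_norm_eq v_def)
    then have "(1 - \<rho>) * sqrt (\<Sum>i<j. (cmod (c i))\<^sup>2) \<le> 0"
      using key[OF v_def] by simp
    then have "sqrt (\<Sum>i<j. (cmod (c i))\<^sup>2) \<le> 0"
      using \<rho>(2) by (simp add: mult_le_0_iff)
    then have "(\<Sum>i<j. (cmod (c i))\<^sup>2) = 0"
      using sum_nonneg[of "{..<j}" "\<lambda>i. (cmod (c i))\<^sup>2"] by simp
    then show "c i = 0"
      using i by (simp add: sum_nonneg_eq_0_iff)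
  qed
  with \<phi>(1) key show ?thesis by blast
qed

end

lemma H1_0_dense:
  assumes "open \<Omega>" and u: "u \<in> H1_0 \<Omega>" and "0 < \<eta>"
  shows "\<exists>\<phi>\<in>test_functions \<Omega>. sqrt (Re (L2_inner (lebesgue_on \<Omega>) (\<lambda>x. u x - \<phi> x) (\<lambda>x. u x - \<phi> x))) \<le> \<eta> \<and>
    sqrt (Re (dirichlet_form \<Omega> (\<lambda>x. u x - \<phi> x) (\<lambda>x. u x - \<phi> x))) \<le> \<eta>"
proof -
  interpret D: hermitian_form "H1 \<Omega>" "dirichlet_form \<Omega>"
    using assms(1) by (rule hermitian_form_H1)
  obtain \<phi> where \<phi>: "\<And>n. \<phi> n \<in> test_functions \<Omega>" "(\<lambda>n. H1_norm \<Omega> (\<lambda>x. u x - \<phi> n x)) \<longlonglongrightarrow> 0"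
    using u unfolding H1_0_def by blast
  then obtain n where n: "H1_norm \<Omega> (\<lambda>x. u x - \<phi> n x) < \<eta>"
    using order_tendstoD(2)[OF \<phi>(2) \<open>0 < \<eta>\<close>] by (auto simp: eventually_sequentially)
  define d where "d = (\<lambda>x. u x - \<phi> n x)"
  have "d \<in> H1 \<Omega>"
    unfolding d_def using D.diff_in[OF H1_0_H1[OF u] test_H1(1)[OF assms(1) \<phi>(1)]] .
  then have "0 \<le> Re (dirichlet_form \<Omega> d d)" "0 \<le> Re (L2_inner (lebesgue_on \<Omega>) d d)"
    by (auto intro: D.nonneg L2.nonneg H1_L2)
  then have "sqrt (Re (L2_inner (lebesgue_on \<Omega>) d d)) \<le> H1_norm \<Omega> d" "sqrt (Re (dirichlet_form \<Omega> d d)) \<le> H1_norm \<Omega> d"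
    by (auto simp: H1_norm_eq)
  then show ?thesis
    using n \<phi>(1) by (intro bexI[of _ "\<phi> n"]) (auto simp: d_def)
qed

lemma test_sum: "(\<And>i. i \<in> I \<Longrightarrow> \<phi> i \<in> test_functions \<Omega>) \<Longrightarrow> (\<lambda>x. \<Sum>i\<in>I. c i * \<phi> i x) \<in> test_functions \<Omega>"
proof (induction I rule: infinite_finite_induct)
  case (insert i I)
  then show ?case
    using test_add[OF test_scale[of "\<phi> i" \<Omega> "c i"] insert.IH] by simp
qed (auto intro: test_zero)

text \<open>A common \<open>\<epsilon>\<close> for finitely many test functions, from a margin of the union of their supports.\<close>

lemma transplant_family:
  assumes "0 < N" and "0 < \<theta>" and "\<theta> < \<sigma>" and "\<sigma> < pi / 2"
    and \<phi>: "\<And>i. i < (j::nat) \<Longrightarrow> \<phi> i \<in> test_functions (polyhedral_layer N \<sigma>)"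
  shows "\<exists>\<epsilon>>0. \<forall>i<j. (\<lambda>p. \<phi> i (transplantation.layer_map N \<theta> \<sigma> \<epsilon> p)) \<in> test_functions (polyhedral_layer N \<theta>)"
proof -
  have "\<forall>i. \<exists>K. i < j \<longrightarrow> compact K \<and> K \<subseteq> polyhedral_layer N \<sigma> \<and> (\<forall>x. x \<notin> K \<longrightarrow> \<phi> i x = 0)"
    using \<phi> unfolding test_functions_iff by blast
  from choice[OF this] obtain K where
    K: "\<forall>i. i < j \<longrightarrow> compact (K i) \<and> K i \<subseteq> polyhedral_layer N \<sigma> \<and> (\<forall>x. x \<notin> K i \<longrightarrow> \<phi> i x = 0)"
    by (elim exE)
  define L where "L = (\<Union>i<j. K i)"
  have L: "compact L" "L \<subseteq> polyhedral_layer N \<sigma>" "\<And>i x. i < j \<Longrightarrow> x \<notin> L \<Longrightarrow> \<phi> i x = 0"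
    using K by (auto simp: L_def intro!: compact_UN)
  obtain \<eta> where \<eta>: "0 < \<eta>" "\<And>q. q \<in> L \<Longrightarrow> \<exists>j<N. face_dist N \<sigma> j q < 1 - \<eta>"
    using compact_in_layer_margin[OF assms(1) L(1,2)] by blast
  define r where "r = \<bar>((cos \<theta>)\<^sup>2 - (cos \<sigma>)\<^sup>2) / cos \<theta>\<bar> * ln (real N)"
  have r: "0 \<le> r"
    using assms(1) by (simp add: r_def)
  define \<epsilon> where "\<epsilon> = \<eta> / (r + 1)"
  have \<epsilon>: "0 < \<epsilon>"
    using \<eta>(1) r by (simp add: \<epsilon>_def)
  interpret transplantation N \<theta> \<sigma> \<epsilon>
    using assms \<epsilon> by unfold_locales
  have "((cos \<theta>)\<^sup>2 - (cos \<sigma>)\<^sup>2) / cos \<theta> * (\<epsilon> * ln (real N)) \<le>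
      \<bar>((cos \<theta>)\<^sup>2 - (cos \<sigma>)\<^sup>2) / cos \<theta>\<bar> * (\<epsilon> * ln (real N))"
    using \<epsilon> assms(1) by (intro mult_right_mono abs_ge_self) auto
  also have "\<dots> = \<epsilon> * r"
    unfolding r_def by (rule mult.left_commute)
  also have "\<dots> \<le> \<eta>"
    using r \<eta>(1) by (simp add: \<epsilon>_def field_simps)
  finally have "\<forall>i<j. (\<lambda>p. \<phi> i (layer_map p)) \<in> test_functions (polyhedral_layer N \<theta>)"
    using layer_map_test[OF _ L(1,2) _ \<eta>(2)] L(3) \<phi> by (auto simp: test_functions_iff[of _ "polyhedral_layer N \<sigma>"])
  with \<epsilon> show ?thesis by blast
qed

theorem theorem3:
  fixes N k :: nat and \<theta> \<sigma> :: real
  assumes "N \<ge> 3"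
    and "0 < \<theta>" and "\<theta> < \<sigma>" and "\<sigma> < pi / 2"
    and "layer_has_eigenvalues N \<sigma> k"
    and "layer_has_eigenvalues N \<theta> k"
  shows "\<forall>j\<in>{1..k}. layer_eigenvalue N \<theta> j \<le> layer_eigenvalue N \<sigma> j"
proof
  fix j assume j: "j \<in> {1..k}"
  have N: "0 < N" using assms(1) by simp
  define \<Omega> where "\<Omega> = polyhedral_layer N \<sigma>"
  define \<Omega>' where "\<Omega>' = polyhedral_layer N \<theta>"
  have op: "open \<Omega>" "open \<Omega>'"
    using N by (auto simp: \<Omega>_def \<Omega>'_def open_polyhedral_layer)
  interpret S: form_operator "H1_0 \<Omega>" "dirichlet_form \<Omega>" "lebesgue_on \<Omega>"
    using op(1) by (rule form_operator_H1_0)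
  interpret R: form_operator "H1_0 \<Omega>'" "dirichlet_form \<Omega>'" "lebesgue_on \<Omega>'"
    using op(2) by (rule form_operator_H1_0)
  note ST = dirichlet_laplacian_eq[OF op(1)] and RT = dirichlet_laplacian_eq[OF op(2)]
  have le: "layer_eigenvalue N \<theta> j \<le> t"
    if thr: "ereal t < essential_threshold (lebesgue_on \<Omega>) S.T" and count: "enat j \<le> eigen_count (lebesgue_on \<Omega>) S.T {..t}" for t
  proof (rule field_le_epsilon)
    fix \<delta> :: real assume "0 < \<delta>"
    obtain e ev where e: "S.orthonormal_eigen {..t} j e ev"
      using S.orthonormal_eigen_of_count[OF count] by blast
    have "0 \<le> t"
      using S.eigen_count_ge_imp_nonneg[OF count] j by simp
    have "\<exists>\<phi>. (\<forall>i<j. \<phi> i \<in> test_functions \<Omega>) \<and> L2_independent (lebesgue_on \<Omega>) j \<phi> \<and>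
      (\<forall>c v. v = (\<lambda>x. \<Sum>i<j. c i * \<phi> i x) \<longrightarrow> Re (dirichlet_form \<Omega> v v) \<le> (t + \<delta>) * Re (L2_inner (lebesgue_on \<Omega>) v v))"
      by (rule S.approximate_eigenspace[OF e \<open>0 \<le> t\<close> \<open>0 < \<delta>\<close> H1_0_dense[OF op(1)]])
        (use test_H1_0[OF op(1)] in auto)
    then obtain \<phi> where \<phi>: "\<And>i. i < j \<Longrightarrow> \<phi> i \<in> test_functions \<Omega>" "L2_independent (lebesgue_on \<Omega>) j \<phi>"
      "\<And>c v. v = (\<lambda>x. \<Sum>i<j. c i * \<phi> i x) \<Longrightarrow> Re (dirichlet_form \<Omega> v v) \<le> (t + \<delta>) * Re (L2_inner (lebesgue_on \<Omega>) v v)"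
      by blast
    obtain \<epsilon> where "0 < \<epsilon>"
      and \<psi>: "\<And>i. i < j \<Longrightarrow> (\<lambda>p. \<phi> i (transplantation.layer_map N \<theta> \<sigma> \<epsilon> p)) \<in> test_functions \<Omega>'"
      using transplant_family[OF N assms(2-4), of j \<phi>] \<phi>(1) by (auto simp: \<Omega>_def \<Omega>'_def)
    interpret transplantation N \<theta> \<sigma> \<epsilon>
      using N assms(2-4) \<open>0 < \<epsilon>\<close> by unfold_locales
    define J where "J = \<kappa>\<^sup>2 * \<alpha>"
    have J: "0 < J"
      using pos by (simp add: J_def)
    define \<psi> where "\<psi> i p = \<phi> i (layer_map p)" for i p
    have \<psi>_test: "\<psi> i \<in> test_functions \<Omega>'" if "i < j" for i
      using \<psi>[OF that] by (simp add: \<psi>_def[abs_def])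
    have compare: "J * Re (L2_inner (lebesgue_on \<Omega>') w w) = Re (L2_inner (lebesgue_on \<Omega>) v v)"
      "J * Re (dirichlet_form \<Omega>' w w) \<le> Re (dirichlet_form \<Omega> v v)"
      if "v = (\<lambda>x. \<Sum>i<j. c i * \<phi> i x)" "w = (\<lambda>x. \<Sum>i<j. c i * \<psi> i x)" for c v w
    proof -
      have v: "v \<in> test_functions \<Omega>" and w: "w \<in> test_functions \<Omega>'"
        unfolding that using \<phi>(1) \<psi>_test by (auto intro!: test_sum)
      have wv: "w = (\<lambda>p. v (layer_map p))"
        by (simp add: that \<psi>_def)
      show "J * Re (L2_inner (lebesgue_on \<Omega>') w w) = Re (L2_inner (lebesgue_on \<Omega>) v v)"
        unfolding L2_inner_test[OF op(1) v] L2_inner_test[OF op(2) w] J_def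
        unfolding wv by (rule transplanted_norm[OF v])
      show "J * Re (dirichlet_form \<Omega>' w w) \<le> Re (dirichlet_form \<Omega> v v)"
        unfolding dirichlet_form_test[OF op(1) v] dirichlet_form_test[OF op(2) w] J_def
        unfolding wv by (rule transplanted_form[OF v w[unfolded wv]])
    qed
    have bound: "Re (dirichlet_form \<Omega>' w w) \<le> (t + \<delta>) * Re (L2_inner (lebesgue_on \<Omega>') w w)"
      if w: "w = (\<lambda>x. \<Sum>i<j. c i * \<psi> i x)" for c w
    proof -
      define v where "v = (\<lambda>x. \<Sum>i<j. c i * \<phi> i x)"
      have "J * Re (dirichlet_form \<Omega>' w w) \<le> Re (dirichlet_form \<Omega> v v)"
        by (rule compare(2)[OF v_def w])
      also have "\<dots> \<le> (t + \<delta>) * Re (L2_inner (lebesgue_on \<Omega>) v v)"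
        by (rule \<phi>(3)[OF v_def])
      also have "\<dots> = J * ((t + \<delta>) * Re (L2_inner (lebesgue_on \<Omega>') w w))"
        unfolding compare(1)[OF v_def w, symmetric] by (rule mult.left_commute)
      finally show ?thesis
        using J by simp
    qed
    have indep: "L2_independent (lebesgue_on \<Omega>') j \<psi>"
      unfolding L2_independent_def
    proof (intro allI impI)
      fix c :: "nat \<Rightarrow> complex" and i
      assume ae: "AE x in lebesgue_on \<Omega>'. (\<Sum>i<j. c i * \<psi> i x) = 0" and i: "i < j"
      define v where "v = (\<lambda>x. \<Sum>i<j. c i * \<phi> i x)"
      define w where "w = (\<lambda>x. \<Sum>i<j. c i * \<psi> i x)"
      have vL: "v \<in> L2_space (lebesgue_on \<Omega>)" and wL: "w \<in> L2_space (lebesgue_on \<Omega>')"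
        unfolding v_def w_def using \<phi>(1) \<psi>_test op by (auto intro!: test_L2 test_sum)
      have "Re (L2_inner (lebesgue_on \<Omega>') w w) = 0"
        using L2_norm_eq_0_iff[OF wL] ae by (simp add: L2_norm_eq w_def)
      then have "Re (L2_inner (lebesgue_on \<Omega>) v v) = 0"
        using compare(1)[OF v_def w_def] by simp
      then have "AE x in lebesgue_on \<Omega>. v x = 0"
        using L2_norm_eq_0_iff[OF vL] by (simp add: L2_norm_eq)
      then show "c i = 0"
        using \<phi>(2) i unfolding L2_independent_def v_def by blast
    qed
    \<comment> \<open>only values below the threshold for \<open>\<theta>\<close> need the variational principle, because the \<open>j\<close>-th
      eigenvalue exists and lies below this threshold\<close>
    show "layer_eigenvalue N \<theta> j \<le> t + \<delta>"
    proof (cases "ereal (t + \<delta>) < essential_threshold (lebesgue_on \<Omega>') R.T")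
      case True
      have "enat j \<le> eigen_count (lebesgue_on \<Omega>') R.T {..t + \<delta>}"
        by (rule R.form_bound_imp_eigen_count[OF _ indep bound True]) (use \<psi>_test op(2) in \<open>auto intro: test_H1_0\<close>)
      then show ?thesis
        using R.nth_eigenvalue_le[OF _ True] j by (simp add: layer_eigenvalue_def RT flip: \<Omega>'_def)
    next
      case False
      obtain s where s: "ereal s < essential_threshold (lebesgue_on \<Omega>') R.T" "enat j \<le> eigen_count (lebesgue_on \<Omega>') R.T {..s}"
        using R.has_eigenvalues_imp_count[of k j] assms(6) j
        by (auto simp: layer_has_eigenvalues_def RT simp flip: \<Omega>'_def)
      then have "layer_eigenvalue N \<theta> j \<le> s"
        using R.nth_eigenvalue_le j by (simp add: layer_eigenvalue_def RT flip: \<Omega>'_def)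
      also have "s \<le> t + \<delta>"
      proof -
        have "ereal s < ereal (t + \<delta>)"
          by (rule less_le_trans[OF s(1)]) (use False in \<open>simp add: not_less\<close>)
        then show ?thesis by simp
      qed
      finally show ?thesis .
    qed
  qed
  have "\<exists>t. ereal t < essential_threshold (lebesgue_on \<Omega>) S.T \<and> enat j \<le> eigen_count (lebesgue_on \<Omega>) S.T {..t}"
    using S.has_eigenvalues_imp_count[of k j] assms(5) j
    by (auto simp: layer_has_eigenvalues_def ST simp flip: \<Omega>_def)
  then show "layer_eigenvalue N \<theta> j \<le> layer_eigenvalue N \<sigma> j"
    unfolding layer_eigenvalue_def[of N \<sigma>] nth_eigenvalue_def \<Omega>_def[symmetric] ST
    using le by (intro cInf_greatest) auto
qed

end
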